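(* Let $H$ be a separable complex Hilbert space, let $\mathcal{N}$ be a weakly closed $*$-subalgebra of $\mathcal{L}(H)$, let $\mathcal{J}$ be a two-sided ideal of compact operators on $H$ containing the finite rank operators, let $0<T\in\mathcal{J}$, and let $\mathrm{f}$ be a positive singular trace on $\mathcal{J}$. If there is $h\in H$ such that $T$ is $(\mathcal{N},h)$-dominated, then the functional $\Phi_{\mathrm{f},T}=\mathrm{f}(\,\cdot\,T)$, i.e. $a\mapsto \mathrm{f}(aT)$ for $a\in\mathcal{N}$, belongs to $\mathcal{N}_*$.
   Context: $\mathcal{L}(H)$ is the algebra of bounded linear operators on $H$, and $\mathcal{N}_*$ denotes the predual of $\mathcal{N}$, that is, the set of all normal linear functionals on $\mathcal{N}$. A trace on a two-sided ideal $\mathcal{J}$ of compact operators is a linear functional $\mathrm{f}:\mathcal{J}\to\mathbb{C}$ with $\mathrm{f}(aS-Sa)=0$ for all $a\in\mathcal{L}(H)$, $S\in\mathcal{J}$ (no continuity assumed). A singular trace is a trace on an ideal containing the finite rank operators that vanishes on all finite rank operators. It is positive if $\mathrm{f}(S)\ge0$ for all $0\le S\in\mathcal{J}$. A positive compact operator $T$ is called $(\mathcal{N},h)$-dominated, where $h\in H$, if for some orthonormal basis $\{h_m\}_{m=1}^\infty$ of $H$ consisting of eigenvectors of $T$ one has $\|Ph_m\|\le\|Ph\|$ for all $m$ and all projections $P\in\mathcal{N}$. *)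

theory Defs
  imports "HOL-Analysis.Analysis"
begin

section \<open>Complex Hilbert spaces\<close>

class complex_vector = real_vector +
  fixes scaleC :: "complex \<Rightarrow> 'a \<Rightarrow> 'a"  (infixr "*\<^sub>C" 75)
  assumes scaleC_add_right: "a *\<^sub>C (x + y) = a *\<^sub>C x + a *\<^sub>C y"
    and scaleC_add_left: "(a + b) *\<^sub>C x = a *\<^sub>C x + b *\<^sub>C x"
    and scaleC_scaleC: "a *\<^sub>C (b *\<^sub>C x) = (a * b) *\<^sub>C x"
    and scaleC_one: "1 *\<^sub>C x = x"
    and scaleR_scaleC: "r *\<^sub>R x = complex_of_real r *\<^sub>C x"

global_interpretation complex_vector: vector_space "scaleC :: complex \<Rightarrow> 'a \<Rightarrow> 'a::complex_vector"
  by unfold_locales (simp_all add: scaleC_add_right scaleC_add_left scaleC_scaleC scaleC_one)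

text \<open>The inner product is linear in the second argument and conjugate linear in the first.
  Positive definiteness is implied by the last axiom, which ties the inner product to the norm.\<close>

class complex_hilbert_space = complex_vector + banach +
  fixes cinner :: "'a \<Rightarrow> 'a \<Rightarrow> complex"
  assumes cinner_commute: "cinner x y = cnj (cinner y x)"
    and cinner_add_right: "cinner x (y + z) = cinner x y + cinner x z"
    and cinner_scaleC_right: "cinner x (c *\<^sub>C y) = c * cinner x y"
    and cinner_self: "cinner x x = complex_of_real ((norm x)\<^sup>2)"

instantiation complex :: complex_hilbert_space
begin

definition scaleC_complex :: "complex \<Rightarrow> complex \<Rightarrow> complex"
  where "scaleC_complex c z = c * z"

definition cinner_complex :: "complex \<Rightarrow> complex \<Rightarrow> complex"
  where "cinner_complex x y = cnj x * y"

instance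
  by standard
    (simp_all add: scaleC_complex_def cinner_complex_def algebra_simps scaleR_conv_of_real
      complex_norm_square flip: of_real_power)

end

definition orthonormal_basis :: "'a::complex_hilbert_space set \<Rightarrow> bool"
  where "orthonormal_basis B \<longleftrightarrow>
    (\<forall>x\<in>B. \<forall>y\<in>B. cinner x y = (if x = y then 1 else 0)) \<and>
    closure (complex_vector.span B) = UNIV"


section \<open>Operators\<close>

text \<open>Operators on \<open>H\<close> are functions \<open>H \<Rightarrow> H\<close> with pointwise linear structure and
  composition as product.\<close>

definition bounded_operators :: "('a::complex_hilbert_space \<Rightarrow> 'a) set"
  where "bounded_operators = {A. bounded_linear A \<and> (\<forall>c x. A (c *\<^sub>C x) = c *\<^sub>C A x)}"

definition compact_operators :: "('a::complex_hilbert_space \<Rightarrow> 'a) set"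
  where "compact_operators = {A \<in> bounded_operators. compact (closure (A ` cball 0 1))}"

definition finite_rank_operators :: "('a::complex_hilbert_space \<Rightarrow> 'a) set"
  where "finite_rank_operators =
    {A \<in> bounded_operators. \<exists>F. finite F \<and> range A \<subseteq> complex_vector.span F}"

definition is_adjoint :: "('a::complex_hilbert_space \<Rightarrow> 'a) \<Rightarrow> ('a \<Rightarrow> 'a) \<Rightarrow> bool"
  where "is_adjoint A B \<longleftrightarrow> (\<forall>x y. cinner (A x) y = cinner x (B y))"

definition projection_operators :: "('a::complex_hilbert_space \<Rightarrow> 'a) set"
  where "projection_operators = {P \<in> bounded_operators. P \<circ> P = P \<and> is_adjoint P P}"

definition positive_operators :: "('a::complex_hilbert_space \<Rightarrow> 'a) set"
  where "positive_operators = {A \<in> bounded_operators. \<forall>x. cinner x (A x) \<in> \<real>\<^sub>\<ge>\<^sub>0}"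

definition operator_subspace :: "('a::complex_hilbert_space \<Rightarrow> 'a) set \<Rightarrow> bool"
  where "operator_subspace V \<longleftrightarrow> V \<subseteq> bounded_operators \<and> (\<lambda>_. 0) \<in> V \<and>
    (\<forall>A\<in>V. \<forall>B\<in>V. (\<lambda>x. A x + B x) \<in> V) \<and> (\<forall>c. \<forall>A\<in>V. (\<lambda>x. c *\<^sub>C A x) \<in> V)"

definition linear_functional_on ::
  "('a::complex_hilbert_space \<Rightarrow> 'a) set \<Rightarrow> (('a \<Rightarrow> 'a) \<Rightarrow> complex) \<Rightarrow> bool"
  where "linear_functional_on V f \<longleftrightarrow>
    (\<forall>A\<in>V. \<forall>B\<in>V. f (\<lambda>x. A x + B x) = f A + f B) \<and>
    (\<forall>c. \<forall>A\<in>V. f (\<lambda>x. c *\<^sub>C A x) = c * f A)"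


section \<open>Weakly closed star-algebras and their preduals\<close>

definition weak_operator_topology :: "('a::complex_hilbert_space \<Rightarrow> 'a) topology"
  where "weak_operator_topology = topology_generated_by
    {{A \<in> bounded_operators. cinner x (A y) \<in> U} | x y U. open U}"

text \<open>Generated by the functionals \<open>A \<mapsto> \<Sum>n. \<langle>x\<^sub>n, A y\<^sub>n\<rangle>\<close> with square-summable \<open>x\<close> and \<open>y\<close>;
  by the Cauchy--Schwarz inequality these series converge absolutely.\<close>

definition ultraweak_topology :: "('a::complex_hilbert_space \<Rightarrow> 'a) topology"
  where "ultraweak_topology = topology_generated_by
    {{A \<in> bounded_operators. (\<Sum>n. cinner (x n) (A (y n))) \<in> U} | (x :: nat \<Rightarrow> 'a) y U.
      summable (\<lambda>n. (norm (x n))\<^sup>2) \<and> summable (\<lambda>n. (norm (y n))\<^sup>2) \<and> open U}"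

text \<open>The algebra is not required to contain the identity operator.\<close>

definition weakly_closed_star_subalgebra :: "('a::complex_hilbert_space \<Rightarrow> 'a) set \<Rightarrow> bool"
  where "weakly_closed_star_subalgebra N \<longleftrightarrow> operator_subspace N \<and>
    (\<forall>A\<in>N. \<forall>B\<in>N. A \<circ> B \<in> N) \<and> (\<forall>A\<in>N. \<exists>B\<in>N. is_adjoint A B) \<and>
    closedin weak_operator_topology N"

text \<open>Normal means ultraweakly continuous. A functional on \<open>N\<close> is a total function of which only
  the values on \<open>N\<close> matter.\<close>

definition predual ::
  "('a::complex_hilbert_space \<Rightarrow> 'a) set \<Rightarrow> (('a \<Rightarrow> 'a) \<Rightarrow> complex) set"
  where "predual N = {\<phi>. linear_functional_on N \<phi> \<and>
    continuous_map (subtopology ultraweak_topology N) euclidean \<phi>}"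


section \<open>Ideals and singular traces\<close>

definition compact_ideal :: "('a::complex_hilbert_space \<Rightarrow> 'a) set \<Rightarrow> bool"
  where "compact_ideal J \<longleftrightarrow> operator_subspace J \<and> J \<subseteq> compact_operators \<and>
    (\<forall>a\<in>bounded_operators. \<forall>S\<in>J. a \<circ> S \<in> J \<and> S \<circ> a \<in> J)"

definition trace_on ::
  "('a::complex_hilbert_space \<Rightarrow> 'a) set \<Rightarrow> (('a \<Rightarrow> 'a) \<Rightarrow> complex) \<Rightarrow> bool"
  where "trace_on J f \<longleftrightarrow> linear_functional_on J f \<and>
    (\<forall>a\<in>bounded_operators. \<forall>S\<in>J. f (\<lambda>x. a (S x) - S (a x)) = 0)"

definition singular_trace_on ::
  "('a::complex_hilbert_space \<Rightarrow> 'a) set \<Rightarrow> (('a \<Rightarrow> 'a) \<Rightarrow> complex) \<Rightarrow> bool"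
  where "singular_trace_on J f \<longleftrightarrow> trace_on J f \<and> (\<forall>S\<in>finite_rank_operators. f S = 0)"

definition positive_functional_on ::
  "('a::complex_hilbert_space \<Rightarrow> 'a) set \<Rightarrow> (('a \<Rightarrow> 'a) \<Rightarrow> complex) \<Rightarrow> bool"
  where "positive_functional_on J f \<longleftrightarrow> (\<forall>S \<in> J \<inter> positive_operators. f S \<in> \<real>\<^sub>\<ge>\<^sub>0)"


section \<open>Domination\<close>

text \<open>The basis is given as a set, which is countable when \<open>H\<close> is separable, instead of as a
  sequence. This also covers finite-dimensional \<open>H\<close>.\<close>

definition dominated ::
  "('a::complex_hilbert_space \<Rightarrow> 'a) set \<Rightarrow> 'a \<Rightarrow> ('a \<Rightarrow> 'a) \<Rightarrow> bool"
  where "dominated N h T \<longleftrightarrow> T \<in> positive_operators \<inter> compact_operators \<and>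
    (\<exists>B. orthonormal_basis B \<and> (\<forall>b\<in>B. \<exists>l. T b = l *\<^sub>C b) \<and>
      (\<forall>b\<in>B. \<forall>P \<in> N \<inter> projection_operators. norm (P b) \<le> norm (P h)))"

end

theory Submission
  imports Defs
begin

text \<open>For \<open>a \<in> N\<close> the number \<open>f (a T)\<close> is bounded by a constant times \<open>\<parallel>a h\<parallel>\<close>. Hence
  \<open>a h \<mapsto> f (a T)\<close> is a well-defined bounded linear functional on the subspace \<open>N h\<close>, and by the
  theorem of Riesz (\<open>Riesz_on_subspace\<close>) there is a vector \<open>y\<close> with \<open>f (a T) = \<langle>y, a h\<rangle>\<close> on \<open>N\<close>.
  Such a functional is ultraweakly continuous.

  The form \<open>(b, a) \<mapsto> f (b\<^sup>* a T)\<close> is positive semidefinite, so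
  \<open>\<bar>f (a T)\<bar>\<^sup>2 \<le> f (T) f (a\<^sup>* a T)\<close> (\<open>trace_Cauchy_Schwarz\<close>). This reduces the bound to
  \<open>f (a T) \<le> K \<langle>h, a h\<rangle>\<close> for \<open>0 \<le> a \<in> N\<close>, which results from two independent facts about an
  orthonormal basis \<open>B\<close> of eigenvectors of \<open>T\<close>.

  The first fact is \<open>\<langle>b, a b\<rangle> \<le> \<langle>h, a h\<rangle>\<close> for \<open>b \<in> B\<close> (\<open>projection_domination_extends\<close>). Domination
  is this inequality for projections. The general case follows by scaling to \<open>a \<le> 1\<close> and expanding
  \<open>a\<close> as a series \<open>\<Sum>k. 2\<^sup>-\<^sup>k P\<^sub>k\<close> with spectral projections \<open>P\<^sub>k \<in> N\<close>.

  The second fact concerns the trace only: if \<open>a \<ge> 0\<close> and \<open>\<langle>b, a b\<rangle> \<le> \<epsilon>\<close> for all \<open>b \<in> B\<close>, then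
  \<open>f (a T) \<le> K \<epsilon>\<close> (\<open>trace_le_eigenbasis_bound\<close>). The eigenvalues of \<open>T\<close> may be rounded to powers of 2,
  which replaces \<open>T\<close> by a multiple of an operator \<open>D\<close> with finite-dimensional eigenspaces for the
  eigenvalues \<open>2\<^sup>-\<^sup>j\<close>. If the compression of \<open>a\<close> to each of these eigenspaces is at most \<open>\<delta>\<close>, then
  \<open>f (a D) \<le> 2 \<delta> f (D)\<close>, because the eigenvalues of \<open>a\<^sup>1\<^sup>/\<^sup>2 D a\<^sup>1\<^sup>/\<^sup>2\<close> are at most \<open>2 \<delta>\<close> times
  those of \<open>D\<close> by the min-max principle (\<open>trace_le_level_bound\<close>). A bound \<open>\<epsilon>\<close> on the diagonal
  entries does not bound the compressions, but it bounds their normalised traces, and therefore at most half of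
  the eigenvalues of each compression exceed \<open>2 \<epsilon>\<close>. A unitary that commutes with \<open>D\<close> can exchange the
  large eigenvalues with small ones. Averaging \<open>a\<close> with its conjugate by this unitary leaves \<open>f (a D)\<close>
  unchanged and improves the bound from \<open>\<delta>\<close> to \<open>\<delta> / 2 + \<epsilon>\<close> (\<open>halving\<close>). Repetition brings the bound
  arbitrarily close to \<open>2 \<epsilon>\<close>, for all eigenspaces simultaneously.\<close>

section \<open>Inner products\<close>

text \<open>The common source of all Cauchy--Schwarz inequalities below: a positive semidefinite form
  evaluated at \<open>x + t y\<close> is the given polynomial in \<open>t\<close>, and \<open>t = - cnj z / q\<close> is the best choice.\<close>

lemma nonneg_form_bound:
  fixes p q :: real and z w :: complex
  assumes pos: "\<And>t. complex_of_real p + t * z + cnj t * w + complex_of_real ((cmod t)\<^sup>2 * q) \<in> \<real>\<^sub>\<ge>\<^sub>0"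
  shows "w = cnj z" and "(cmod z)\<^sup>2 \<le> p * q"
proof -
  have im: "Im (t * z + cnj t * w) = 0" for t
    using pos[of t] by (simp add: complex_nonneg_Reals_iff)
  show w: "w = cnj z"
    using im[of 1] im[of \<i>] by (simp add: complex_eq_iff)
  have re: "0 \<le> p + 2 * Re (t * z) + (cmod t)\<^sup>2 * q" for t
    using pos[of t] by (simp add: w complex_nonneg_Reals_iff)
  have zz: "Re (cnj z * z) = (cmod z)\<^sup>2"
    by (metis complex_norm_square mult.commute Re_complex_of_real)
  have line: "0 \<le> p - 2 * s * (cmod z)\<^sup>2 + s\<^sup>2 * (cmod z)\<^sup>2 * q" for s :: real
  proof -
    have "Re (- (complex_of_real s * cnj z) * z) = - s * (cmod z)\<^sup>2"
      unfolding zz[symmetric] by (simp add: algebra_simps)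
    then show ?thesis
      using re[of "- (complex_of_real s * cnj z)"] by (simp add: norm_mult power_mult_distrib)
  qed
  have p: "0 \<le> p" using re[of 0] by simp
  show "(cmod z)\<^sup>2 \<le> p * q"
  proof (cases "q > 0")
    case True
    from line[of "1 / q"] have "0 \<le> p - (cmod z)\<^sup>2 / q"
      using True by (simp add: power2_eq_square field_simps)
    then show ?thesis using True by (simp add: field_simps)
  next
    case False
    have "(cmod z)\<^sup>2 = 0"
    proof (rule ccontr)
      assume nz: "(cmod z)\<^sup>2 \<noteq> 0"
      define s where "s = (p + 1) / (cmod z)\<^sup>2"
      have "s * (cmod z)\<^sup>2 = p + 1" using nz by (simp add: s_def)
      moreover have "s\<^sup>2 * (cmod z)\<^sup>2 * q \<le> 0"
        using False by (intro mult_nonneg_nonpos) auto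
      ultimately show False using line[of s] p by linarith
    qed
    moreover have "0 \<le> p * q"
    proof -
      have "0 \<le> q"
      proof (rule ccontr)
        assume "\<not> 0 \<le> q"
        define t where "t = complex_of_real (sqrt ((p + 1) / - q))"
        have "(cmod t)\<^sup>2 = (p + 1) / - q"
          using p \<open>\<not> 0 \<le> q\<close> by (simp add: t_def real_sqrt_pow2 divide_nonneg_neg)
        then have "(cmod t)\<^sup>2 * q = - (p + 1)"
          using \<open>\<not> 0 \<le> q\<close> by (simp add: field_simps)
        with re[of t] \<open>(cmod z)\<^sup>2 = 0\<close> show False by simp
      qed
      then show ?thesis using p by simp
    qed
    ultimately show ?thesis by simp
  qed
qed

lemma cinner_add_left: "cinner (x + y) z = cinner x z + cinner y z"
  by (metis cinner_commute cinner_add_right complex_cnj_add)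

lemma cinner_scaleC_left: "cinner (c *\<^sub>C x) y = cnj c * cinner x y"
  by (metis cinner_commute cinner_scaleC_right complex_cnj_mult)

lemma cinner_scaleR_left: "cinner (r *\<^sub>R x) y = of_real r * cinner x y"
  by (simp add: scaleR_scaleC cinner_scaleC_left)

lemma cinner_scaleR_right: "cinner x (r *\<^sub>R y) = of_real r * cinner x y"
  by (simp add: scaleR_scaleC cinner_scaleC_right)

lemma Re_cinner_self: "Re (cinner x x) = (norm x)\<^sup>2"
  by (simp add: cinner_self)

theorem Cauchy_Schwarz_cinner: "cmod (cinner x y) \<le> norm x * norm y"
proof -
  have "complex_of_real ((norm x)\<^sup>2) + t * cinner x y + cnj t * cinner y x
      + complex_of_real ((cmod t)\<^sup>2 * (norm y)\<^sup>2) \<in> \<real>\<^sub>\<ge>\<^sub>0" for t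
  proof -
    have "cinner (x + t *\<^sub>C y) (x + t *\<^sub>C y) = complex_of_real ((norm x)\<^sup>2) + t * cinner x y
        + cnj t * cinner y x + complex_of_real ((cmod t)\<^sup>2 * (norm y)\<^sup>2)"
      unfolding of_real_mult complex_norm_square cinner_self[symmetric]
      by (simp add: cinner_add_left cinner_add_right cinner_scaleC_left cinner_scaleC_right
          algebra_simps)
    then show ?thesis by (metis cinner_self nonneg_Reals_of_real_iff zero_le_power2)
  qed
  from nonneg_form_bound(2)[OF this] have "(cmod (cinner x y))\<^sup>2 \<le> (norm x * norm y)\<^sup>2"
    by (simp add: power_mult_distrib)
  then show ?thesis by (rule power2_le_imp_le) simp
qed

interpretation cinner: bounded_bilinear "cinner :: 'a::complex_hilbert_space \<Rightarrow> 'a \<Rightarrow> complex"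
proof
  show "\<exists>K. \<forall>a b::'a. cmod (cinner a b) \<le> norm a * norm b * K"
    by (rule exI[of _ 1]) (simp add: Cauchy_Schwarz_cinner)
qed (simp_all add: cinner_add_left cinner_add_right cinner_scaleR_left cinner_scaleR_right
    scaleR_conv_of_real)

lemmas cinner_simps = cinner.add_left cinner.add_right cinner.diff_left cinner.diff_right
  cinner.minus_left cinner.minus_right cinner_scaleC_left cinner_scaleC_right
  cinner_scaleR_left cinner_scaleR_right

lemma norm_scaleC: "norm (c *\<^sub>C (x::'a::complex_hilbert_space)) = cmod c * norm x"
proof -
  have "complex_of_real ((norm (c *\<^sub>C x))\<^sup>2) = complex_of_real ((cmod c * norm x)\<^sup>2)"
    unfolding power_mult_distrib of_real_mult complex_norm_square cinner_self[symmetric]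
    by (simp add: cinner_simps)
  then have "(norm (c *\<^sub>C x))\<^sup>2 = (cmod c * norm x)\<^sup>2" using of_real_eq_iff by blast
  then show ?thesis by (simp add: power2_eq_iff_nonneg)
qed

interpretation scaleC: bounded_bilinear "scaleC :: complex \<Rightarrow> 'a \<Rightarrow> 'a::complex_hilbert_space"
proof
  show "\<exists>K. \<forall>a (b::'a). norm (a *\<^sub>C b) \<le> cmod a * norm b * K"
    by (rule exI[of _ 1]) (simp add: norm_scaleC)
next
  fix r :: real and a :: complex and b :: 'a
  show "(r *\<^sub>R a) *\<^sub>C b = r *\<^sub>R (a *\<^sub>C b)"
    by (simp add: scaleR_scaleC[of r "a *\<^sub>C b"] scaleC_scaleC scaleR_conv_of_real)
  show "a *\<^sub>C (r *\<^sub>R b) = r *\<^sub>R (a *\<^sub>C b)"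
    by (simp add: scaleR_scaleC[where 'a='a] scaleC_scaleC mult.commute)
qed (simp_all add: scaleC_add_left scaleC_add_right)

lemma norm_diff_squared:
  "(norm (x - y))\<^sup>2 = (norm x)\<^sup>2 + (norm y)\<^sup>2 - 2 * Re (cinner x y)"
proof -
  have "Re (cinner (x - y) (x - y)) = (norm x)\<^sup>2 + (norm y)\<^sup>2 - Re (cinner x y) - Re (cinner y x)"
    by (simp add: cinner_simps Re_cinner_self)
  moreover have "Re (cinner y x) = Re (cinner x y)" by (metis cinner_commute cnj.simps(1))
  ultimately show ?thesis by (simp add: Re_cinner_self)
qed

lemma norm_add_squared:
  "(norm (x + y))\<^sup>2 = (norm x)\<^sup>2 + (norm y)\<^sup>2 + 2 * Re (cinner x y)"
  using norm_diff_squared[of x "- y"] by (simp add: cinner_simps)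

lemma cinner_zero_commute: "cinner x y = 0 \<longleftrightarrow> cinner y x = 0"
  by (metis cinner_commute complex_cnj_zero)

lemma Re_cinner_commute: "Re (cinner x y) = Re (cinner y x)"
  by (metis cinner_commute cnj.simps(1))

lemma convergent_of_squared_differences:
  fixes X :: "nat \<Rightarrow> 'a::banach"
  assumes le: "\<And>m n. m \<le> n \<Longrightarrow> (norm (X n - X m))\<^sup>2 \<le> p m + p n" and p: "p \<longlonglongrightarrow> 0"
  shows "convergent X"
  unfolding Cauchy_convergent_iff[symmetric]
proof (rule CauchyI')
  fix e :: real assume e: "e > 0"
  then have "e\<^sup>2 / 2 > 0" by simp
  from LIMSEQ_D[OF p this] obtain N where N: "\<And>n. n \<ge> N \<Longrightarrow> \<bar>p n\<bar> < e\<^sup>2 / 2" by auto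
  have "dist (X m) (X n) < e" if "m \<ge> N" "m < n" for m n
  proof -
    have "(norm (X n - X m))\<^sup>2 < e\<^sup>2 / 2 + e\<^sup>2 / 2"
      using le[of m n] N[of m] N[of n] that by linarith
    then show ?thesis using e by (simp add: dist_norm norm_minus_commute power2_less_imp_less)
  qed
  then show "\<exists>M. \<forall>m\<ge>M. \<forall>n>m. dist (X m) (X n) < e" by blast
qed

text \<open>The vector is the limit of a minimising sequence of \<open>\<parallel>v\<parallel>\<^sup>2 - 2 Re (g v)\<close>, which is a Cauchy
  sequence by the parallelogram law. Its limit may lie outside of the subspace.\<close>

theorem Riesz_on_subspace:
  fixes V :: "'a::complex_hilbert_space set" and g :: "'a \<Rightarrow> complex"
  assumes V0: "0 \<in> V" and Vadd: "\<And>x y. x \<in> V \<Longrightarrow> y \<in> V \<Longrightarrow> x + y \<in> V"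
    and Vscale: "\<And>c x. x \<in> V \<Longrightarrow> c *\<^sub>C x \<in> V"
    and gadd: "\<And>x y. x \<in> V \<Longrightarrow> y \<in> V \<Longrightarrow> g (x + y) = g x + g y"
    and gscale: "\<And>c x. x \<in> V \<Longrightarrow> g (c *\<^sub>C x) = c * g x"
    and bound: "\<And>x. x \<in> V \<Longrightarrow> cmod (g x) \<le> K * norm x"
  shows "\<exists>y. \<forall>x\<in>V. g x = cinner y x"
proof -
  define F where "F x = (norm x)\<^sup>2 - 2 * Re (g x)" for x
  have VscaleR: "r *\<^sub>R x \<in> V" if "x \<in> V" for r x
    using Vscale[OF that] by (simp add: scaleR_scaleC)
  have gscaleR: "g (r *\<^sub>R x) = of_real r * g x" if "x \<in> V" for r x
    using gscale[OF that] by (simp add: scaleR_scaleC)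
  have Flow: "- K\<^sup>2 \<le> F x" if "x \<in> V" for x
  proof -
    have "Re (g x) \<le> K * norm x" using bound[OF that] complex_Re_le_cmod order_trans by blast
    moreover have "0 \<le> (norm x - K)\<^sup>2" by simp
    ultimately show ?thesis by (simp add: F_def power2_diff algebra_simps)
  qed
  define m where "m = Inf (F ` V)"
  have bdd: "bdd_below (F ` V)" by (rule bdd_belowI[of _ "- K\<^sup>2"]) (use Flow in auto)
  have mle: "m \<le> F x" if "x \<in> V" for x
    unfolding m_def by (rule cInf_lower) (use that bdd in auto)
  have "\<exists>x\<in>V. F x < m + 1 / Suc n" for n
    using cInf_lessD[of "F ` V" "m + 1 / Suc n"] V0 by (auto simp: m_def)
  then obtain v where v: "\<And>n. v n \<in> V" and vF: "\<And>n. F (v n) < m + 1 / Suc n" by metis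
  have par: "(norm (v i - v j))\<^sup>2 \<le> 2 * (1 / Suc i) + 2 * (1 / Suc j)" for i j
  proof -
    define w where "w = (1/2) *\<^sub>R (v i + v j)"
    have w: "w \<in> V" unfolding w_def by (intro VscaleR Vadd v)
    have nw: "norm w = norm (v i + v j) / 2" by (simp add: w_def del: scaleR_right_distrib)
    have "g w = complex_of_real (1 / 2) * (g (v i) + g (v j))"
      unfolding w_def by (subst gscaleR) (auto simp: Vadd v gadd)
    then have gw: "Re (g w) = (Re (g (v i)) + Re (g (v j))) / 2"
      by (simp del: of_real_divide)
    have "F w = (norm (v i + v j))\<^sup>2 / 4 - Re (g (v i)) - Re (g (v j))"
      by (simp add: F_def nw gw power_divide add_divide_distrib)
    then have "(norm (v i - v j))\<^sup>2 = 2 * F (v i) + 2 * F (v j) - 4 * F w"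
      by (simp add: F_def norm_add_squared norm_diff_squared field_simps)
    also have "\<dots> \<le> 2 * (m + 1 / Suc i) + 2 * (m + 1 / Suc j) - 4 * m"
      by (intro diff_mono add_mono mult_left_mono less_imp_le[OF vF] mle[OF w]) auto
    finally show ?thesis by simp
  qed
  have "convergent v"
  proof (rule convergent_of_squared_differences)
    show "(norm (v n - v m))\<^sup>2 \<le> 2 * (1 / Suc m) + 2 * (1 / Suc n)" for m n
      using par[of n m] by simp
    show "(\<lambda>n. 2 * (1 / real (Suc n))) \<longlonglongrightarrow> 0"
      by (intro tendsto_mult_right_zero LIMSEQ_Suc[OF lim_1_over_n])
  qed
  then obtain y where y: "v \<longlonglongrightarrow> y" by (auto simp: convergent_def)
  have approx: "(cmod (g x - cinner (v n) x))\<^sup>2 \<le> (1 / Suc n) * (norm x)\<^sup>2" if x: "x \<in> V" for x n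
  proof -
    define z where "z = cinner (v n) x - g x"
    have expand: "F (v n + t *\<^sub>C x) = F (v n) + 2 * Re (t * z) + (cmod t)\<^sup>2 * (norm x)\<^sup>2" for t
      by (simp add: F_def norm_add_squared gadd gscale v x Vscale cinner_simps norm_scaleC
          power_mult_distrib z_def algebra_simps)
    have "complex_of_real (1 / Suc n) + t * z + cnj t * cnj z
        + complex_of_real ((cmod t)\<^sup>2 * (norm x)\<^sup>2) \<in> \<real>\<^sub>\<ge>\<^sub>0" for t
    proof -
      have "0 \<le> 1 / Suc n + 2 * Re (t * z) + (cmod t)\<^sup>2 * (norm x)\<^sup>2"
        using mle[OF Vadd[OF v Vscale[OF x]], of n t] vF[of n] unfolding expand by linarith
      then show ?thesis by (simp add: complex_nonneg_Reals_iff)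
    qed
    from nonneg_form_bound(2)[OF this] show ?thesis
      by (simp add: z_def norm_minus_commute)
  qed
  have "g x = cinner y x" if x: "x \<in> V" for x
  proof -
    have "(\<lambda>n. (cmod (g x - cinner (v n) x))\<^sup>2) \<longlonglongrightarrow> (cmod (g x - cinner y x))\<^sup>2"
      by (intro tendsto_intros cinner.tendsto y)
    moreover have "(\<lambda>n. (1 / Suc n) * (norm x)\<^sup>2) \<longlonglongrightarrow> 0 * (norm x)\<^sup>2"
      by (intro tendsto_intros LIMSEQ_Suc[OF lim_1_over_n])
    ultimately have "(cmod (g x - cinner y x))\<^sup>2 \<le> 0"
      using LIMSEQ_le approx[OF x] by fastforce
    then show ?thesis by simp
  qed
  then show ?thesis by blast
qed


section \<open>Bounded and positive operators\<close>

lemma bounded_operators_linear: "A \<in> bounded_operators \<Longrightarrow> bounded_linear A"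
  by (simp add: bounded_operators_def)

lemma bounded_operators_scaleC: "A \<in> bounded_operators \<Longrightarrow> A (c *\<^sub>C x) = c *\<^sub>C A x"
  by (simp add: bounded_operators_def)

lemmas bounded_operators_add = linear_add[OF bounded_linear.linear[OF bounded_operators_linear]]
lemmas bounded_operators_diff = linear_diff[OF bounded_linear.linear[OF bounded_operators_linear]]
lemmas bounded_operators_zero = linear_0[OF bounded_linear.linear[OF bounded_operators_linear]]
lemmas bounded_operators_scaleR = linear_scale[OF bounded_linear.linear[OF bounded_operators_linear]]
lemmas bounded_operators_sum = linear_sum[OF bounded_linear.linear[OF bounded_operators_linear]]
lemmas bounded_operators_tendsto = bounded_linear.tendsto[OF bounded_operators_linear]

lemma bounded_operators_bound:
  assumes "A \<in> bounded_operators"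
  obtains K where "K > 0" "\<And>x. norm (A x) \<le> K * norm x"
  using bounded_linear.pos_bounded[OF bounded_operators_linear[OF assms]]
  by (metis mult.commute)

lemma abs_form_le:
  assumes "norm (A x) \<le> K * norm x"
  shows "\<bar>Re (cinner x (A x))\<bar> \<le> K * (norm x)\<^sup>2"
proof -
  have "\<bar>Re (cinner x (A x))\<bar> \<le> norm x * norm (A x)"
    using Cauchy_Schwarz_cinner abs_Re_le_cmod order_trans by blast
  also have "\<dots> \<le> norm x * (K * norm x)" by (intro mult_left_mono assms) simp
  finally show ?thesis by (simp add: power2_eq_square mult_ac)
qed

lemma bounded_operators_form_bound:
  assumes "A \<in> bounded_operators"
  obtains K where "K > 0" "\<And>x. Re (cinner x (A x)) \<le> K * (norm x)\<^sup>2"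
proof (rule bounded_operators_bound[OF assms])
  fix K assume "K > 0" "\<And>x. norm (A x) \<le> K * norm x"
  then show thesis using abs_form_le[of A _ K] by (intro that[of K]) (auto simp: abs_le_iff)
qed

lemma bounded_operatorsI:
  assumes "\<And>x y. A (x + y) = A x + A y" "\<And>c x. A (c *\<^sub>C x) = c *\<^sub>C A x"
    and "\<And>x. norm (A x) \<le> K * norm x"
  shows "A \<in> bounded_operators"
proof -
  have "bounded_linear A"
    by (rule bounded_linear_intro[where K=K])
      (use assms in \<open>auto simp: scaleR_scaleC mult.commute\<close>)
  then show ?thesis using assms(2) by (simp add: bounded_operators_def)
qed

lemma zero_bounded_operator: "(\<lambda>_. 0) \<in> bounded_operators"
  by (simp add: bounded_operators_def bounded_linear_zero)

lemma id_bounded_operator: "(\<lambda>x. x) \<in> bounded_operators"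
  by (simp add: bounded_operators_def bounded_linear_ident)

lemma add_bounded_operator:
  "A \<in> bounded_operators \<Longrightarrow> B \<in> bounded_operators \<Longrightarrow> (\<lambda>x. A x + B x) \<in> bounded_operators"
  by (auto simp: bounded_operators_def intro: bounded_linear_add simp: scaleC_add_right)

lemma scaleC_bounded_operator:
  "A \<in> bounded_operators \<Longrightarrow> (\<lambda>x. c *\<^sub>C A x) \<in> bounded_operators"
  by (auto simp: bounded_operators_def scaleC_scaleC mult.commute
      intro: bounded_linear_compose[OF scaleC.bounded_linear_right])

lemma scaleR_bounded_operator:
  "A \<in> bounded_operators \<Longrightarrow> (\<lambda>x. r *\<^sub>R A x) \<in> bounded_operators"
  by (simp add: scaleR_scaleC scaleC_bounded_operator)

lemma minus_one_scaleC: "(-1) *\<^sub>C x = - (x :: 'a::complex_hilbert_space)"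
  using scaleC.minus_left[of 1 x] by (simp add: scaleC_one)

lemma diff_bounded_operator:
  assumes "A \<in> bounded_operators" "B \<in> bounded_operators"
  shows "(\<lambda>x. A x - B x) \<in> bounded_operators"
  using add_bounded_operator[OF assms(1) scaleC_bounded_operator[OF assms(2), of "-1"]]
  by (simp add: minus_one_scaleC)

lemma comp_bounded_operator:
  "A \<in> bounded_operators \<Longrightarrow> B \<in> bounded_operators \<Longrightarrow> A \<circ> B \<in> bounded_operators"
  by (auto simp: bounded_operators_def o_def intro: bounded_linear_compose)

lemmas bounded_operator_intros = zero_bounded_operator id_bounded_operator add_bounded_operator
  scaleC_bounded_operator scaleR_bounded_operator diff_bounded_operator comp_bounded_operator

lemma positive_bounded: "A \<in> positive_operators \<Longrightarrow> A \<in> bounded_operators"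
  by (simp add: positive_operators_def)

lemma positive_Re_ge_0: "A \<in> positive_operators \<Longrightarrow> 0 \<le> Re (cinner x (A x))"
  by (simp add: positive_operators_def complex_nonneg_Reals_iff)

lemma positive_form_bound:
  assumes "A \<in> positive_operators"
  shows "cinner y (A x) = cnj (cinner x (A y))"
    and "(cmod (cinner x (A y)))\<^sup>2 \<le> Re (cinner x (A x)) * Re (cinner y (A y))"
proof -
  note b = positive_bounded[OF assms]
  have real: "complex_of_real (Re (cinner z (A z))) = cinner z (A z)" for z
    using assms by (simp add: positive_operators_def complex_nonneg_Reals_iff complex_eq_iff)
  have "complex_of_real (Re (cinner x (A x))) + t * cinner x (A y) + cnj t * cinner y (A x)
      + complex_of_real ((cmod t)\<^sup>2 * Re (cinner y (A y))) \<in> \<real>\<^sub>\<ge>\<^sub>0" for t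
  proof -
    have "cinner (x + t *\<^sub>C y) (A (x + t *\<^sub>C y)) \<in> \<real>\<^sub>\<ge>\<^sub>0"
      using assms by (simp add: positive_operators_def)
    then show ?thesis
      unfolding of_real_mult real complex_norm_square
      by (simp add: cinner_simps bounded_operators_add[OF b] bounded_operators_scaleC[OF b]
          algebra_simps)
  qed
  from nonneg_form_bound[OF this]
  show "cinner y (A x) = cnj (cinner x (A y))"
    and "(cmod (cinner x (A y)))\<^sup>2 \<le> Re (cinner x (A x)) * Re (cinner y (A y))" .
qed

lemma positive_self_adjoint:
  assumes "A \<in> positive_operators" shows "is_adjoint A A"
  unfolding is_adjoint_def
  by (metis assms cinner_commute complex_cnj_cnj positive_form_bound(1))

lemma positive_operatorsI:
  assumes "A \<in> bounded_operators" "is_adjoint A A" "\<And>x. 0 \<le> Re (cinner x (A x))"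
  shows "A \<in> positive_operators"
proof -
  have "cinner x (A x) \<in> \<real>\<^sub>\<ge>\<^sub>0" for x
  proof -
    have "cinner x (A x) = cnj (cinner x (A x))"
      using assms(2) by (metis cinner_commute is_adjoint_def)
    then have "Im (cinner x (A x)) = 0" by (simp add: complex_eq_iff)
    with assms(3)[of x] show ?thesis by (simp add: complex_nonneg_Reals_iff)
  qed
  then show ?thesis using assms(1) by (simp add: positive_operators_def)
qed

lemma is_adjoint_id: "is_adjoint (\<lambda>x. x) (\<lambda>x. x)"
  by (simp add: is_adjoint_def)

lemma is_adjoint_diff:
  "is_adjoint A A' \<Longrightarrow> is_adjoint B B' \<Longrightarrow> is_adjoint (\<lambda>x. A x - B x) (\<lambda>x. A' x - B' x)"
  by (simp add: is_adjoint_def cinner_simps)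

lemma is_adjoint_scaleR: "is_adjoint A A' \<Longrightarrow> is_adjoint (\<lambda>x. r *\<^sub>R A x) (\<lambda>x. r *\<^sub>R A' x)"
  by (simp add: is_adjoint_def cinner_simps)

lemma is_adjoint_comp: "is_adjoint A A' \<Longrightarrow> is_adjoint B B' \<Longrightarrow> is_adjoint (A \<circ> B) (B' \<circ> A')"
  by (simp add: is_adjoint_def)

lemma is_adjoint_sym: "is_adjoint A B \<Longrightarrow> is_adjoint B A"
  unfolding is_adjoint_def by (metis cinner_commute)

lemma adjoint_comp_self_positive:
  assumes "A \<in> bounded_operators" "B \<in> bounded_operators" "is_adjoint A B"
  shows "B \<circ> A \<in> positive_operators"
proof -
  have "cinner x ((B \<circ> A) x) = of_real ((norm (A x))\<^sup>2)" for x
    using assms(3) by (metis cinner_self comp_apply is_adjoint_def)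
  then show ?thesis
    using comp_bounded_operator[OF assms(2,1)]
    by (simp add: positive_operators_def del: of_real_power)
qed

lemma conjugate_positive:
  assumes "A \<in> positive_operators" "C \<in> bounded_operators" "D \<in> bounded_operators" "is_adjoint C D"
  shows "D \<circ> (A \<circ> C) \<in> positive_operators"
proof -
  have "cinner x ((D \<circ> (A \<circ> C)) x) = cinner (C x) (A (C x))" for x
    using assms(4) by (simp add: is_adjoint_def)
  then show ?thesis
    using comp_bounded_operator[OF assms(3) comp_bounded_operator[OF positive_bounded[OF assms(1)] assms(2)]]
      assms(1) by (simp add: positive_operators_def)
qed

lemma positive_add:
  "A \<in> positive_operators \<Longrightarrow> B \<in> positive_operators \<Longrightarrow> (\<lambda>x. A x + B x) \<in> positive_operators"
  by (auto simp: positive_operators_def cinner_simps add_bounded_operator intro: nonneg_Reals_add_I)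

lemma positive_scaleR:
  "A \<in> positive_operators \<Longrightarrow> 0 \<le> r \<Longrightarrow> (\<lambda>x. r *\<^sub>R A x) \<in> positive_operators"
  by (auto simp: positive_operators_def cinner_simps scaleR_bounded_operator intro: nonneg_Reals_mult_I)

text \<open>The Cauchy--Schwarz inequality of the form \<open>\<langle>x, A y\<rangle>\<close>, used with \<open>A x\<close> in place of \<open>x\<close>.\<close>

lemma positive_norm_le:
  assumes A: "A \<in> positive_operators" and C: "\<And>x. Re (cinner x (A x)) \<le> C * (norm x)\<^sup>2" "0 \<le> C"
  shows "(norm (A x))\<^sup>2 \<le> C * Re (cinner x (A x))" and "norm (A x) \<le> C * norm x"
proof -
  have "((norm (A x))\<^sup>2)\<^sup>2 = (cmod (cinner (A x) (A x)))\<^sup>2"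
    by (simp add: cinner_self norm_power)
  also have "\<dots> \<le> Re (cinner (A x) (A (A x))) * Re (cinner x (A x))"
    by (rule positive_form_bound(2)[OF A])
  also have "\<dots> \<le> (C * (norm (A x))\<^sup>2) * Re (cinner x (A x))"
    by (intro mult_right_mono C positive_Re_ge_0[OF A])
  finally have le: "(norm (A x))\<^sup>2 * (norm (A x))\<^sup>2 \<le> (norm (A x))\<^sup>2 * (C * Re (cinner x (A x)))"
    by (simp add: power2_eq_square[of "(norm (A x))\<^sup>2"] algebra_simps)
  show *: "(norm (A x))\<^sup>2 \<le> C * Re (cinner x (A x))"
  proof (cases "A x = 0")
    case True then show ?thesis using C(2) positive_Re_ge_0[OF A, of x] by simp
  next
    case False then show ?thesis using le by (metis mult_le_cancel_left_pos zero_less_norm_iff zero_less_power)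
  qed
  also have "\<dots> \<le> C * (C * (norm x)\<^sup>2)" by (intro mult_left_mono C)
  finally have "(norm (A x))\<^sup>2 \<le> (C * norm x)\<^sup>2" by (simp add: power2_eq_square algebra_simps)
  then show "norm (A x) \<le> C * norm x" by (rule power2_le_imp_le) (simp add: C(2))
qed

lemma positive_kernel:
  assumes A: "A \<in> positive_operators" and 0: "Re (cinner x (A x)) \<le> 0"
  shows "A x = 0"
proof -
  obtain K where K: "K > 0" "\<And>x. Re (cinner x (A x)) \<le> K * (norm x)\<^sup>2"
    using bounded_operators_form_bound[OF positive_bounded[OF A]] by blast
  have "(norm (A x))\<^sup>2 \<le> K * Re (cinner x (A x))"
    using positive_norm_le(1)[OF A K(2)] K(1) by simp
  also have "\<dots> \<le> 0" using 0 K(1) by (simp add: mult_nonneg_nonpos)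
  finally show ?thesis by simp
qed


section \<open>Orthonormal systems and diagonal operators\<close>

text \<open>Zero vectors are admitted, so that finite and infinite systems are both indexed by the
  natural numbers.\<close>

definition orthosystem :: "(nat \<Rightarrow> 'a::complex_hilbert_space) \<Rightarrow> bool"
  where "orthosystem u \<longleftrightarrow> (\<forall>m n. m \<noteq> n \<longrightarrow> cinner (u m) (u n) = 0) \<and> (\<forall>n. norm (u n) = 1 \<or> u n = 0)"

definition orthonormal :: "'a::complex_hilbert_space set \<Rightarrow> bool"
  where "orthonormal S \<longleftrightarrow> (\<forall>x\<in>S. \<forall>y\<in>S. cinner x y = (if x = y then 1 else 0))"

text \<open>The series \<open>\<Sum>n. c\<^sub>n \<langle>u\<^sub>n, \<cdot>\<rangle> v\<^sub>n\<close>. The diagonal operators, projections and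
  partial isometries below have this form.\<close>

definition schmidt ::
  "(nat \<Rightarrow> real) \<Rightarrow> (nat \<Rightarrow> 'a) \<Rightarrow> (nat \<Rightarrow> 'a) \<Rightarrow> 'a \<Rightarrow> 'a::complex_hilbert_space"
  where "schmidt c u v x = (\<Sum>n. (complex_of_real (c n) * cinner (u n) x) *\<^sub>C v n)"

lemma orthonormal_norm:
  assumes "orthonormal S" "v \<in> S"
  shows "norm v = 1"
proof -
  have "(norm v)\<^sup>2 = 1" using assms Re_cinner_self[of v] by (simp add: orthonormal_def)
  then have "norm v = 1 \<or> norm v = - 1" by (simp only: power2_eq_1_iff)
  then show ?thesis using norm_ge_zero[of v] by linarith
qed

lemma orthonormal_residual:
  assumes F: "finite F" "orthonormal F" "v \<in> F"
  shows "cinner v (x - (\<Sum>u\<in>F. cinner u x *\<^sub>C u)) = 0"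
proof -
  have "(\<Sum>u\<in>F. cinner u x * cinner v u) = (\<Sum>u\<in>F. if u = v then cinner v x else 0)"
    by (rule sum.cong) (use F in \<open>auto simp: orthonormal_def\<close>)
  then show ?thesis using F by (simp add: cinner_simps cinner.sum_right)
qed

lemma orthosystem_orth: "orthosystem u \<Longrightarrow> m \<noteq> n \<Longrightarrow> cinner (u m) (u n) = 0"
  by (simp add: orthosystem_def)

lemma orthosystem_self: "orthosystem u \<Longrightarrow> cinner (u n) (u n) = (if u n = 0 then 0 else 1)"
  unfolding orthosystem_def cinner_self by (metis norm_zero of_real_0 of_real_1 power_one zero_power2)

lemma orthosystem_norm_le: "orthosystem u \<Longrightarrow> norm (u n) \<le> 1"
  unfolding orthosystem_def by (metis norm_zero order_refl zero_le_one)

lemma norm_orthogonal_sum: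
  fixes v :: "'b \<Rightarrow> 'a::complex_hilbert_space"
  assumes "finite F" "\<And>m n. m \<in> F \<Longrightarrow> n \<in> F \<Longrightarrow> m \<noteq> n \<Longrightarrow> cinner (v m) (v n) = 0"
  shows "(norm (\<Sum>n\<in>F. v n))\<^sup>2 = (\<Sum>n\<in>F. (norm (v n))\<^sup>2)"
  using assms
proof (induction F)
  case (insert a F)
  have "cinner (v a) (\<Sum>n\<in>F. v n) = (\<Sum>n\<in>F. cinner (v a) (v n))"
    by (rule cinner.sum_right)
  also have "\<dots> = 0" by (rule sum.neutral) (use insert in auto)
  finally show ?case using insert by (simp add: norm_add_squared)
qed simp

lemma Bessel_finite:
  assumes F: "finite F" and orth: "\<And>m n. m \<in> F \<Longrightarrow> n \<in> F \<Longrightarrow> m \<noteq> n \<Longrightarrow> cinner (u m) (u n) = 0"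
    and norm: "\<And>n. n \<in> F \<Longrightarrow> norm (u n) = 1 \<or> u n = 0"
  shows "(norm (x - (\<Sum>n\<in>F. cinner (u n) x *\<^sub>C u n)))\<^sup>2 = (norm x)\<^sup>2 - (\<Sum>n\<in>F. (cmod (cinner (u n) x))\<^sup>2)"
    and "(\<Sum>n\<in>F. (cmod (cinner (u n) x))\<^sup>2) \<le> (norm x)\<^sup>2"
proof -
  let ?p = "\<Sum>n\<in>F. cinner (u n) x *\<^sub>C u n"
  have n: "(norm ?p)\<^sup>2 = (\<Sum>n\<in>F. (cmod (cinner (u n) x))\<^sup>2)"
  proof (subst norm_orthogonal_sum[OF F])
    show "(\<Sum>n\<in>F. (norm (cinner (u n) x *\<^sub>C u n))\<^sup>2) = (\<Sum>n\<in>F. (cmod (cinner (u n) x))\<^sup>2)"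
    proof (rule sum.cong)
      fix n assume "n \<in> F"
      from norm[OF this] show "(norm (cinner (u n) x *\<^sub>C u n))\<^sup>2 = (cmod (cinner (u n) x))\<^sup>2"
        by (auto simp: norm_scaleC cinner.zero_left)
    qed simp
  qed (use orth in \<open>simp add: cinner_simps\<close>)
  have c: "Re (cinner x ?p) = (\<Sum>n\<in>F. (cmod (cinner (u n) x))\<^sup>2)"
  proof -
    have "cinner x ?p = (\<Sum>n\<in>F. complex_of_real ((cmod (cinner (u n) x))\<^sup>2))"
      unfolding complex_norm_square cinner.sum_right cinner_scaleC_right
      by (intro sum.cong refl) (metis cinner_commute)
    then show ?thesis by simp
  qed
  show *: "(norm (x - ?p))\<^sup>2 = (norm x)\<^sup>2 - (\<Sum>n\<in>F. (cmod (cinner (u n) x))\<^sup>2)"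
    unfolding norm_diff_squared n c by simp
  show "(\<Sum>n\<in>F. (cmod (cinner (u n) x))\<^sup>2) \<le> (norm x)\<^sup>2"
    using * zero_le_power2[of "norm (x - ?p)"] by linarith
qed

lemma Bessel_orthonormal:
  assumes "finite F" "orthonormal F"
  shows "(norm (x - (\<Sum>v\<in>F. cinner v x *\<^sub>C v)))\<^sup>2 = (norm x)\<^sup>2 - (\<Sum>v\<in>F. (cmod (cinner v x))\<^sup>2)"
    and "(\<Sum>v\<in>F. (cmod (cinner v x))\<^sup>2) \<le> (norm x)\<^sup>2"
  using Bessel_finite[of F "\<lambda>v. v" x] assms orthonormal_norm[OF assms(2)] by (auto simp: orthonormal_def)

lemma Bessel_summable:
  assumes "orthosystem u"
  shows "summable (\<lambda>n. (cmod (cinner (u n) x))\<^sup>2)"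
  by (rule summableI_nonneg_bounded[where x="(norm x)\<^sup>2"])
    (use assms Bessel_finite(2)[of "{..<_}" u x] in \<open>auto simp: orthosystem_def\<close>)

context
  fixes c :: "nat \<Rightarrow> real" and u v :: "nat \<Rightarrow> 'a::complex_hilbert_space" and K :: real
  assumes u: "orthosystem u" and v: "orthosystem v" and c: "\<And>n. \<bar>c n\<bar> \<le> K"
begin

private lemma block_norm:
  assumes "finite F"
  shows "(norm (\<Sum>n\<in>F. (complex_of_real (c n) * cinner (u n) x) *\<^sub>C v n))\<^sup>2
    \<le> K\<^sup>2 * (\<Sum>n\<in>F. (cmod (cinner (u n) x))\<^sup>2)"
proof -
  have "(norm (\<Sum>n\<in>F. (complex_of_real (c n) * cinner (u n) x) *\<^sub>C v n))\<^sup>2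
      = (\<Sum>n\<in>F. (norm ((complex_of_real (c n) * cinner (u n) x) *\<^sub>C v n))\<^sup>2)"
    by (rule norm_orthogonal_sum) (use assms v in \<open>auto simp: cinner_simps orthosystem_orth\<close>)
  also have "\<dots> \<le> (\<Sum>n\<in>F. K\<^sup>2 * (cmod (cinner (u n) x))\<^sup>2)"
  proof (rule sum_mono)
    fix n
    have "norm ((complex_of_real (c n) * cinner (u n) x) *\<^sub>C v n) \<le> K * cmod (cinner (u n) x) * 1"
      unfolding norm_scaleC norm_mult norm_of_real
      by (intro mult_mono c orthosystem_norm_le[OF v]) (use c[of n] in auto)
    from power_mono[OF this norm_ge_zero, of 2]
    show "(norm ((complex_of_real (c n) * cinner (u n) x) *\<^sub>C v n))\<^sup>2 \<le> K\<^sup>2 * (cmod (cinner (u n) x))\<^sup>2"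
      by (simp add: power_mult_distrib)
  qed
  finally show ?thesis by (simp add: sum_distrib_left)
qed

lemma schmidt_sums:
  "(\<lambda>n. (complex_of_real (c n) * cinner (u n) x) *\<^sub>C v n) sums schmidt c u v x"
proof -
  have "summable (\<lambda>n. (complex_of_real (c n) * cinner (u n) x) *\<^sub>C v n)"
    unfolding summable_Cauchy
  proof (intro allI impI)
    fix e :: real assume e: "e > 0"
    have "e\<^sup>2 / (K\<^sup>2 + 1) > 0" using e by (simp add: add_nonneg_pos)
    then obtain N where N: "\<And>m n. m \<ge> N \<Longrightarrow> norm (\<Sum>i=m..<n. (cmod (cinner (u i) x))\<^sup>2) < e\<^sup>2 / (K\<^sup>2 + 1)"
      using Bessel_summable[OF u, of x] unfolding summable_Cauchy by meson
    have "norm (\<Sum>i=m..<n. (complex_of_real (c i) * cinner (u i) x) *\<^sub>C v i) < e" if "m \<ge> N" for m n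
    proof -
      let ?s = "\<Sum>i=m..<n. (cmod (cinner (u i) x))\<^sup>2"
      have "(norm (\<Sum>i=m..<n. (complex_of_real (c i) * cinner (u i) x) *\<^sub>C v i))\<^sup>2 \<le> K\<^sup>2 * ?s"
        by (rule block_norm) simp
      also have "\<dots> \<le> (K\<^sup>2 + 1) * ?s" by (intro mult_right_mono) (auto intro: sum_nonneg)
      also have "\<dots> < (K\<^sup>2 + 1) * (e\<^sup>2 / (K\<^sup>2 + 1))"
        using N[OF that, of n] by (intro mult_strict_left_mono) (auto simp: add_nonneg_pos)
      also have "\<dots> = e\<^sup>2"
      proof -
        have "K\<^sup>2 + 1 \<noteq> 0" using zero_le_power2[of K] by linarith
        then show ?thesis by simp
      qed
      finally show ?thesis using e by (simp add: power2_less_imp_less)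
    qed
    then show "\<exists>N. \<forall>m\<ge>N. \<forall>n. norm (\<Sum>i=m..<n. (complex_of_real (c i) * cinner (u i) x) *\<^sub>C v i) < e"
      by blast
  qed
  then show ?thesis by (simp add: schmidt_def summable_sums)
qed

lemma schmidt_norm_le: "norm (schmidt c u v x) \<le> K * norm x"
proof -
  have K0: "0 \<le> K" using c[of 0] by linarith
  have "norm (\<Sum>n<k. (complex_of_real (c n) * cinner (u n) x) *\<^sub>C v n) \<le> K * norm x" for k
  proof -
    have "(norm (\<Sum>n<k. (complex_of_real (c n) * cinner (u n) x) *\<^sub>C v n))\<^sup>2
        \<le> K\<^sup>2 * (\<Sum>n<k. (cmod (cinner (u n) x))\<^sup>2)" by (rule block_norm) simp
    also have "\<dots> \<le> K\<^sup>2 * (norm x)\<^sup>2"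
      by (intro mult_left_mono Bessel_finite) (use u in \<open>auto simp: orthosystem_def\<close>)
    also have "\<dots> = (K * norm x)\<^sup>2" by (simp add: power_mult_distrib)
    finally show ?thesis by (rule power2_le_imp_le) (simp add: K0)
  qed
  then show ?thesis
    using tendsto_norm[OF schmidt_sums[of x, unfolded sums_def]] by (intro Lim_bounded) auto
qed

lemma schmidt_bounded_operator: "schmidt c u v \<in> bounded_operators"
proof (rule bounded_operatorsI[OF _ _ schmidt_norm_le])
  fix x y :: 'a and t :: complex
  have "(\<lambda>n. (complex_of_real (c n) * cinner (u n) (x + y)) *\<^sub>C v n) sums (schmidt c u v x + schmidt c u v y)"
    using sums_add[OF schmidt_sums[of x] schmidt_sums[of y]]
    by (simp add: cinner_simps distrib_left scaleC_add_left)
  then show "schmidt c u v (x + y) = schmidt c u v x + schmidt c u v y"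
    using schmidt_sums sums_unique2 by blast
  have "(\<lambda>n. (complex_of_real (c n) * cinner (u n) (t *\<^sub>C x)) *\<^sub>C v n) sums (t *\<^sub>C schmidt c u v x)"
    using bounded_linear.sums[OF scaleC.bounded_linear_right schmidt_sums[of x], of t]
    by (simp add: cinner_simps scaleC_scaleC mult_ac)
  then show "schmidt c u v (t *\<^sub>C x) = t *\<^sub>C schmidt c u v x"
    using schmidt_sums sums_unique2 by blast
qed

lemma cinner_schmidt_sums:
  "(\<lambda>n. complex_of_real (c n) * cinner (u n) x * cinner y (v n)) sums cinner y (schmidt c u v x)"
  using bounded_linear.sums[OF cinner.bounded_linear_right schmidt_sums[of x], of y]
  by (simp add: cinner_simps)

lemma bounded_operator_schmidt_sums:
  assumes "A \<in> bounded_operators"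
  shows "(\<lambda>n. (complex_of_real (c n) * cinner (u n) x) *\<^sub>C A (v n)) sums A (schmidt c u v x)"
  using bounded_linear.sums[OF bounded_operators_linear[OF assms] schmidt_sums[of x]]
  by (simp add: bounded_operators_scaleC[OF assms])

lemma cinner_system_schmidt:
  "cinner (v k) (schmidt c u v x) = (if v k = 0 then 0 else complex_of_real (c k) * cinner (u k) x)"
proof -
  have "(\<lambda>n. complex_of_real (c n) * cinner (u n) x * cinner (v k) (v n)) sums
      (complex_of_real (c k) * cinner (u k) x * cinner (v k) (v k))"
    using sums_finite[of "{k}" "\<lambda>n. complex_of_real (c n) * cinner (u n) x * cinner (v k) (v n)"]
    by (simp add: orthosystem_orth[OF v])
  from sums_unique2[OF cinner_schmidt_sums this] show ?thesis
    by (simp add: orthosystem_self[OF v])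
qed

lemma schmidt_system:
  assumes "u k \<noteq> 0"
  shows "schmidt c u v (u k) = c k *\<^sub>R v k"
proof -
  have "(\<lambda>n. (complex_of_real (c n) * cinner (u n) (u k)) *\<^sub>C v n) sums
      ((complex_of_real (c k) * cinner (u k) (u k)) *\<^sub>C v k)"
    using sums_finite[of "{k}" "\<lambda>n. (complex_of_real (c n) * cinner (u n) (u k)) *\<^sub>C v n"]
    by (simp add: orthosystem_orth[OF u] scaleC.zero_left)
  from sums_unique2[OF schmidt_sums this] show ?thesis
    using assms by (simp add: orthosystem_self[OF u] scaleR_scaleC)
qed

end

lemma schmidt_adjoint:
  assumes u: "orthosystem u" and v: "orthosystem v" and c: "\<And>n. \<bar>c n\<bar> \<le> K"
  shows "is_adjoint (schmidt c u v) (schmidt c v u)"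
  unfolding is_adjoint_def
proof (intro allI)
  fix x y
  have "(\<lambda>n. cnj (complex_of_real (c n) * cinner (u n) x * cinner y (v n))) sums cnj (cinner y (schmidt c u v x))"
    by (rule bounded_linear.sums[OF bounded_linear_cnj cinner_schmidt_sums[OF u v c]])
  moreover have "cnj (complex_of_real (c n) * cinner (u n) x * cinner y (v n))
      = complex_of_real (c n) * cinner (v n) y * cinner x (u n)" for n
    by (simp add: cinner_commute[of x] cinner_commute[of y] mult_ac)
  ultimately have "(\<lambda>n. complex_of_real (c n) * cinner (v n) y * cinner x (u n)) sums cinner (schmidt c u v x) y"
    by (simp add: cinner_commute[symmetric] mult_ac)
  moreover have "(\<lambda>n. complex_of_real (c n) * cinner (v n) y * cinner x (u n)) sums cinner x (schmidt c v u y)"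
    using cinner_schmidt_sums[where c=c and y=x and x=y, OF v u c] by simp
  ultimately show "cinner (schmidt c u v x) y = cinner x (schmidt c v u y)"
    by (rule sums_unique2)
qed

lemma schmidt_form_sums:
  assumes "orthosystem u" "\<And>n. \<bar>c n\<bar> \<le> K"
  shows "(\<lambda>n. c n * (cmod (cinner (u n) x))\<^sup>2) sums Re (cinner x (schmidt c u u x))"
proof -
  have "complex_of_real (c n) * cinner (u n) x * cinner x (u n) = complex_of_real (c n * (cmod (cinner (u n) x))\<^sup>2)" for n
    unfolding of_real_mult complex_norm_square by (simp add: cinner_commute[of x] mult_ac)
  then show ?thesis
    using sums_Re[OF cinner_schmidt_sums[where c=c and x=x and y=x, OF assms(1,1,2)]] by (simp only: Re_complex_of_real)
qed

lemma schmidt_positive: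
  assumes "orthosystem u" "\<And>n. \<bar>c n\<bar> \<le> K" "\<And>n. 0 \<le> c n"
  shows "schmidt c u u \<in> positive_operators"
proof (rule positive_operatorsI)
  show "0 \<le> Re (cinner x (schmidt c u u x))" for x
    by (rule sums_le[OF _ sums_zero schmidt_form_sums[OF assms(1,2)]]) (simp add: assms(3))
qed (rule schmidt_bounded_operator[OF assms(1,1,2)] schmidt_adjoint[OF assms(1,1,2)])+

lemma bounded_operators_ext_span:
  assumes "A \<in> bounded_operators" "B \<in> bounded_operators" "closure (complex_vector.span S) = UNIV"
    and "\<And>x. x \<in> S \<Longrightarrow> A x = B x"
  shows "A = B"
proof
  fix x
  have "closed {x. A x = B x}"
    by (rule closed_Collect_eq)
      (rule linear_continuous_on[OF bounded_operators_linear] assms)+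
  moreover have "complex_vector.span S \<subseteq> {x. A x = B x}"
  proof (rule complex_vector.span_minimal)
    show "complex_vector.subspace {x. A x = B x}"
      by (rule complex_vector.subspaceI)
        (simp_all add: bounded_operators_zero[OF assms(1)] bounded_operators_zero[OF assms(2)]
          bounded_operators_add[OF assms(1)] bounded_operators_add[OF assms(2)]
          bounded_operators_scaleC[OF assms(1)] bounded_operators_scaleC[OF assms(2)])
  qed (use assms(4) in blast)
  ultimately have "closure (complex_vector.span S) \<subseteq> {x. A x = B x}"
    by (rule closure_minimal[rotated])
  then show "A x = B x" using assms(3) by auto
qed


section \<open>Square roots and spectral projections in strongly closed algebras\<close>

definition strongly_closed :: "('a::complex_hilbert_space \<Rightarrow> 'a) set \<Rightarrow> bool"
  where "strongly_closed M \<longleftrightarrow> (\<forall>X A. (\<forall>n. X n \<in> M) \<longrightarrow> A \<in> bounded_operators \<longrightarrow>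
    (\<forall>x. (\<lambda>n::nat. X n x) \<longlonglongrightarrow> A x) \<longrightarrow> A \<in> M)"

definition strongly_closed_algebra :: "('a::complex_hilbert_space \<Rightarrow> 'a) set \<Rightarrow> bool"
  where "strongly_closed_algebra M \<longleftrightarrow> M \<subseteq> bounded_operators \<and> (\<lambda>x. x) \<in> M \<and>
    (\<forall>A\<in>M. \<forall>B\<in>M. (\<lambda>x. A x + B x) \<in> M \<and> A \<circ> B \<in> M) \<and> (\<forall>c. \<forall>A\<in>M. (\<lambda>x. c *\<^sub>C A x) \<in> M) \<and>
    strongly_closed M"

context
  fixes M :: "('a::complex_hilbert_space \<Rightarrow> 'a) set"
  assumes M: "strongly_closed_algebra M"
begin

lemma sca_bounded: "A \<in> M \<Longrightarrow> A \<in> bounded_operators"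
  using M by (auto simp: strongly_closed_algebra_def)

lemma sca_id: "(\<lambda>x. x) \<in> M"
  using M by (simp add: strongly_closed_algebra_def)

lemma sca_add: "A \<in> M \<Longrightarrow> B \<in> M \<Longrightarrow> (\<lambda>x. A x + B x) \<in> M"
  using M by (simp add: strongly_closed_algebra_def)

lemma sca_comp: "A \<in> M \<Longrightarrow> B \<in> M \<Longrightarrow> A \<circ> B \<in> M"
  using M by (simp add: strongly_closed_algebra_def)

lemma sca_scaleR: "A \<in> M \<Longrightarrow> (\<lambda>x. r *\<^sub>R A x) \<in> M"
  using M by (simp add: strongly_closed_algebra_def scaleR_scaleC)

lemma sca_diff:
  assumes "A \<in> M" "B \<in> M" shows "(\<lambda>x. A x - B x) \<in> M"
  using sca_add[OF assms(1) sca_scaleR[OF assms(2), of "-1"]] by simp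

lemma sca_zero: "(\<lambda>_. 0) \<in> M"
  using sca_scaleR[OF sca_id, of 0] by simp

lemma sca_limit:
  "(\<And>n. X n \<in> M) \<Longrightarrow> A \<in> bounded_operators \<Longrightarrow> (\<And>x. (\<lambda>n::nat. X n x) \<longlonglongrightarrow> A x) \<Longrightarrow> A \<in> M"
  using M unfolding strongly_closed_algebra_def strongly_closed_def by blast

text \<open>Adding the requirement to commute with \<open>B\<close> is how later operators are seen to commute: they
  are constructed inside this smaller algebra.\<close>

lemma sca_commutant:
  assumes B: "B \<in> bounded_operators"
  shows "strongly_closed_algebra {A \<in> M. A \<circ> B = B \<circ> A}"
proof -
  let ?C = "{A \<in> M. A \<circ> B = B \<circ> A}"
  have comm: "A (B x) = B (A x)" if "A \<in> ?C" for A x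
    using that by (metis (mono_tags, lifting) comp_apply mem_Collect_eq)
  have mem: "A \<in> ?C" if "A \<in> M" "\<And>x. A (B x) = B (A x)" for A
    using that by (simp add: fun_eq_iff)
  have "strongly_closed ?C"
    unfolding strongly_closed_def
  proof (intro allI impI)
    fix X :: "nat \<Rightarrow> 'a \<Rightarrow> 'a" and A
    assume X: "\<forall>n. X n \<in> ?C" and A: "A \<in> bounded_operators" and lim: "\<forall>x. (\<lambda>n. X n x) \<longlonglongrightarrow> A x"
    have "A (B x) = B (A x)" for x
    proof -
      have "(\<lambda>n. B (X n x)) \<longlonglongrightarrow> B (A x)"
        by (rule bounded_operators_tendsto[OF B lim[rule_format]])
      moreover have "(\<lambda>n. X n (B x)) \<longlonglongrightarrow> A (B x)" by (rule lim[rule_format])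
      moreover have "X n (B x) = B (X n x)" for n using comm X by blast
      ultimately show ?thesis using LIMSEQ_unique by fastforce
    qed
    moreover have "A \<in> M" by (rule sca_limit[of X]) (use X A lim in auto)
    ultimately show "A \<in> ?C" using mem by blast
  qed
  moreover have "(\<lambda>x. A x + A' x) \<in> ?C" "A \<circ> A' \<in> ?C" "(\<lambda>x. c *\<^sub>C A x) \<in> ?C"
    if "A \<in> ?C" "A' \<in> ?C" for A A' c
    using that comm[OF that(1)] comm[OF that(2)] M
    by (auto intro!: mem sca_add sca_comp
        simp: bounded_operators_add[OF B] bounded_operators_scaleC[OF B] strongly_closed_algebra_def)
  ultimately show ?thesis
    unfolding strongly_closed_algebra_def using sca_bounded sca_id by (auto simp: fun_eq_iff)
qed

end

lemma bounded_operators_strongly_closed_algebra: "strongly_closed_algebra bounded_operators"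
  unfolding strongly_closed_algebra_def strongly_closed_def
  by (intro conjI ballI allI impI bounded_operator_intros order_refl) assumption+

lemma strong_limit_bounded_operator:
  assumes X: "\<And>n. X n \<in> bounded_operators" and K: "\<And>n x. norm (X n x) \<le> K * norm x"
    and lim: "\<And>x. (\<lambda>n::nat. X n x) \<longlonglongrightarrow> A x"
  shows "A \<in> bounded_operators" and "norm (A x) \<le> K * norm x"
proof -
  have le: "norm (A x) \<le> K * norm x" for x
    by (rule LIMSEQ_le_const2[OF tendsto_norm[OF lim]]) (use K in blast)
  show "A \<in> bounded_operators"
  proof (rule bounded_operatorsI[OF _ _ le])
    show "A (x + y) = A x + A y" for x y
      using tendsto_add[OF lim[of x] lim[of y]]
      by (intro LIMSEQ_unique[OF lim]) (simp add: bounded_operators_add[OF X])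
    show "A (c *\<^sub>C x) = c *\<^sub>C A x" for c x
      using scaleC.tendsto[OF tendsto_const lim[of x], of c]
      by (intro LIMSEQ_unique[OF lim]) (simp add: bounded_operators_scaleC[OF X])
  qed
  show "norm (A x) \<le> K * norm x" by (rule le)
qed

lemma strong_limit_self_adjoint:
  assumes "\<And>n. is_adjoint (X n) (X n)" and lim: "\<And>x. (\<lambda>n::nat. X n x) \<longlonglongrightarrow> A x"
  shows "is_adjoint A A"
  unfolding is_adjoint_def
proof (intro allI)
  fix v w
  have "(\<lambda>n. cinner (X n v) w) \<longlonglongrightarrow> cinner (A v) w" by (intro cinner.tendsto lim tendsto_const)
  moreover have "(\<lambda>n. cinner v (X n w)) \<longlonglongrightarrow> cinner v (A w)" by (intro cinner.tendsto lim tendsto_const)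
  moreover have "cinner (X n v) w = cinner v (X n w)" for n
    using assms(1) by (simp add: is_adjoint_def)
  ultimately show "cinner (A v) w = cinner v (A w)" using LIMSEQ_unique by fastforce
qed

text \<open>For \<open>D = X\<^sub>n - X\<^sub>m \<ge> 0\<close> one has \<open>\<parallel>D v\<parallel>\<^sup>2 \<le> \<parallel>D\<parallel> \<langle>v, D v\<rangle>\<close>, and the numbers
  \<open>\<langle>v, X\<^sub>n v\<rangle>\<close> increase and are bounded.\<close>

lemma increasing_strong_limit:
  fixes X :: "nat \<Rightarrow> 'a::complex_hilbert_space \<Rightarrow> 'a"
  assumes X: "\<And>n. X n \<in> bounded_operators" and K: "\<And>n x. norm (X n x) \<le> K * norm x"
    and incr: "\<And>m n. m \<le> n \<Longrightarrow> (\<lambda>v. X n v - X m v) \<in> positive_operators"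
  shows "\<exists>A. \<forall>v. (\<lambda>n. X n v) \<longlonglongrightarrow> A v"
proof -
  have "convergent (\<lambda>n. X n v)" for v
  proof -
    define q where "q n = Re (cinner v (X n v))" for n
    have qle: "\<bar>Re (cinner x (X n x))\<bar> \<le> K * (norm x)\<^sup>2" for n x
      by (rule abs_form_le[OF K])
    show ?thesis
    proof (cases "v = 0")
      case True
      then show ?thesis by (simp add: bounded_operators_zero[OF X] convergent_const)
    next
      case False
      then have "0 \<le> K" using K[of 0 v] norm_ge_zero[of "X 0 v"]
        by (metis mult_le_cancel_right_pos mult_zero_left order_trans zero_less_norm_iff)
      have d: "(norm (X n v - X m v))\<^sup>2 \<le> 2 * K * (q n - q m)" if "m \<le> n" for m n
      proof -
        have "Re (cinner x (X n x - X m x)) \<le> 2 * K * (norm x)\<^sup>2" for x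
          using qle[where x=x and n=n] qle[where x=x and n=m] by (simp add: cinner_simps abs_le_iff)
        from positive_norm_le(1)[OF incr[OF that] this] \<open>0 \<le> K\<close> show ?thesis
          by (simp add: q_def cinner_simps)
      qed
      have "incseq q"
        unfolding incseq_def q_def
        using positive_Re_ge_0[OF incr] by (auto simp: cinner_simps)
      moreover have "\<forall>n. q n \<le> K * (norm v)\<^sup>2" using qle[where x=v] by (simp add: q_def abs_le_iff)
      ultimately obtain l where l: "q \<longlonglongrightarrow> l" "\<And>n. q n \<le> l" using incseq_convergent by metis
      show ?thesis
      proof (rule convergent_of_squared_differences)
        show "(norm (X n v - X m v))\<^sup>2 \<le> 2 * K * (l - q m) + 2 * K * (l - q n)" if "m \<le> n" for m n
        proof -
          have "2 * K * (q n - q m) \<le> 2 * K * (l - q m)" using l(2) \<open>0 \<le> K\<close> by (intro mult_left_mono) auto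
          moreover have "0 \<le> 2 * K * (l - q n)" using l(2)[of n] \<open>0 \<le> K\<close> by simp
          ultimately show ?thesis using d[OF that] by linarith
        qed
        have "(\<lambda>n. 2 * K * (l - q n)) \<longlonglongrightarrow> 2 * K * (l - l)" by (intro tendsto_intros l)
        then show "(\<lambda>n. 2 * K * (l - q n)) \<longlonglongrightarrow> 0" by simp
      qed
    qed
  qed
  then show ?thesis unfolding convergent_def by metis
qed

text \<open>A product of commuting positive operators is positive, but that is usually derived from
  the existence of square roots. For polynomials in \<open>x \<ge> 0\<close> with nonnegative coefficients it is
  clear, because \<open>x\<^sup>k \<ge> 0\<close>.\<close>

inductive_set power_cone :: "('a::real_vector \<Rightarrow> 'a) \<Rightarrow> ('a \<Rightarrow> 'a) set" for x where
  power_cone_monomial: "0 \<le> c \<Longrightarrow> (\<lambda>v. c *\<^sub>R (x ^^ k) v) \<in> power_cone x"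
| power_cone_add: "p \<in> power_cone x \<Longrightarrow> q \<in> power_cone x \<Longrightarrow> (\<lambda>v. p v + q v) \<in> power_cone x"

primrec sqrt_iteration :: "('a::real_vector \<Rightarrow> 'a) \<Rightarrow> nat \<Rightarrow> 'a \<Rightarrow> 'a" where
  "sqrt_iteration x 0 = (\<lambda>_. 0)"
| "sqrt_iteration x (Suc n) = (\<lambda>v. (1/2) *\<^sub>R (x v + sqrt_iteration x n (sqrt_iteration x n v)))"

context
  fixes x :: "'a::complex_hilbert_space \<Rightarrow> 'a"
  assumes x: "x \<in> positive_operators"
begin

lemma funpow_positive: "x ^^ k \<in> positive_operators"
proof (induction k rule: less_induct)
  case (less k)
  consider "k = 0" | "k = 1" | m where "k = Suc (Suc m)"
    by (metis One_nat_def not0_implies_Suc)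
  then show ?case
  proof cases
    case 1
    have "cinner v v \<in> \<real>\<^sub>\<ge>\<^sub>0" for v :: 'a by (simp add: cinner_self del: of_real_power)
    then show ?thesis using 1 id_bounded_operator by (simp add: positive_operators_def id_def)
  next
    case 2 then show ?thesis using x by simp
  next
    case 3
    have "x ^^ k = x \<circ> (x ^^ m \<circ> x)" by (simp add: 3 funpow_swap1 fun_eq_iff)
    moreover have "m < k" using 3 by simp
    ultimately show ?thesis
      using conjugate_positive[OF less.IH[of m] positive_bounded[OF x] positive_bounded[OF x]
          positive_self_adjoint[OF x]] by (simp only:)
  qed
qed

lemma power_cone_positive: "p \<in> power_cone x \<Longrightarrow> p \<in> positive_operators"
  by (induction rule: power_cone.induct) (auto intro: positive_scaleR positive_add funpow_positive)

lemma power_cone_scaleR: "p \<in> power_cone x \<Longrightarrow> 0 \<le> r \<Longrightarrow> (\<lambda>v. r *\<^sub>R p v) \<in> power_cone x"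
proof (induction rule: power_cone.induct)
  case (power_cone_monomial c k)
  then show ?case using power_cone.power_cone_monomial[where c="r * c" and x=x and k=k] by simp
next
  case (power_cone_add p q)
  from power_cone.power_cone_add[OF power_cone_add.IH(1) power_cone_add.IH(2)] power_cone_add.prems
  show ?case by (simp add: scaleR_add_right)
qed

lemma power_cone_comp:
  assumes p: "p \<in> power_cone x" and q: "q \<in> power_cone x"
  shows "(\<lambda>v. p (q v)) \<in> power_cone x"
  using p
proof (induction rule: power_cone.induct)
  case (power_cone_monomial c k)
  note lin = positive_bounded[OF funpow_positive[of k]]
  from q show ?case
  proof (induction rule: power_cone.induct)
    case (power_cone_monomial d l)
    then show ?case
      using power_cone.power_cone_monomial[where c="c * d" and x=x and k="k + l"] \<open>0 \<le> c\<close>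
      by (simp add: bounded_operators_scaleR[OF lin] funpow_add)
  next
    case (power_cone_add p q)
    from power_cone.power_cone_add[OF power_cone_add.IH] show ?case
      by (simp add: scaleR_add_right bounded_operators_add[OF lin])
  qed
next
  case (power_cone_add p p')
  from power_cone.power_cone_add[OF power_cone_add.IH] show ?case by simp
qed

lemma sqrt_iteration_cone: "sqrt_iteration x n \<in> power_cone x"
proof (induction n)
  case 0
  show ?case using power_cone_monomial[where c=0 and x=x and k=0] by simp
next
  case (Suc n)
  have "(\<lambda>v. 1 *\<^sub>R (x ^^ 1) v + sqrt_iteration x n (sqrt_iteration x n v)) \<in> power_cone x"
    using power_cone_monomial[where c=1 and k=1] power_cone_comp[OF Suc Suc] by (intro power_cone_add) auto
  from power_cone_scaleR[OF this, where r="1/2"] show ?case by simp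
qed

lemma sqrt_iteration_step_cone: "(\<lambda>v. sqrt_iteration x (Suc n) v - sqrt_iteration x n v) \<in> power_cone x"
proof (induction n)
  case 0
  show ?case using power_cone_monomial[where c="1/2" and x=x and k=1] by simp
next
  case (Suc n)
  let ?y = "sqrt_iteration x n" and ?z = "sqrt_iteration x (Suc n)"
  \<comment> \<open>With \<open>z\<close> the successor of \<open>y\<close>, the next difference is \<open>(z\<^sup>2 - y\<^sup>2) / 2 = ((z - y) z + y (z - y)) / 2\<close>.\<close>
  have "(\<lambda>v. (1/2) *\<^sub>R ((?z (?z v) - ?y (?z v)) + ?y (?z v - ?y v))) \<in> power_cone x"
    using power_cone_scaleR[OF power_cone_add[OF power_cone_comp[OF Suc sqrt_iteration_cone[of "Suc n"]]
        power_cone_comp[OF sqrt_iteration_cone[of n] Suc]], where r="1/2"] by (simp only:)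
  moreover have "(1/2) *\<^sub>R ((?z (?z v) - ?y (?z v)) + ?y (?z v - ?y v))
      = sqrt_iteration x (Suc (Suc n)) v - ?z v" for v
  proof -
    have "?y (?z v - ?y v) = ?y (?z v) - ?y (?y v)"
      by (rule bounded_operators_diff[OF positive_bounded[OF power_cone_positive[OF sqrt_iteration_cone]]])
    moreover have "?z v = (1/2) *\<^sub>R (x v + ?y (?y v))"
      "sqrt_iteration x (Suc (Suc n)) v = (1/2) *\<^sub>R (x v + ?z (?z v))" by simp_all
    ultimately show ?thesis by (simp only: scaleR_diff_right scaleR_add_right) simp
  qed
  ultimately show ?case by (simp only:)
qed

lemma sqrt_iteration_mono:
  assumes "m \<le> n"
  shows "(\<lambda>v. sqrt_iteration x n v - sqrt_iteration x m v) \<in> power_cone x"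
  using assms
proof (induction n rule: dec_induct)
  case base
  show ?case using power_cone_monomial[where c=0 and x=x and k=0] by simp
next
  case (step n)
  from power_cone_add[OF step.IH sqrt_iteration_step_cone[of n]] show ?case by (simp del: sqrt_iteration.simps)
qed

lemma sqrt_iteration_norm_le:
  assumes "\<And>v. norm (x v) \<le> norm v"
  shows "norm (sqrt_iteration x n v) \<le> norm v"
proof (induction n arbitrary: v)
  case (Suc n)
  have "norm (sqrt_iteration x n (sqrt_iteration x n v)) \<le> norm v" using Suc order_trans by blast
  then have "norm (x v + sqrt_iteration x n (sqrt_iteration x n v)) \<le> norm v + norm v"
    using assms norm_triangle_mono by blast
  then show ?case by simp
qed simp

end

text \<open>The iteration \<open>y \<mapsto> (x + y\<^sup>2) / 2\<close> started at 0 increases to a solution of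
  \<open>(1 - y)\<^sup>2 = 1 - x\<close>; here \<open>x = 1 - a\<close>.\<close>

lemma contraction_sqrt:
  fixes a :: "'a::complex_hilbert_space \<Rightarrow> 'a"
  assumes M: "strongly_closed_algebra M" and aM: "a \<in> M" and a: "a \<in> positive_operators"
    and a1: "\<And>v. Re (cinner v (a v)) \<le> (norm v)\<^sup>2"
  shows "\<exists>b\<in>M. b \<in> positive_operators \<and> b \<circ> b = a"
proof -
  define x where "x = (\<lambda>v. v - a v)"
  have xM: "x \<in> M" unfolding x_def by (intro sca_diff[OF M] sca_id[OF M] aM)
  have x: "x \<in> positive_operators"
  proof (rule positive_operatorsI)
    show "is_adjoint x x" unfolding x_def by (intro is_adjoint_diff is_adjoint_id positive_self_adjoint a)
    show "0 \<le> Re (cinner v (x v))" for v using a1[of v] by (simp add: x_def cinner_simps Re_cinner_self)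
  qed (rule sca_bounded[OF M xM])
  have "Re (cinner v (x v)) \<le> 1 * (norm v)\<^sup>2" for v
    using positive_Re_ge_0[OF a, of v] by (simp add: x_def cinner_simps Re_cinner_self)
  from positive_norm_le(2)[OF x this] have xn: "norm (x v) \<le> norm v" for v by simp
  let ?Y = "sqrt_iteration x"
  have Yn: "norm (?Y n v) \<le> norm v" for n v by (rule sqrt_iteration_norm_le[OF x xn])
  have YM: "?Y n \<in> M" for n
  proof (induction n)
    case (Suc n)
    have "(\<lambda>v. x v + (?Y n \<circ> ?Y n) v) \<in> M" by (intro sca_add[OF M] sca_comp[OF M] xM Suc)
    from sca_scaleR[OF M this, of "1/2"] show ?case by simp
  qed (simp add: sca_zero[OF M])
  have Yp: "?Y n \<in> positive_operators" for n by (rule power_cone_positive[OF x sqrt_iteration_cone[OF x]])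
  note Yb = sca_bounded[OF M YM]
  obtain y where y: "\<And>v. (\<lambda>n. ?Y n v) \<longlonglongrightarrow> y v"
    using increasing_strong_limit[of ?Y 1, OF Yb _ power_cone_positive[OF x sqrt_iteration_mono[OF x]]] Yn
    by auto
  have yb: "y \<in> bounded_operators" and yn: "norm (y v) \<le> norm v" for v
    using strong_limit_bounded_operator[where X="?Y" and K=1, OF Yb _ y] Yn by auto
  have yM: "y \<in> M" by (rule sca_limit[OF M YM yb y])
  have "(\<lambda>n. ?Y n (?Y n v)) \<longlonglongrightarrow> y (y v)" for v
  proof -
    have "(\<lambda>n. norm (?Y n v - y v)) \<longlonglongrightarrow> 0"
      using y[of v] by (simp add: LIM_zero_iff tendsto_norm_zero_iff)
    moreover have "norm (?Y n (?Y n v) - ?Y n (y v)) \<le> norm (?Y n v - y v)" for n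
      using Yn[of n "?Y n v - y v"] by (simp add: bounded_operators_diff[OF Yb])
    ultimately have "(\<lambda>n. ?Y n (?Y n v) - ?Y n (y v)) \<longlonglongrightarrow> 0"
      by (metis (no_types, lifting) Lim_null_comparison eventuallyI)
    from tendsto_add[OF this y[of "y v"]] show ?thesis by simp
  qed
  then have "(\<lambda>n. ?Y (Suc n) v) \<longlonglongrightarrow> (1/2) *\<^sub>R (x v + y (y v))" for v
    by (auto intro!: tendsto_intros)
  then have yy: "y v = (1/2) *\<^sub>R (x v + y (y v))" for v
    using LIMSEQ_unique[OF LIMSEQ_Suc[OF y[of v]]] by blast
  define b where "b = (\<lambda>v. v - y v)"
  have bM: "b \<in> M" unfolding b_def by (intro sca_diff[OF M] sca_id[OF M] yM)
  have "b \<in> positive_operators"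
  proof (rule positive_operatorsI)
    have "is_adjoint y y" by (rule strong_limit_self_adjoint[OF positive_self_adjoint[OF Yp] y])
    then show "is_adjoint b b" unfolding b_def by (intro is_adjoint_diff is_adjoint_id)
    show "0 \<le> Re (cinner v (b v))" for v
      using abs_form_le[where A=y and K=1 and x=v] yn[of v] by (simp add: b_def cinner_simps Re_cinner_self)
  qed (rule sca_bounded[OF M bM])
  moreover have "b (b v) = a v" for v
  proof -
    have "b (b v) = v - y v - (y v - y (y v))"
      by (simp add: b_def bounded_operators_diff[OF yb])
    also have "\<dots> = v - (2 *\<^sub>R y v - y (y v))" by (simp add: scaleR_2)
    also have "2 *\<^sub>R y v = x v + y (y v)" by (subst yy) simp
    finally show ?thesis by (simp add: x_def)
  qed
  then have "b \<circ> b = a" by (simp add: fun_eq_iff)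
  ultimately show ?thesis using bM by blast
qed

theorem positive_sqrt:
  assumes M: "strongly_closed_algebra M" and aM: "a \<in> M" and a: "a \<in> positive_operators"
  shows "\<exists>b\<in>M. b \<in> positive_operators \<and> b \<circ> b = a"
proof -
  obtain K where K: "K > 0" "\<And>x. Re (cinner x (a x)) \<le> K * (norm x)\<^sup>2"
    using bounded_operators_form_bound[OF positive_bounded[OF a]] by blast
  let ?a = "\<lambda>v. (1/K) *\<^sub>R a v"
  have "Re (cinner v (?a v)) \<le> (norm v)\<^sup>2" for v
    using K(1) K(2)[of v] by (simp add: cinner_simps field_simps)
  moreover have "?a \<in> positive_operators" using K(1) by (intro positive_scaleR a) simp
  moreover have "?a \<in> M" by (rule sca_scaleR[OF M aM])
  ultimately obtain b where b: "b \<in> M" "b \<in> positive_operators" "b \<circ> b = ?a"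
    using contraction_sqrt[OF M] by blast
  have bb: "b (b v) = (1/K) *\<^sub>R a v" for v using b(3) by (metis comp_apply)
  let ?b = "\<lambda>v. sqrt K *\<^sub>R b v"
  have "?b (?b v) = a v" for v
    using K(1) by (simp add: bounded_operators_scaleR[OF sca_bounded[OF M b(1)]] bb)
  then have "?b \<circ> ?b = a" by (simp add: fun_eq_iff)
  moreover have "?b \<in> M" by (rule sca_scaleR[OF M b(1)])
  moreover have "?b \<in> positive_operators" using K(1) by (intro positive_scaleR b) simp
  ultimately show ?thesis by blast
qed

text \<open>After scaling, \<open>c\<close> is a contraction. The projection onto its kernel is then the strong limit of
  \<open>w\<^sup>n\<close> for \<open>w = (1 - c\<^sup>2)\<^sup>2\<close>. The numbers \<open>q\<^sub>k = \<langle>v, w\<^sup>k v\<rangle>\<close> decrease, and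
  \<open>\<parallel>w\<^sup>n v - w\<^sup>m v\<parallel>\<^sup>2 = q\<^sub>2\<^sub>n + q\<^sub>2\<^sub>m - 2 q\<^sub>n\<^sub>+\<^sub>m\<close>. The outer square makes
  \<open>q\<^sub>k = \<parallel>(1 - c\<^sup>2)\<^sup>k v\<parallel>\<^sup>2\<close>, for which this is obvious.\<close>

lemma kernel_projection:
  fixes c :: "'a::complex_hilbert_space \<Rightarrow> 'a"
  assumes M: "strongly_closed_algebra M" and cM: "c \<in> M" and c: "is_adjoint c c"
  shows "\<exists>E\<in>M. E \<in> projection_operators \<and> (\<forall>x. c (E x) = 0) \<and> (\<forall>x. c x = 0 \<longrightarrow> E x = x)"
proof -
  obtain K where K: "K > 0" "\<And>x. norm (c x) \<le> K * norm x"
    using bounded_operators_bound[OF sca_bounded[OF M cM]] by blast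
  define d where "d = (\<lambda>v. (1/K) *\<^sub>R c v)"
  have dM: "d \<in> M" unfolding d_def by (rule sca_scaleR[OF M cM])
  have dadj: "is_adjoint d d" unfolding d_def by (rule is_adjoint_scaleR[OF c])
  have dn: "norm (d v) \<le> norm v" for v using K by (simp add: d_def field_simps)
  have dc: "d v = 0 \<longleftrightarrow> c v = 0" for v using K(1) by (simp add: d_def)
  define z where "z = (\<lambda>v. v - (d \<circ> d) v)"
  have zM: "z \<in> M" unfolding z_def by (intro sca_diff[OF M] sca_comp[OF M] dM sca_id[OF M])
  have zadj: "is_adjoint z z" unfolding z_def by (intro is_adjoint_diff is_adjoint_comp dadj is_adjoint_id)
  have zn: "(norm (z v))\<^sup>2 \<le> (norm v)\<^sup>2 - (norm (d v))\<^sup>2" for v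
  proof -
    have "(norm (d (d v)))\<^sup>2 \<le> (norm (d v))\<^sup>2" using dn by (simp add: power_mono)
    moreover have "cinner v (d (d v)) = cinner (d v) (d v)" using dadj by (simp add: is_adjoint_def)
    ultimately show ?thesis by (simp add: z_def norm_diff_squared Re_cinner_self)
  qed
  have zn1: "norm (z v) \<le> norm v" for v
    by (rule power2_le_imp_le) (use zn[of v] zero_le_power2[of "norm (d v)"] in linarith, simp)
  have zkM: "z ^^ k \<in> M" for k
  proof (induction k)
    case (Suc k)
    show ?case unfolding funpow.simps by (rule sca_comp[OF M zM Suc])
  qed (simp add: id_def sca_id[OF M])
  have zkadj: "is_adjoint (z ^^ k) (z ^^ k)" for k
  proof (induction k)
    case (Suc k)
    have "is_adjoint (z \<circ> z ^^ k) (z ^^ k \<circ> z)" by (rule is_adjoint_comp[OF zadj Suc])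
    moreover have "z \<circ> z ^^ k = z ^^ Suc k" by simp
    moreover have "z ^^ k \<circ> z = z ^^ Suc k" by (simp only: funpow_Suc_right)
    ultimately show ?case by (simp only:)
  qed (simp add: is_adjoint_def)
  have zkn: "norm ((z ^^ (j + k)) v) \<le> norm ((z ^^ k) v)" for j k v
    by (induction j) (use zn1 order_trans in auto)
  have W: "cinner ((z ^^ j) v) ((z ^^ k) v) = cinner v ((z ^^ (j + k)) v)" for j k v
    using zkadj[of j] by (simp add: is_adjoint_def funpow_add)
  define q where "q k v = (norm ((z ^^ k) v))\<^sup>2" for k v
  have qW: "Re (cinner v ((z ^^ (2 * k)) v)) = q k v" for k v
    using W[where j=k and k=k and v=v] unfolding q_def mult_2 by (metis Re_cinner_self)
  have diff: "(norm ((z ^^ (2 * n)) v - (z ^^ (2 * m)) v))\<^sup>2 = q (2 * n) v + q (2 * m) v - 2 * q (n + m) v" for n m v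
  proof -
    have "Re (cinner ((z ^^ (2 * n)) v) ((z ^^ (2 * m)) v)) = q (n + m) v"
      unfolding W using qW[of v "n + m"] by (simp only: distrib_left)
    then show ?thesis unfolding norm_diff_squared q_def by simp
  qed
  have "convergent (\<lambda>n. (z ^^ (2 * n)) v)" for v
  proof -
    have "decseq (\<lambda>k. q k v)"
      unfolding decseq_Suc_iff q_def using zkn[of 1] by (auto intro!: power_mono)
    then obtain l where l: "(\<lambda>k. q k v) \<longlonglongrightarrow> l" and ql: "\<And>k. l \<le> q k v"
      using decseq_convergent[of "\<lambda>k. q k v" 0] by (auto simp: q_def)
    show ?thesis
    proof (rule convergent_of_squared_differences)
      show "(norm ((z ^^ (2 * n)) v - (z ^^ (2 * m)) v))\<^sup>2 \<le> (q (2 * m) v - l) + (q (2 * n) v - l)" for m n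
        unfolding diff using ql[of "n + m"] by simp
      have "strict_mono (\<lambda>n::nat. 2 * n)" by (simp add: strict_mono_def)
      from LIMSEQ_subseq_LIMSEQ[OF l this] show "(\<lambda>n. q (2 * n) v - l) \<longlonglongrightarrow> 0"
        by (simp add: o_def LIM_zero_iff)
    qed
  qed
  then obtain E where E: "\<And>v. (\<lambda>n. (z ^^ (2 * n)) v) \<longlonglongrightarrow> E v" unfolding convergent_def by metis
  have Eb: "E \<in> bounded_operators"
    using strong_limit_bounded_operator(1)[where X="\<lambda>n. z ^^ (2 * n)" and K=1, OF sca_bounded[OF M zkM] _ E] zkn[where k=0]
    by simp
  have EM: "E \<in> M" by (rule sca_limit[OF M zkM Eb E])
  have wE: "(z ^^ 2) (E v) = E v" for v
  proof -
    have "(\<lambda>n. (z ^^ 2) ((z ^^ (2 * n)) v)) \<longlonglongrightarrow> (z ^^ 2) (E v)"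
      by (rule bounded_operators_tendsto[OF sca_bounded[OF M zkM] E])
    moreover have "(z ^^ 2) ((z ^^ (2 * n)) v) = (z ^^ (2 * Suc n)) v" for n
      by (simp add: numeral_2_eq_2)
    ultimately show ?thesis using LIMSEQ_unique LIMSEQ_Suc[OF E[of v]] by fastforce
  qed
  have dE: "d (E v) = 0" for v
  proof -
    have "(norm (z (E v)))\<^sup>2 = (norm (E v))\<^sup>2"
      using W[where j=1 and k=1 and v="E v"] wE[of v] Re_cinner_self[of "z (E v)"] Re_cinner_self[of "E v"]
      by (simp add: numeral_2_eq_2)
    with zn[of "E v"] show ?thesis by simp
  qed
  have ker: "E v = v" if "d v = 0" for v
  proof -
    have zv: "z v = v" using that by (simp add: z_def bounded_operators_zero[OF sca_bounded[OF M dM]])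
    have "(z ^^ k) v = v" for k by (induction k) (simp_all add: zv)
    then have "(\<lambda>n. (z ^^ (2 * n)) v) \<longlonglongrightarrow> v" by simp
    then show ?thesis using E LIMSEQ_unique by blast
  qed
  have "is_adjoint E E" by (rule strong_limit_self_adjoint[OF zkadj E])
  then have "E \<in> projection_operators"
    using Eb ker[OF dE] by (simp add: projection_operators_def fun_eq_iff)
  then show ?thesis using EM dE ker dc by blast
qed

lemma projection_bounded: "P \<in> projection_operators \<Longrightarrow> P \<in> bounded_operators"
  by (simp add: projection_operators_def)

lemma projection_idem: "P \<in> projection_operators \<Longrightarrow> P (P x) = P x"
  unfolding projection_operators_def by (metis (mono_tags, lifting) comp_apply mem_Collect_eq)

lemma projection_adjoint: "P \<in> projection_operators \<Longrightarrow> cinner (P x) y = cinner x (P y)"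
  by (simp add: projection_operators_def is_adjoint_def)

text \<open>The projection is the one onto the kernel of \<open>\<bar>d\<bar> - d\<close>, where \<open>\<bar>d\<bar>\<close> is the square root of
  \<open>d\<^sup>2\<close>. That kernel contains the range of \<open>\<bar>d\<bar> + d\<close>, since
  \<open>(\<bar>d\<bar> - d) (\<bar>d\<bar> + d) = 0\<close>; hence \<open>d = - \<bar>d\<bar>\<close> on its orthogonal complement.\<close>

lemma spectral_projection:
  fixes d :: "'a::complex_hilbert_space \<Rightarrow> 'a"
  assumes M: "strongly_closed_algebra M" and dM: "d \<in> M" and d: "is_adjoint d d"
  shows "\<exists>E\<in>M. E \<in> projection_operators \<and> (\<forall>x. E (d x) = d (E x)) \<and>
    (\<forall>x. E x = x \<longrightarrow> 0 \<le> Re (cinner x (d x))) \<and> (\<forall>x. E x = 0 \<longrightarrow> Re (cinner x (d x)) \<le> 0)"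
proof -
  note db = sca_bounded[OF M dM]
  define M' where "M' = {A \<in> M. A \<circ> d = d \<circ> A}"
  have M': "strongly_closed_algebra M'" unfolding M'_def by (rule sca_commutant[OF M db])
  have "d \<circ> d \<in> M'" using sca_comp[OF M dM dM] by (auto simp: M'_def)
  then obtain s where sM: "s \<in> M'" and s: "s \<in> positive_operators" and ss: "s \<circ> s = d \<circ> d"
    using positive_sqrt[OF M' _ adjoint_comp_self_positive[OF db db d]] by blast
  note sb = positive_bounded[OF s]
  have sd: "s (d x) = d (s x)" for x using sM unfolding M'_def by (metis (mono_tags, lifting) comp_apply mem_Collect_eq)
  have ss': "s (s x) = d (d x)" for x using ss by (metis comp_apply)
  define M'' where "M'' = {A \<in> M'. A \<circ> s = s \<circ> A}"
  have M'': "strongly_closed_algebra M''" unfolding M''_def by (rule sca_commutant[OF M' sb])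
  define c where "c = (\<lambda>x. s x - d x)"
  have "s \<in> M''" "d \<in> M''" using sM dM sd by (auto simp: M''_def M'_def fun_eq_iff)
  then have cM: "c \<in> M''" unfolding c_def by (rule sca_diff[OF M''])
  have "is_adjoint c c" unfolding c_def by (intro is_adjoint_diff positive_self_adjoint s d)
  from kernel_projection[OF M'' cM this] obtain E
    where EM: "E \<in> M''" and E: "E \<in> projection_operators" and cE: "\<And>x. c (E x) = 0"
      and ker: "\<And>x. c x = 0 \<Longrightarrow> E x = x" by blast
  have Ed: "E (d x) = d (E x)" and Es: "E (s x) = s (E x)" for x
    using EM unfolding M''_def M'_def by (metis (mono_tags, lifting) comp_apply mem_Collect_eq)+
  have "0 \<le> Re (cinner x (d x))" if "E x = x" for x
    using cE[of x] that positive_Re_ge_0[OF s, of x] by (simp add: c_def)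
  moreover have "Re (cinner x (d x)) \<le> 0" if "E x = 0" for x
  proof -
    have "c (s x + d x) = 0"
      by (simp add: c_def bounded_operators_add[OF sb] bounded_operators_add[OF db] ss' sd)
    then have "s x + d x = E (s x + d x)" by (simp add: ker)
    also have "\<dots> = 0"
      by (simp add: bounded_operators_add[OF projection_bounded[OF E]] Ed Es that
          bounded_operators_zero[OF sb] bounded_operators_zero[OF db])
    finally have "d x = - s x" by (simp add: add_eq_0_iff)
    then show ?thesis using positive_Re_ge_0[OF s, of x] by (simp add: cinner_simps)
  qed
  ultimately show ?thesis using EM E Ed by (auto simp: M''_def M'_def)
qed


section \<open>Positive elements of a weakly closed star-algebra\<close>

lemma weakly_closed_strong_limit:
  fixes N :: "('a::complex_hilbert_space \<Rightarrow> 'a) set"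
  assumes N: "closedin weak_operator_topology N" and X: "\<And>n. X n \<in> N"
    and A: "A \<in> bounded_operators" and lim: "\<And>x. (\<lambda>n::nat. X n x) \<longlonglongrightarrow> A x"
  shows "A \<in> N"
proof (rule ccontr)
  assume "A \<notin> N"
  let ?S = "{{A \<in> bounded_operators. cinner x (A y) \<in> U} | x (y::'a) U. open U}"
  have top: "topspace (weak_operator_topology :: ('a \<Rightarrow> 'a) topology) = bounded_operators"
  proof -
    have "bounded_operators \<in> ?S" by (rule CollectI, intro exI[of _ 0] exI[of _ UNIV]) auto
    then have "\<Union>?S = bounded_operators" by blast
    then show ?thesis by (simp add: weak_operator_topology_def)
  qed
  have Xb: "X n \<in> bounded_operators" for n
    using X closedin_subset[OF N] by (auto simp: top)
  have ev: "A \<in> V \<longrightarrow> (\<forall>\<^sub>F n in sequentially. X n \<in> V)" if "generate_topology_on ?S V" for V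
    using that
  proof (induction V rule: generate_topology_on.induct)
    case (Int V W)
    then show ?case using eventually_conj by fastforce
  next
    case (UN K)
    show ?case
    proof
      assume "A \<in> \<Union>K"
      then obtain V where V: "V \<in> K" "A \<in> V" by blast
      with UN have "\<forall>\<^sub>F n in sequentially. X n \<in> V" by blast
      then show "\<forall>\<^sub>F n in sequentially. X n \<in> \<Union>K" by (rule eventually_mono) (use V in blast)
    qed
  next
    case (Basis V)
    then obtain x y U where V: "V = {A \<in> bounded_operators. cinner x (A y) \<in> U}" and U: "open U" by blast
    show ?case
    proof
      assume "A \<in> V"
      moreover have "(\<lambda>n. cinner x (X n y)) \<longlonglongrightarrow> cinner x (A y)"
        by (intro cinner.tendsto tendsto_const lim)
      ultimately have "\<forall>\<^sub>F n in sequentially. cinner x (X n y) \<in> U"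
        using topological_tendstoD U by (auto simp: V)
      then show "\<forall>\<^sub>F n in sequentially. X n \<in> V" by (rule eventually_mono) (simp add: V Xb)
    qed
  qed simp
  have "openin weak_operator_topology (bounded_operators - N)"
    using N by (simp add: closedin_def top)
  then have "generate_topology_on ?S (bounded_operators - N)"
    unfolding weak_operator_topology_def openin_topology_generated_by_iff .
  from ev[OF this] A \<open>A \<notin> N\<close> have "\<forall>\<^sub>F n in sequentially. X n \<in> bounded_operators - N" by blast
  then have "\<forall>\<^sub>F n in sequentially. False" by (rule eventually_mono) (use X in blast)
  then show False by simp
qed

context
  fixes N :: "('a::complex_hilbert_space \<Rightarrow> 'a) set"
  assumes N: "weakly_closed_star_subalgebra N"
begin

lemma star_algebra_bounded: "A \<in> N \<Longrightarrow> A \<in> bounded_operators"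
  using N by (auto simp: weakly_closed_star_subalgebra_def operator_subspace_def)

lemma star_algebra_add: "A \<in> N \<Longrightarrow> B \<in> N \<Longrightarrow> (\<lambda>x. A x + B x) \<in> N"
  using N by (auto simp: weakly_closed_star_subalgebra_def operator_subspace_def)

lemma star_algebra_scaleC: "A \<in> N \<Longrightarrow> (\<lambda>x. c *\<^sub>C A x) \<in> N"
  using N by (auto simp: weakly_closed_star_subalgebra_def operator_subspace_def)

lemma star_algebra_comp: "A \<in> N \<Longrightarrow> B \<in> N \<Longrightarrow> A \<circ> B \<in> N"
  using N by (auto simp: weakly_closed_star_subalgebra_def)

lemma star_algebra_zero: "(\<lambda>_. 0) \<in> N"
  using N by (auto simp: weakly_closed_star_subalgebra_def operator_subspace_def)

lemma star_algebra_scaleR: "A \<in> N \<Longrightarrow> (\<lambda>x. r *\<^sub>R A x) \<in> N"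
  by (simp add: scaleR_scaleC star_algebra_scaleC)

lemma star_algebra_diff: "A \<in> N \<Longrightarrow> B \<in> N \<Longrightarrow> (\<lambda>x. A x - B x) \<in> N"
  using star_algebra_add[OF _ star_algebra_scaleR[of _ "-1"], of A B] by simp

lemma star_algebra_limit:
  "(\<And>n. X n \<in> N) \<Longrightarrow> A \<in> bounded_operators \<Longrightarrow> (\<And>x. (\<lambda>n::nat. X n x) \<longlonglongrightarrow> A x) \<Longrightarrow> A \<in> N"
  using N weakly_closed_strong_limit[of N X A] by (auto simp: weakly_closed_star_subalgebra_def)

text \<open>Since \<open>N\<close> may lack the identity, functions of \<open>a \<in> N\<close> that do not vanish at 0 need not lie
  in \<open>N\<close>. They lie in this algebra, which contains \<open>N\<close> as an ideal.\<close>

lemma right_multipliers_strongly_closed: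
  "strongly_closed_algebra {A \<in> bounded_operators. \<forall>B\<in>N. B \<circ> A \<in> N}"
proof -
  let ?M = "{A \<in> bounded_operators. \<forall>B\<in>N. B \<circ> A \<in> N}"
  have "strongly_closed ?M"
    unfolding strongly_closed_def
  proof (intro allI impI)
    fix X :: "nat \<Rightarrow> 'a \<Rightarrow> 'a" and A
    assume X: "\<forall>n. X n \<in> ?M" and A: "A \<in> bounded_operators" and lim: "\<forall>x. (\<lambda>n. X n x) \<longlonglongrightarrow> A x"
    have "B \<circ> A \<in> N" if B: "B \<in> N" for B
    proof (rule star_algebra_limit)
      show "B \<circ> X n \<in> N" for n using X B by blast
      show "B \<circ> A \<in> bounded_operators" by (intro comp_bounded_operator star_algebra_bounded B A)
      show "(\<lambda>n. (B \<circ> X n) x) \<longlonglongrightarrow> (B \<circ> A) x" for x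
        using bounded_operators_tendsto[OF star_algebra_bounded[OF B] lim[rule_format, of x]] by simp
    qed
    then show "A \<in> ?M" using A by blast
  qed
  moreover have "(\<lambda>x. x) \<in> ?M" using id_bounded_operator by (auto simp: o_def)
  moreover have "(\<lambda>x. A x + C x) \<in> ?M" if "A \<in> ?M" "C \<in> ?M" for A C
  proof -
    have "B \<circ> (\<lambda>x. A x + C x) \<in> N" if B: "B \<in> N" for B
    proof -
      have "B \<circ> (\<lambda>x. A x + C x) = (\<lambda>x. (B \<circ> A) x + (B \<circ> C) x)"
        by (simp add: fun_eq_iff bounded_operators_add[OF star_algebra_bounded[OF B]])
      moreover have "(\<lambda>x. (B \<circ> A) x + (B \<circ> C) x) \<in> N"
        by (rule star_algebra_add) (use \<open>A \<in> ?M\<close> \<open>C \<in> ?M\<close> B in blast)+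
      ultimately show ?thesis by (simp only:)
    qed
    moreover have "(\<lambda>x. A x + C x) \<in> bounded_operators"
      by (rule add_bounded_operator) (use that in blast)+
    ultimately show ?thesis by (intro CollectI conjI ballI)
  qed
  moreover have "A \<circ> C \<in> ?M" if "A \<in> ?M" "C \<in> ?M" for A C
  proof -
    have "B \<circ> (A \<circ> C) \<in> N" if B: "B \<in> N" for B
    proof -
      have "B \<circ> A \<in> N" using \<open>A \<in> ?M\<close> B by blast
      then have "(B \<circ> A) \<circ> C \<in> N" using \<open>C \<in> ?M\<close> by blast
      then show ?thesis by (simp only: comp_assoc)
    qed
    moreover have "A \<circ> C \<in> bounded_operators"
      by (rule comp_bounded_operator) (use that in blast)+
    ultimately show ?thesis by (intro CollectI conjI ballI)
  qed
  moreover have "(\<lambda>x. c *\<^sub>C A x) \<in> ?M" if "A \<in> ?M" for A c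
  proof -
    have "B \<circ> (\<lambda>x. c *\<^sub>C A x) \<in> N" if B: "B \<in> N" for B
    proof -
      have "B \<circ> (\<lambda>x. c *\<^sub>C A x) = (\<lambda>x. c *\<^sub>C (B \<circ> A) x)"
        by (simp add: fun_eq_iff bounded_operators_scaleC[OF star_algebra_bounded[OF B]])
      moreover have "(\<lambda>x. c *\<^sub>C (B \<circ> A) x) \<in> N"
        by (rule star_algebra_scaleC) (use \<open>A \<in> ?M\<close> B in blast)
      ultimately show ?thesis by (simp only:)
    qed
    moreover have "(\<lambda>x. c *\<^sub>C A x) \<in> bounded_operators"
      by (rule scaleC_bounded_operator) (use that in blast)
    ultimately show ?thesis by (intro CollectI conjI ballI)
  qed
  moreover have "?M \<subseteq> bounded_operators" by blast
  ultimately show ?thesis unfolding strongly_closed_algebra_def by (intro conjI ballI allI) assumption+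
qed

text \<open>The projection \<open>P\<close> is the spectral projection of \<open>a\<close> for \<open>[1/2, 1]\<close>, which accounts for the first
  binary digit of \<open>a\<close>. To see that it lies in \<open>N\<close>, it is written as the limit of
  \<open>1 - (1 - a P)\<^sup>n\<close>, a polynomial in \<open>a P\<close> without constant term.\<close>

lemma first_binary_digit:
  assumes aN: "a \<in> N" and a: "a \<in> positive_operators" and a1: "\<And>x. Re (cinner x (a x)) \<le> (norm x)\<^sup>2"
  shows "\<exists>P\<in>N. P \<in> projection_operators \<and> (\<lambda>x. 2 *\<^sub>R a x - P x) \<in> positive_operators \<and>
    (\<forall>x. Re (cinner x (2 *\<^sub>R a x - P x)) \<le> (norm x)\<^sup>2)"
proof -
  note ab = positive_bounded[OF a]
  let ?M = "{A \<in> bounded_operators. \<forall>B\<in>N. B \<circ> A \<in> N}"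
  note M = right_multipliers_strongly_closed
  define d where "d = (\<lambda>x. a x - (1/2) *\<^sub>R x)"
  have "a \<in> ?M" using ab star_algebra_comp aN by blast
  then have dM: "d \<in> ?M" unfolding d_def by (intro sca_diff[OF M] sca_scaleR[OF M sca_id[OF M]])
  have "is_adjoint d d"
    unfolding d_def by (intro is_adjoint_diff is_adjoint_scaleR is_adjoint_id positive_self_adjoint a)
  from spectral_projection[OF M dM this] obtain P where PM: "P \<in> ?M" and P: "P \<in> projection_operators"
    and Pd: "\<And>x. P (d x) = d (P x)" and ge: "\<And>x. P x = x \<Longrightarrow> 0 \<le> Re (cinner x (d x))"
    and le: "\<And>x. P x = 0 \<Longrightarrow> Re (cinner x (d x)) \<le> 0" by blast
  note Pb = projection_bounded[OF P] note PP = projection_idem[OF P]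
  have Pa: "P (a x) = a (P x)" for x
  proof -
    have "P (a x) - (1/2) *\<^sub>R P x = a (P x) - (1/2) *\<^sub>R P x"
      using Pd[of x] by (simp add: d_def bounded_operators_diff[OF Pb] bounded_operators_scaleR[OF Pb])
    then show ?thesis by simp
  qed
  define k where "k = a \<circ> P"
  have kN: "k \<in> N" using PM aN by (auto simp: k_def)
  note kb = star_algebra_bounded[OF kN]
  have contr: "norm (x - a x) \<le> (1/2) * norm x" if Px: "P x = x" for x
  proof -
    define c where "c = P \<circ> ((\<lambda>x. x - a x) \<circ> P)"
    have "(\<lambda>x. x - a x) \<in> positive_operators"
    proof (rule positive_operatorsI)
      show "is_adjoint (\<lambda>x. x - a x) (\<lambda>x. x - a x)" by (intro is_adjoint_diff is_adjoint_id positive_self_adjoint a)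
      show "0 \<le> Re (cinner x (x - a x))" for x using a1[of x] by (simp add: cinner_simps Re_cinner_self)
    qed (intro bounded_operator_intros ab)
    moreover have "is_adjoint P P" using P by (simp add: projection_operators_def)
    ultimately have c: "c \<in> positive_operators" unfolding c_def by (intro conjugate_positive Pb)
    have "Re (cinner y (c y)) \<le> (1/2) * (norm y)\<^sup>2" for y
    proof -
      have "Re (cinner y (c y)) = Re (cinner (P y) (P y - a (P y)))"
        by (simp add: c_def projection_adjoint[OF P])
      also have "\<dots> \<le> (1/2) * (norm (P y))\<^sup>2"
        using ge[OF PP, of y] by (simp add: d_def cinner_simps Re_cinner_self)
      also have "\<dots> \<le> (1/2) * (norm y)\<^sup>2"
      proof -
        have "(norm (y - P y))\<^sup>2 = (norm y)\<^sup>2 - (norm (P y))\<^sup>2"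
          using projection_adjoint[OF P, of y "P y"] projection_adjoint[OF P, of y y]
          by (simp add: norm_diff_squared PP) (metis Re_cinner_self)
        then show ?thesis using zero_le_power2[of "norm (y - P y)"] by simp
      qed
      finally show ?thesis .
    qed
    from positive_norm_le(2)[OF c this, of x] show ?thesis
      by (simp add: c_def Px bounded_operators_diff[OF Pb] Pa)
  qed
  define p where "p = rec_nat (\<lambda>_. 0) (\<lambda>_ q x. q x + (k x - (k \<circ> q) x))"
  have p0: "p 0 = (\<lambda>_. 0)" and pS: "p (Suc n) = (\<lambda>x. p n x + (k x - (k \<circ> p n) x))" for n
    by (simp_all add: p_def)
  have pN: "p n \<in> N" for n
  proof (induction n)
    case (Suc n)
    show ?case
      unfolding pS by (rule star_algebra_add[OF Suc star_algebra_diff[OF kN star_algebra_comp[OF kN Suc]]])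
  qed (simp add: p0 star_algebra_zero)
  have err: "P (P x - p n x) = P x - p n x \<and> norm (P x - p n x) \<le> (1/2) ^ n * norm (P x)" for n x
  proof (induction n)
    case 0
    then show ?case by (simp add: p0 PP bounded_operators_diff[OF Pb] bounded_operators_zero[OF Pb])
  next
    case (Suc n)
    let ?u = "P x - p n x"
    have E: "P x - p (Suc n) x = ?u - a ?u"
    proof -
      have "a (p n x) = k (p n x) + (a (p n x) - a (P (p n x)))" by (simp add: k_def)
      moreover have "P (p n x) = p n x"
        using Suc by (simp add: bounded_operators_diff[OF Pb] PP)
      ultimately show ?thesis by (simp add: pS k_def bounded_operators_diff[OF ab] algebra_simps)
    qed
    have "P (?u - a ?u) = ?u - a ?u" using Suc by (simp add: bounded_operators_diff[OF Pb, of ?u] Pa)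
    moreover have "norm (?u - a ?u) \<le> (1/2) * norm ?u" using contr Suc by blast
    moreover have "(1/2) * norm ?u \<le> (1/2) * ((1/2) ^ n * norm (P x))" using Suc by simp
    ultimately show ?case unfolding E power_Suc mult.assoc by (blast intro: order_trans)
  qed
  have "P \<in> N"
  proof (rule star_algebra_limit[OF pN Pb])
    fix x
    have "(\<lambda>n. (1/2) ^ n * norm (P x)) \<longlonglongrightarrow> 0"
      by (intro tendsto_mult_left_zero LIMSEQ_realpow_zero) auto
    moreover have "norm (p n x - P x) \<le> (1/2) ^ n * norm (P x)" for n
      using err[of x n] by (simp add: norm_minus_commute)
    ultimately have "(\<lambda>n. p n x - P x) \<longlonglongrightarrow> 0"
      by (metis (no_types, lifting) Lim_null_comparison eventuallyI)
    then show "(\<lambda>n. p n x) \<longlonglongrightarrow> P x" by (simp add: LIM_zero_iff)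
  qed
  moreover have form: "0 \<le> Re (cinner x (2 *\<^sub>R a x - P x))" "Re (cinner x (2 *\<^sub>R a x - P x)) \<le> (norm x)\<^sup>2" for x
  proof -
    define y z where "y = P x" and "z = x - P x"
    have x: "x = y + z" by (simp add: y_def z_def)
    have Py: "P y = y" and Pz: "P z = 0" by (simp_all add: y_def z_def PP bounded_operators_diff[OF Pb])
    have yz: "cinner y z = 0" using projection_adjoint[OF P, of y z] by (simp add: Py Pz cinner.zero_right)
    have ayz: "cinner y (a z) = 0"
      using projection_adjoint[OF P, of y "a z"] by (simp add: Py Pa Pz bounded_operators_zero[OF ab] cinner.zero_right)
    have azy: "cinner z (a y) = 0"
      using ayz positive_form_bound(1)[OF a, of z y] by simp
    have zy: "cinner z y = 0" using yz cinner_zero_commute by blast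
    have nx: "(norm x)\<^sup>2 = (norm y)\<^sup>2 + (norm z)\<^sup>2" by (simp add: x norm_add_squared yz)
    have eq: "Re (cinner x (2 *\<^sub>R a x - P x)) = 2 * Re (cinner y (a y)) + 2 * Re (cinner z (a z)) - (norm y)\<^sup>2"
      unfolding x by (simp add: cinner_simps bounded_operators_add[OF ab] bounded_operators_add[OF Pb] Py Pz
          yz zy ayz azy Re_cinner_self cinner.zero_right)
    have "0 \<le> Re (cinner y (d y))" "Re (cinner z (d z)) \<le> 0" by (rule ge[OF Py], rule le[OF Pz])
    then have "(norm y)\<^sup>2 \<le> 2 * Re (cinner y (a y))" "2 * Re (cinner z (a z)) \<le> (norm z)\<^sup>2"
      by (simp_all add: d_def cinner_simps Re_cinner_self)
    moreover note a1[of y] positive_Re_ge_0[OF a, of z]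
    ultimately show "0 \<le> Re (cinner x (2 *\<^sub>R a x - P x))" "Re (cinner x (2 *\<^sub>R a x - P x)) \<le> (norm x)\<^sup>2"
      unfolding eq nx by linarith+
  qed
  moreover have "(\<lambda>x. 2 *\<^sub>R a x - P x) \<in> positive_operators"
  proof (rule positive_operatorsI)
    show "is_adjoint (\<lambda>x. 2 *\<^sub>R a x - P x) (\<lambda>x. 2 *\<^sub>R a x - P x)"
      using P by (intro is_adjoint_diff is_adjoint_scaleR positive_self_adjoint[OF a]) (simp add: projection_operators_def)
  qed (use form in \<open>auto intro!: bounded_operator_intros ab Pb\<close>)
  ultimately show ?thesis using P by blast
qed

text \<open>After scaling, \<open>0 \<le> a \<le> 1\<close>. The binary expansion \<open>a = \<Sum>k. 2\<^sup>-\<^sup>k P\<^sub>k\<close> with projections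
  \<open>P\<^sub>k \<in> N\<close> then extends the inequality from projections to positive elements.\<close>

lemma projection_domination_extends:
  assumes dom: "\<And>P. P \<in> N \<Longrightarrow> P \<in> projection_operators \<Longrightarrow> norm (P b) \<le> norm (P h)"
    and aN: "a \<in> N" and a: "a \<in> positive_operators"
  shows "Re (cinner b (a b)) \<le> Re (cinner h (a h))"
proof -
  have unit: "Re (cinner b (a b)) \<le> Re (cinner h (a h)) + (1/2) ^ n * (norm b)\<^sup>2"
    if "a \<in> N" "a \<in> positive_operators" "\<And>x. Re (cinner x (a x)) \<le> (norm x)\<^sup>2" for a n
    using that
  proof (induction n arbitrary: a)
    case 0
    show ?case using positive_Re_ge_0[OF 0(2), of h] 0(3)[of b] by simp
  next
    case (Suc n)
    from first_binary_digit[OF Suc.prems] obtain P where P: "P \<in> N" "P \<in> projection_operators"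
      and c: "(\<lambda>x. 2 *\<^sub>R a x - P x) \<in> positive_operators" "\<And>x. Re (cinner x (2 *\<^sub>R a x - P x)) \<le> (norm x)\<^sup>2"
      by blast
    have "(\<lambda>x. 2 *\<^sub>R a x - P x) \<in> N" by (intro star_algebra_diff star_algebra_scaleR Suc.prems P)
    from Suc.IH[OF this c] have le: "2 * Re (cinner b (a b)) - Re (cinner b (P b))
        \<le> 2 * Re (cinner h (a h)) - Re (cinner h (P h)) + (1/2) ^ n * (norm b)\<^sup>2"
      by (simp add: cinner_simps)
    have Px: "Re (cinner x (P x)) = (norm (P x))\<^sup>2" for x
      using projection_adjoint[OF P(2), of x "P x"] projection_idem[OF P(2)] by (metis Re_cinner_self)
    have "(norm (P b))\<^sup>2 \<le> (norm (P h))\<^sup>2" using dom[OF P] by (simp add: power_mono)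
    then have "2 * Re (cinner b (a b)) \<le> 2 * (Re (cinner h (a h)) + (1/2) ^ Suc n * (norm b)\<^sup>2)"
      using le unfolding Px by (simp del: power_mono_iff)
    then show ?case by (simp only: mult_le_cancel_left_pos zero_less_numeral)
  qed
  obtain K where K: "K > 0" "\<And>x. Re (cinner x (a x)) \<le> K * (norm x)\<^sup>2"
    using bounded_operators_form_bound[OF positive_bounded[OF a]] by blast
  let ?a = "\<lambda>v. (1/K) *\<^sub>R a v"
  have "Re (cinner v (?a v)) \<le> (norm v)\<^sup>2" for v
    using K(1) K(2)[of v] by (simp add: cinner_simps field_simps)
  moreover have "?a \<in> positive_operators" using K(1) by (intro positive_scaleR a) simp
  ultimately have "Re (cinner b (?a b)) \<le> Re (cinner h (?a h)) + (1/2) ^ n * (norm b)\<^sup>2" for n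
    using unit star_algebra_scaleR[OF aN] by blast
  moreover have "(\<lambda>n. Re (cinner h (?a h)) + (1/2) ^ n * (norm b)\<^sup>2) \<longlonglongrightarrow> Re (cinner h (?a h)) + 0"
    by (intro tendsto_add tendsto_const tendsto_mult_left_zero LIMSEQ_realpow_zero) auto
  ultimately have "Re (cinner b (?a b)) \<le> Re (cinner h (?a h)) + 0"
    by (intro LIMSEQ_le_const) auto
  then show ?thesis using K(1) by (simp add: cinner_simps divide_le_cancel)
qed

end


section \<open>Positive traces and the spectral theorem\<close>

text \<open>Let \<open>\<mu>\<close> be the supremum of \<open>\<langle>y, A y\<rangle>\<close> over unit vectors. Along a maximising sequence
  \<open>\<parallel>A y - \<mu> y\<parallel>\<^sup>2 \<le> \<mu> (\<mu> - \<langle>y, A y\<rangle>)\<close> tends to 0, and \<open>A y\<close> converges after passing to a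
  subsequence.\<close>

lemma top_eigenvector:
  fixes A :: "'a::complex_hilbert_space \<Rightarrow> 'a"
  assumes comp: "A \<in> compact_operators" and A: "A \<in> positive_operators" and nz: "A \<noteq> (\<lambda>_. 0)"
  shows "\<exists>e \<mu>. norm e = 1 \<and> 0 < \<mu> \<and> A e = \<mu> *\<^sub>R e \<and> (\<forall>x. Re (cinner x (A x)) \<le> \<mu> * (norm x)\<^sup>2)"
proof -
  note Ab = positive_bounded[OF A]
  define S where "S = (\<lambda>x. Re (cinner x (A x))) ` {x. norm x = 1}"
  define \<mu> where "\<mu> = Sup S"
  obtain K where K: "K > 0" "\<And>x. Re (cinner x (A x)) \<le> K * (norm x)\<^sup>2"
    using bounded_operators_form_bound[OF Ab] by blast
  have "Re (cinner x (A x)) \<le> K" if "norm x = 1" for x using K(2)[of x] that by simp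
  then have bdd: "bdd_above S" by (auto simp: S_def intro!: bdd_aboveI[of _ K])
  have normalise: "Re (cinner x (A x)) / (norm x)\<^sup>2 \<in> S" if "x \<noteq> 0" for x
    unfolding S_def
  proof (rule image_eqI)
    show "Re (cinner x (A x)) / (norm x)\<^sup>2
        = Re (cinner ((1 / norm x) *\<^sub>R x) (A ((1 / norm x) *\<^sub>R x)))"
      by (simp add: bounded_operators_scaleR[OF Ab] cinner_simps power2_eq_square)
  qed (use that in simp)
  have le: "Re (cinner x (A x)) \<le> \<mu> * (norm x)\<^sup>2" for x
  proof (cases "x = 0")
    case False
    have "Re (cinner x (A x)) / (norm x)\<^sup>2 \<le> \<mu>"
      unfolding \<mu>_def by (rule cSup_upper[OF normalise[OF False] bdd])
    then show ?thesis using False by (simp add: pos_divide_le_eq)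
  qed (simp add: cinner.zero_left)
  obtain x0 where "A x0 \<noteq> 0" using nz by auto
  then have x0: "Re (cinner x0 (A x0)) > 0" using positive_kernel[OF A] not_le by blast
  then have \<mu>: "0 < \<mu>"
    using le[of x0] by (smt (verit) mult_nonpos_nonneg zero_le_power2)
  have "x0 \<noteq> 0" using x0 by (auto simp: cinner.zero_left)
  then have "S \<noteq> {}" using normalise by blast
  have "\<exists>y. norm y = 1 \<and> \<mu> - 1 / Suc n < Re (cinner y (A y))" for n
    using less_cSupD[OF \<open>S \<noteq> {}\<close>, of "\<mu> - 1 / Suc n"] unfolding \<mu>_def[symmetric] by (auto simp: S_def)
  then obtain y where y1: "\<And>n. norm (y n) = 1" and y: "\<And>n. \<mu> - 1 / Suc n < Re (cinner (y n) (A (y n)))"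
    by metis
  have "A (y n) \<in> closure (A ` cball 0 1)" for n
    by (rule closure_subset[THEN subsetD]) (use y1 in auto)
  moreover have "compact (closure (A ` cball 0 1))" using comp by (simp add: compact_operators_def)
  ultimately obtain l r where r: "strict_mono (r :: nat \<Rightarrow> nat)" and l: "((\<lambda>n. A (y n)) \<circ> r) \<longlonglongrightarrow> l"
    unfolding compact_def by meson
  have "(norm (A (y n) - \<mu> *\<^sub>R y n))\<^sup>2 \<le> \<mu> * (1 / Suc n)" for n
  proof -
    have "(norm (A (y n) - \<mu> *\<^sub>R y n))\<^sup>2
        = (norm (A (y n)))\<^sup>2 + \<mu>\<^sup>2 - 2 * (\<mu> * Re (cinner (y n) (A (y n))))"
      by (simp add: norm_diff_squared y1 power_mult_distrib cinner_simps Re_cinner_commute[of "A _"])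
    also have "(norm (A (y n)))\<^sup>2 \<le> \<mu> * Re (cinner (y n) (A (y n)))"
      using positive_norm_le(1)[OF A le] \<mu> by simp
    finally have "(norm (A (y n) - \<mu> *\<^sub>R y n))\<^sup>2 \<le> \<mu> * (\<mu> - Re (cinner (y n) (A (y n))))"
      by (simp add: power2_eq_square algebra_simps)
    also have "\<dots> \<le> \<mu> * (1 / Suc n)" using y[of n] \<mu> by (intro mult_left_mono) linarith+
    finally show ?thesis .
  qed
  moreover have "(\<lambda>n. \<mu> * (1 / Suc n)) \<longlonglongrightarrow> \<mu> * 0" by (intro tendsto_intros LIMSEQ_Suc[OF lim_1_over_n])
  ultimately have "(\<lambda>n. (norm (A (y n) - \<mu> *\<^sub>R y n))\<^sup>2) \<longlonglongrightarrow> 0"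
    by (intro Lim_null_comparison[of "\<lambda>n. (norm (A (y n) - \<mu> *\<^sub>R y n))\<^sup>2"]) auto
  then have "(\<lambda>n. sqrt ((norm (A (y n) - \<mu> *\<^sub>R y n))\<^sup>2)) \<longlonglongrightarrow> sqrt 0" by (rule tendsto_real_sqrt)
  then have "(\<lambda>n. A (y n) - \<mu> *\<^sub>R y n) \<longlonglongrightarrow> 0" by (simp add: tendsto_norm_zero_iff)
  then have "((\<lambda>n. A (y n) - \<mu> *\<^sub>R y n) \<circ> r) \<longlonglongrightarrow> 0" by (rule LIMSEQ_subseq_LIMSEQ[OF _ r])
  from tendsto_diff[OF l this] have "(\<lambda>n. \<mu> *\<^sub>R y (r n)) \<longlonglongrightarrow> l" by (simp add: o_def)
  from tendsto_scaleR[OF tendsto_const[of "1/\<mu>"] this]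
  have lim: "(\<lambda>n. y (r n)) \<longlonglongrightarrow> (1/\<mu>) *\<^sub>R l" using \<mu> by simp
  let ?e = "(1/\<mu>) *\<^sub>R l"
  have "norm ?e = 1" using LIMSEQ_unique[OF tendsto_norm[OF lim]] by (simp only: y1) (metis tendsto_const)
  moreover have "A ?e = \<mu> *\<^sub>R ?e"
    using LIMSEQ_unique[OF bounded_operators_tendsto[OF Ab lim] l[unfolded o_def]] \<mu> by simp
  ultimately show ?thesis using \<mu> le by blast
qed

text \<open>The vectors \<open>A u\<^sub>n\<close> would be orthogonal of norm at least \<open>l\<close>, so without a convergent
  subsequence.\<close>

lemma compact_eigenvalues_not_bounded_below:
  fixes u :: "nat \<Rightarrow> 'a::complex_hilbert_space"
  assumes A: "A \<in> compact_operators" and u1: "\<And>n. norm (u n) = 1"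
    and orth: "\<And>m n. m \<noteq> n \<Longrightarrow> cinner (u m) (u n) = 0"
    and Au: "\<And>n. A (u n) = c n *\<^sub>R u n" and l: "\<And>n. l \<le> c n" "0 < l"
  shows False
proof -
  have "A (u n) \<in> closure (A ` cball 0 1)" for n
    by (rule closure_subset[THEN subsetD]) (use u1 in auto)
  moreover have "compact (closure (A ` cball 0 1))" using A by (simp add: compact_operators_def)
  ultimately obtain y r where r: "strict_mono (r :: nat \<Rightarrow> nat)" and y: "((\<lambda>n. A (u n)) \<circ> r) \<longlonglongrightarrow> y"
    unfolding compact_def by meson
  from tendsto_norm[OF tendsto_diff[OF LIMSEQ_Suc[OF y] y]]
  have "(\<lambda>n. norm (A (u (r (Suc n))) - A (u (r n)))) \<longlonglongrightarrow> 0" by (simp add: o_def)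
  moreover have "l \<le> norm (A (u (r (Suc n))) - A (u (r n)))" for n
  proof (rule power2_le_imp_le)
    have "r n < r (Suc n)" using r by (simp add: strict_mono_Suc_iff)
    then have "cinner (u (r (Suc n))) (u (r n)) = 0" by (intro orth) simp
    then have "(norm (A (u (r (Suc n))) - A (u (r n))))\<^sup>2 = (c (r (Suc n)))\<^sup>2 + (c (r n))\<^sup>2"
      by (simp add: Au norm_diff_squared cinner_simps u1 power_mult_distrib)
    also have "\<dots> \<ge> l\<^sup>2 + 0" by (intro add_mono power_mono l) (use l in auto)
    finally show "l\<^sup>2 \<le> (norm (A (u (r (Suc n))) - A (u (r n))))\<^sup>2" by simp
  qed simp
  ultimately have "l \<le> 0" by (intro LIMSEQ_le_const) auto
  then show False using l(2) by simp
qed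

lemma finite_sum_finite_rank:
  assumes "finite F"
  shows "(\<lambda>x. \<Sum>m\<in>F. cinner (u m) x *\<^sub>C v m) \<in> finite_rank_operators"
proof -
  have "(\<lambda>x. \<Sum>m\<in>F. cinner (u m) x *\<^sub>C v m) \<in> bounded_operators"
  proof (rule bounded_operatorsI)
    fix x
    have "norm (\<Sum>m\<in>F. cinner (u m) x *\<^sub>C v m) \<le> (\<Sum>m\<in>F. (norm (u m) * norm x) * norm (v m))"
      by (rule sum_norm_le) (simp add: norm_scaleC mult_right_mono Cauchy_Schwarz_cinner)
    also have "\<dots> = (\<Sum>m\<in>F. norm (u m) * norm (v m)) * norm x" by (simp add: sum_distrib_left mult_ac)
    finally show "norm (\<Sum>m\<in>F. cinner (u m) x *\<^sub>C v m) \<le> (\<Sum>m\<in>F. norm (u m) * norm (v m)) * norm x" .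
  qed (simp_all add: cinner_simps scaleC_add_left sum.distrib scaleC.sum_right scaleC_scaleC)
  moreover have "range (\<lambda>x. \<Sum>m\<in>F. cinner (u m) x *\<^sub>C v m) \<subseteq> complex_vector.span (v ` F)"
    by (intro image_subsetI complex_vector.span_sum complex_vector.span_scale complex_vector.span_base) simp
  ultimately show ?thesis unfolding finite_rank_operators_def using assms by blast
qed

locale positive_trace =
  fixes J :: "('a::complex_hilbert_space \<Rightarrow> 'a) set" and f :: "('a \<Rightarrow> 'a) \<Rightarrow> complex"
  assumes ideal: "compact_ideal J" and finite_rank: "finite_rank_operators \<subseteq> J"
    and trace: "trace_on J f" and positive: "positive_functional_on J f"
begin

lemma J_compact: "A \<in> J \<Longrightarrow> A \<in> compact_operators"
  using ideal by (auto simp: compact_ideal_def)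

lemma J_bounded: "A \<in> J \<Longrightarrow> A \<in> bounded_operators"
  using J_compact by (auto simp: compact_operators_def)

lemma J_add: "A \<in> J \<Longrightarrow> B \<in> J \<Longrightarrow> (\<lambda>x. A x + B x) \<in> J"
  using ideal by (simp add: compact_ideal_def operator_subspace_def)

lemma J_scaleC: "A \<in> J \<Longrightarrow> (\<lambda>x. c *\<^sub>C A x) \<in> J"
  using ideal by (simp add: compact_ideal_def operator_subspace_def)

lemma J_scaleR: "A \<in> J \<Longrightarrow> (\<lambda>x. r *\<^sub>R A x) \<in> J"
  by (simp add: scaleR_scaleC J_scaleC)

lemma J_diff: "A \<in> J \<Longrightarrow> B \<in> J \<Longrightarrow> (\<lambda>x. A x - B x) \<in> J"
  using J_add[OF _ J_scaleR[of _ "-1"], of A B] by simp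

lemma J_left: "a \<in> bounded_operators \<Longrightarrow> A \<in> J \<Longrightarrow> a \<circ> A \<in> J"
  using ideal by (simp add: compact_ideal_def)

lemma J_right: "a \<in> bounded_operators \<Longrightarrow> A \<in> J \<Longrightarrow> A \<circ> a \<in> J"
  using ideal by (simp add: compact_ideal_def)

lemma f_add: "A \<in> J \<Longrightarrow> B \<in> J \<Longrightarrow> f (\<lambda>x. A x + B x) = f A + f B"
  using trace by (simp add: trace_on_def linear_functional_on_def)

lemma f_scaleC: "A \<in> J \<Longrightarrow> f (\<lambda>x. c *\<^sub>C A x) = c * f A"
  using trace by (simp add: trace_on_def linear_functional_on_def)

lemma f_scaleR: "A \<in> J \<Longrightarrow> f (\<lambda>x. r *\<^sub>R A x) = of_real r * f A"
  by (simp add: scaleR_scaleC f_scaleC)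

lemma f_diff: "A \<in> J \<Longrightarrow> B \<in> J \<Longrightarrow> f (\<lambda>x. A x - B x) = f A - f B"
  using f_add[OF _ J_scaleR[of _ "-1"], of A B] f_scaleR[of B "-1"] by simp

lemma f_commute:
  assumes "a \<in> bounded_operators" "A \<in> J"
  shows "f (a \<circ> A) = f (A \<circ> a)"
proof -
  have "f (\<lambda>x. a (A x) - A (a x)) = 0" using trace assms by (simp add: trace_on_def)
  then show ?thesis using f_diff[OF J_left[OF assms] J_right[OF assms]] by simp
qed

lemma f_nonneg: "A \<in> J \<Longrightarrow> A \<in> positive_operators \<Longrightarrow> f A \<in> \<real>\<^sub>\<ge>\<^sub>0"
  using positive by (simp add: positive_functional_on_def)

lemma f_mono:
  assumes "A \<in> J" "B \<in> J" "(\<lambda>x. B x - A x) \<in> positive_operators"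
  shows "Re (f A) \<le> Re (f B)"
  using f_nonneg[OF J_diff[OF assms(2,1)] assms(3)] f_diff[OF assms(2,1)]
  by (simp add: complex_nonneg_Reals_iff)

text \<open>The eigenvectors come from successive top eigenvectors of \<open>A - \<Sum>k<n. \<mu>\<^sub>k \<langle>e\<^sub>k, \<cdot>\<rangle> e\<^sub>k\<close>. When this
  difference is 0, the zero vector and the eigenvalue 0 are taken.\<close>

theorem spectral_decomposition:
  assumes AJ: "A \<in> J" and A: "A \<in> positive_operators"
  obtains e :: "nat \<Rightarrow> 'a" and \<mu> :: "nat \<Rightarrow> real"
  where "orthosystem e" and "\<And>n. 0 \<le> \<mu> n" and "decseq \<mu>" and "\<mu> \<longlonglongrightarrow> 0"
    and "\<And>n. A (e n) = \<mu> n *\<^sub>R e n" and "\<And>n. 0 < \<mu> n \<Longrightarrow> norm (e n) = 1"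
    and "\<And>n z. \<forall>k<n. cinner (e k) z = 0 \<Longrightarrow> Re (cinner z (A z)) \<le> \<mu> n * (norm z)\<^sup>2"
    and "\<And>x. (\<lambda>k. \<mu> k * (cmod (cinner (e k) x))\<^sup>2) sums Re (cinner x (A x))"
proof -
  define top where "top B p \<longleftrightarrow> (norm (fst p) = 1 \<and> 0 < snd p \<or> fst p = 0 \<and> snd p = 0) \<and>
      B (fst p) = snd p *\<^sub>R fst p \<and> (\<forall>x. Re (cinner x (B x)) \<le> snd p * (norm x)\<^sup>2)"
    for B :: "'a \<Rightarrow> 'a" and p :: "'a \<times> real"
  have "\<exists>p. top B p" if B: "B \<in> J" "B \<in> positive_operators" for B
  proof (cases "B = (\<lambda>_. 0)")
    case True
    then have "top B (0, 0)" by (simp add: top_def cinner.zero_right)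
    then show ?thesis by blast
  next
    case False
    from top_eigenvector[OF J_compact[OF B(1)] B(2) False] obtain e \<mu> where "top B (e, \<mu>)"
      by (auto simp: top_def)
    then show ?thesis by blast
  qed
  then obtain sel where sel: "\<And>B. B \<in> J \<Longrightarrow> B \<in> positive_operators \<Longrightarrow> top B (sel B)" by metis
  define D where "D = rec_nat A (\<lambda>_ B x. B x - snd (sel B) *\<^sub>R (cinner (fst (sel B)) x *\<^sub>C fst (sel B)))"
  define e where "e n = fst (sel (D n))" for n
  define \<mu> where "\<mu> n = snd (sel (D n))" for n
  have D0: "D 0 = A" and DS: "D (Suc n) = (\<lambda>x. D n x - \<mu> n *\<^sub>R (cinner (e n) x *\<^sub>C e n))" for n
    by (simp_all add: D_def e_def \<mu>_def)
  have form: "Re (cinner x (D (Suc n) x)) = Re (cinner x (D n x)) - \<mu> n * (cmod (cinner (e n) x))\<^sup>2" for n x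
  proof -
    have "cinner (e n) x * cinner x (e n) = complex_of_real ((cmod (cinner (e n) x))\<^sup>2)"
      unfolding complex_norm_square by (metis cinner_commute)
    then show ?thesis unfolding DS by (simp add: cinner_simps)
  qed
  have Dpos: "D n \<in> J \<and> D n \<in> positive_operators" for n
  proof (induction n)
    case (Suc n)
    then have "top (D n) (sel (D n))" using sel by blast
    then have en: "norm (e n) = 1 \<or> e n = 0" and De: "D n (e n) = \<mu> n *\<^sub>R e n"
      by (auto simp: top_def e_def \<mu>_def)
    have "(\<lambda>x. \<Sum>m\<in>{n}. cinner (e m) x *\<^sub>C e m) \<in> finite_rank_operators" by (rule finite_sum_finite_rank) simp
    then have "(\<lambda>x. cinner (e n) x *\<^sub>C e n) \<in> J" using finite_rank by auto
    then have J: "D (Suc n) \<in> J" unfolding DS by (intro J_diff J_scaleR) (use Suc in auto)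
    moreover have "D (Suc n) \<in> positive_operators"
    proof (rule positive_operatorsI[OF J_bounded[OF J]])
      have "is_adjoint (\<lambda>x. cinner (e n) x *\<^sub>C e n) (\<lambda>x. cinner (e n) x *\<^sub>C e n)"
        by (simp add: is_adjoint_def cinner_simps) (metis cinner_commute)
      then show "is_adjoint (D (Suc n)) (D (Suc n))"
        unfolding DS by (intro is_adjoint_diff is_adjoint_scaleR positive_self_adjoint[OF conjunct2[OF Suc]])
      fix x
      define \<alpha> where "\<alpha> = cinner (e n) x"
      define z where "z = x - \<alpha> *\<^sub>C e n"
      note Db = positive_bounded[OF conjunct2[OF Suc]]
      show "0 \<le> Re (cinner x (D (Suc n) x))"
      proof (cases "e n = 0")
        case True
        then show ?thesis using Suc positive_Re_ge_0[of "D n" x] by (simp add: form cinner.zero_left)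
      next
        case False
        then have ee: "cinner (e n) (e n) = 1" using en by (simp add: cinner_self)
        have xe: "cinner x (e n) = cnj \<alpha>" by (metis \<alpha>_def cinner_commute)
        have eD: "cinner (e n) (D n x) = \<mu> n * \<alpha>"
          using positive_self_adjoint[OF conjunct2[OF Suc]] De unfolding is_adjoint_def
          by (metis \<alpha>_def cinner_scaleR_left)
        have "cinner z (D n z) = cinner x (D n x) - \<mu> n * (\<alpha> * cnj \<alpha>)"
          by (simp add: z_def bounded_operators_diff[OF Db] bounded_operators_scaleC[OF Db] De
              cinner_simps xe eD ee algebra_simps flip: \<alpha>_def)
        then have "Re (cinner z (D n z)) = Re (cinner x (D (Suc n) x))"
          unfolding form complex_norm_square[symmetric] \<alpha>_def by simp
        then show ?thesis using positive_Re_ge_0[OF conjunct2[OF Suc], of z] by simp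
      qed
    qed
    ultimately show ?case ..
  qed (simp add: D0 AJ A)
  then have top: "top (D n) (sel (D n))" for n using sel by blast
  have e1: "0 < \<mu> n \<Longrightarrow> norm (e n) = 1" and e0: "\<mu> n = 0 \<Longrightarrow> e n = 0" and \<mu>0: "0 \<le> \<mu> n"
    and De: "D n (e n) = \<mu> n *\<^sub>R e n" and Dle: "Re (cinner x (D n x)) \<le> \<mu> n * (norm x)\<^sup>2" for n x
    using top[of n] by (auto simp: top_def e_def \<mu>_def)
  have kill: "D m (e n) = 0" if "n < m" for m n
    using that
  proof (induction m)
    case (Suc m)
    have le: "Re (cinner x (D (Suc m) x)) \<le> Re (cinner x (D m x))" for x
      using \<mu>0[of m] by (simp add: form)
    have "Re (cinner (e n) (D (Suc m) (e n))) \<le> 0"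
    proof (cases "n = m")
      case True
      show ?thesis
      proof (cases "\<mu> m = 0")
        case True then show ?thesis using \<open>n = m\<close> e0[of m] by (simp add: cinner.zero_left)
      next
        case False
        then have "norm (e m) = 1" using e1 \<mu>0[of m] by (simp add: order_less_le)
        then show ?thesis unfolding form using \<open>n = m\<close> by (simp add: De cinner_simps cinner_self)
      qed
    next
      case False
      then show ?thesis using le[of "e n"] Suc by (simp add: cinner.zero_right)
    qed
    then show ?case using positive_kernel Dpos by blast
  qed simp
  have orth: "cinner (e m) (e n) = 0" if "m < n" for m n
  proof (cases "\<mu> n = 0")
    case False
    have "of_real (\<mu> n) * cinner (e m) (e n) = cinner (D n (e m)) (e n)"
      using positive_self_adjoint[of "D n"] Dpos[of n] De[of n]
      by (metis cinner_scaleR_right is_adjoint_def)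
    then show ?thesis using kill[OF that] False by (simp add: cinner.zero_left)
  qed (simp add: e0 cinner.zero_right)
  have e: "orthosystem e"
    unfolding orthosystem_def
  proof (intro conjI allI impI)
    show "cinner (e m) (e n) = 0" if "m \<noteq> n" for m n
      using orth[of m n] orth[of n m] that cinner_zero_commute by (metis nat_neq_iff)
    show "norm (e n) = 1 \<or> e n = 0" for n using e1[of n] e0[of n] \<mu>0[of n] by linarith
  qed
  have dec: "decseq \<mu>"
    unfolding decseq_Suc_iff
  proof
    fix n
    show "\<mu> (Suc n) \<le> \<mu> n"
    proof (cases "\<mu> (Suc n) = 0")
      case False
      then have n1: "norm (e (Suc n)) = 1" using e1 \<mu>0[of "Suc n"] by (simp add: order_less_le)
      have "\<mu> (Suc n) = Re (cinner (e (Suc n)) (D (Suc n) (e (Suc n))))"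
        by (simp add: De cinner_simps cinner_self n1)
      also have "\<dots> \<le> Re (cinner (e (Suc n)) (D n (e (Suc n))))" using \<mu>0[of n] by (simp only: form) simp
      also have "\<dots> \<le> \<mu> n" using Dle[of "e (Suc n)" n] n1 by simp
      finally show ?thesis .
    qed (simp add: \<mu>0)
  qed
  have DA: "D n z = A z" if "\<And>k. k < n \<Longrightarrow> cinner (e k) z = 0" for n z
    using that
  proof (induction n)
    case (Suc n)
    then show ?case by (simp add: DS scaleC.zero_left)
  qed (simp add: D0)
  have Ae: "A (e n) = \<mu> n *\<^sub>R e n" for n using DA[OF orth] De by simp
  have lim: "\<mu> \<longlonglongrightarrow> 0"
  proof -
    obtain l where l: "\<mu> \<longlonglongrightarrow> l" and \<mu>l: "\<And>n. l \<le> \<mu> n" using decseq_convergent[OF dec, of 0] \<mu>0 by blast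
    have "l = 0"
    proof (rule ccontr)
      assume "l \<noteq> 0"
      then have l0: "l > 0" using LIMSEQ_le_const[OF l] \<mu>0 by (metis order_less_le)
      have n1: "norm (e n) = 1" for n using e1[of n] \<mu>l[of n] l0 by simp
      show False
        using compact_eigenvalues_not_bounded_below[where u=e and c=\<mu>, OF J_compact[OF AJ] n1 _ Ae \<mu>l l0]
          orthosystem_orth[OF e] by blast
    qed
    then show ?thesis using l by simp
  qed
  have "(\<lambda>k. \<mu> k * (cmod (cinner (e k) x))\<^sup>2) sums Re (cinner x (A x))" for x
  proof -
    have partial: "(\<Sum>k<n. \<mu> k * (cmod (cinner (e k) x))\<^sup>2) = Re (cinner x (A x)) - Re (cinner x (D n x))" for n
      by (induction n) (simp_all add: D0 form del: DS)
    have "(\<lambda>n. Re (cinner x (D n x))) \<longlonglongrightarrow> 0"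
    proof (rule tendsto_sandwich[OF _ _ tendsto_const])
      show "(\<lambda>n. \<mu> n * (norm x)\<^sup>2) \<longlonglongrightarrow> 0" by (intro tendsto_mult_left_zero lim)
      show "\<forall>\<^sub>F n in sequentially. 0 \<le> Re (cinner x (D n x))"
        by (rule always_eventually, rule allI, rule positive_Re_ge_0) (simp add: Dpos)
    qed (simp add: Dle)
    from tendsto_diff[OF tendsto_const[of "Re (cinner x (A x))"] this] show ?thesis
      unfolding sums_def partial by simp
  qed
  moreover have "Re (cinner z (A z)) \<le> \<mu> n * (norm z)\<^sup>2" if "\<forall>k<n. cinner (e k) z = 0" for n z
    using Dle[of z n] DA[of n z] that by simp
  ultimately show thesis using that[of e \<mu>] e dec lim \<mu>0 Ae e1 by blast
qed

lemma trace_comp_nonneg: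
  assumes a: "a \<in> positive_operators" and S: "S \<in> J" "S \<in> positive_operators"
  shows "f (a \<circ> S) \<in> \<real>\<^sub>\<ge>\<^sub>0"
proof -
  obtain b where b: "b \<in> positive_operators" and bb: "b \<circ> b = a"
    using positive_sqrt[OF bounded_operators_strongly_closed_algebra positive_bounded[OF a] a] by blast
  note bB = positive_bounded[OF b]
  have "f (a \<circ> S) = f (b \<circ> (S \<circ> b))"
    using f_commute[OF bB J_left[OF bB S(1)]] by (simp add: bb[symmetric] comp_assoc)
  moreover have "b \<circ> (S \<circ> b) \<in> positive_operators"
    by (rule conjugate_positive[OF S(2) bB bB positive_self_adjoint[OF b]])
  ultimately show ?thesis
    using f_nonneg[OF J_left[OF bB J_right[OF bB S(1)]]] by simp
qed

lemma trace_mono_right: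
  assumes a: "a \<in> positive_operators" and S: "S \<in> J" "S' \<in> J" and le: "(\<lambda>x. S' x - S x) \<in> positive_operators"
  shows "Re (f (a \<circ> S)) \<le> Re (f (a \<circ> S'))"
proof -
  note ab = positive_bounded[OF a]
  have "a \<circ> (\<lambda>x. S' x - S x) = (\<lambda>x. (a \<circ> S') x - (a \<circ> S) x)"
    by (simp add: fun_eq_iff bounded_operators_diff[OF ab])
  then show ?thesis
    using trace_comp_nonneg[OF a J_diff[OF S(2,1)] le] f_diff[OF J_left[OF ab S(2)] J_left[OF ab S(1)]]
    by (simp add: complex_nonneg_Reals_iff)
qed

end


section \<open>Estimating the trace on dyadic diagonal operators\<close>

text \<open>A homogeneous linear system with more unknowns than equations, solved by eliminating one
  unknown for each equation.\<close>

lemma homogeneous_system_solution: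
  fixes c :: "'b \<Rightarrow> 'c \<Rightarrow> 'd::field"
  assumes "finite F" "finite I" "card F < card I"
  shows "\<exists>\<alpha>. (\<exists>i\<in>I. \<alpha> i \<noteq> 0) \<and> (\<forall>k\<in>F. (\<Sum>i\<in>I. \<alpha> i * c k i) = 0)"
  using assms
proof (induction F arbitrary: I c rule: finite_induct)
  case empty
  then have "I \<noteq> {}" by auto
  then show ?case by (intro exI[of _ "\<lambda>_. 1"]) auto
next
  case (insert p F)
  show ?case
  proof (cases "\<forall>i\<in>I. c p i = 0")
    case True
    have "card F < card I" using insert by simp
    from insert.IH[OF insert.prems(1) this, of c] True show ?thesis by auto
  next
    case False
    then obtain j where j: "j \<in> I" "c p j \<noteq> 0" by blast
    define c' where "c' k i = c k i - c k j * c p i / c p j" for k i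
    have "card F < card (I - {j})" using insert j by simp
    from insert.IH[OF _ this, of c'] insert.prems(1) obtain \<beta>
      where \<beta>: "\<exists>i\<in>I - {j}. \<beta> i \<noteq> 0" and sol: "\<And>k. k \<in> F \<Longrightarrow> (\<Sum>i\<in>I - {j}. \<beta> i * c' k i) = 0"
      by auto
    define \<alpha> where "\<alpha> i = (if i = j then - (\<Sum>i\<in>I - {j}. \<beta> i * c p i) / c p j else \<beta> i)" for i
    have split: "(\<Sum>i\<in>I. \<alpha> i * c k i) = \<alpha> j * c k j + (\<Sum>i\<in>I - {j}. \<beta> i * c k i)" for k
      using sum.remove[OF insert.prems(1) j(1), of "\<lambda>i. \<alpha> i * c k i"] by (simp add: \<alpha>_def)
    have "(\<Sum>i\<in>I. \<alpha> i * c p i) = 0" unfolding split using j(2) by (simp add: \<alpha>_def)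
    moreover have "(\<Sum>i\<in>I. \<alpha> i * c k i) = 0" if "k \<in> F" for k
    proof -
      have "(\<Sum>i\<in>I - {j}. \<beta> i * c' k i)
          = (\<Sum>i\<in>I - {j}. \<beta> i * c k i) - (\<Sum>i\<in>I - {j}. \<beta> i * c p i) * c k j / c p j"
        by (simp add: c'_def right_diff_distrib sum_subtractf sum_distrib_left sum_divide_distrib mult_ac)
      then show ?thesis unfolding split using sol[OF that] by (simp add: \<alpha>_def)
    qed
    ultimately show ?thesis using \<beta> by (intro exI[of _ \<alpha>]) (auto simp: \<alpha>_def)
  qed
qed

lemma geometric_tail: "(\<Sum>i=j..<j + l. (1/2::real) ^ i) \<le> 2 * (1/2) ^ j"
proof -
  have "(\<Sum>i=j..<j + l. (1/2::real) ^ i) = 2 * (1/2) ^ j - 2 * (1/2) ^ (j + l)"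
    by (induction l) simp_all
  then show ?thesis by simp
qed

text \<open>Indices \<open>m\<close> with \<open>g m = 0\<close> belong to no level; their values \<open>lev m\<close> are arbitrary.\<close>

locale dyadic_trace = positive_trace J f
  for J :: "('a::complex_hilbert_space \<Rightarrow> 'a) set" and f +
  fixes g :: "nat \<Rightarrow> 'a" and lev :: "nat \<Rightarrow> nat"
  assumes g: "orthosystem g" and finite_level: "\<And>j. finite {m. g m \<noteq> 0 \<and> lev m = j}"
    and D_in_J: "schmidt (\<lambda>m. (1/2) ^ lev m) g g \<in> J"
begin

definition D :: "'a \<Rightarrow> 'a"
  where "D = schmidt (\<lambda>m. (1/2) ^ lev m) g g"

definition level :: "nat \<Rightarrow> nat set"
  where "level j = {m. g m \<noteq> 0 \<and> lev m = j}"

definition eigenspace :: "nat \<Rightarrow> 'a set"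
  where "eigenspace j = {x. D x = (1/2) ^ j *\<^sub>R x}"

definition bounded_on_levels :: "('a \<Rightarrow> 'a) \<Rightarrow> real \<Rightarrow> bool"
  where "bounded_on_levels a \<delta> \<longleftrightarrow> (\<forall>j. \<forall>x\<in>eigenspace j. Re (cinner x (a x)) \<le> \<delta> * (norm x)\<^sup>2)"

lemma finite_level': "finite (level j)"
  unfolding level_def by (rule finite_level)

lemma weight_le: "\<bar>(1/2::real) ^ lev m\<bar> \<le> 1"
  by (simp add: power_le_one)

lemma D_J: "D \<in> J"
  by (simp add: D_def D_in_J)

lemma D_bounded: "D \<in> bounded_operators"
  by (rule J_bounded[OF D_J])

lemma D_positive: "D \<in> positive_operators"
  unfolding D_def by (rule schmidt_positive[OF g weight_le]) simp

lemma D_system: "g m \<noteq> 0 \<Longrightarrow> D (g m) = (1/2) ^ lev m *\<^sub>R g m"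
  unfolding D_def by (rule schmidt_system[OF g g weight_le])

lemma D_form_sums: "(\<lambda>m. (1/2) ^ lev m * (cmod (cinner (g m) x))\<^sup>2) sums Re (cinner x (D x))"
  unfolding D_def by (rule schmidt_form_sums[OF g weight_le])

lemma eigenspace_add: "x \<in> eigenspace j \<Longrightarrow> y \<in> eigenspace j \<Longrightarrow> x + y \<in> eigenspace j"
  by (simp add: eigenspace_def bounded_operators_add[OF D_bounded] scaleR_add_right)

lemma eigenspace_scaleC: "x \<in> eigenspace j \<Longrightarrow> c *\<^sub>C x \<in> eigenspace j"
  by (simp add: eigenspace_def bounded_operators_scaleC[OF D_bounded] scaleC.scaleR_right)

lemma eigenspace_zero: "0 \<in> eigenspace j"
  by (simp add: eigenspace_def bounded_operators_zero[OF D_bounded])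

lemma eigenspace_sum: "(\<And>i. i \<in> I \<Longrightarrow> x i \<in> eigenspace j) \<Longrightarrow> (\<Sum>i\<in>I. x i) \<in> eigenspace j"
  by (induction I rule: infinite_finite_induct) (auto intro: eigenspace_add eigenspace_zero)

lemma level_eigenspace: "m \<in> level j \<Longrightarrow> g m \<in> eigenspace j"
  by (auto simp: level_def eigenspace_def D_system)

text \<open>The sum is \<open>\<parallel>Q b y\<parallel>\<^sup>2\<close> for the projection \<open>Q\<close> onto the eigenspace, and
  \<open>\<parallel>Q b\<parallel>\<^sup>2 = \<parallel>Q b\<^sup>2 Q\<parallel> \<le> \<delta>\<close>.\<close>

lemma level_component_bound:
  assumes bb: "\<And>x. b (b x) = a x" and b: "b \<in> positive_operators"
    and \<delta>: "bounded_on_levels a \<delta>" "0 \<le> \<delta>"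
  shows "(\<Sum>m\<in>level j. (cmod (cinner (g m) (b y)))\<^sup>2) \<le> \<delta> * (norm y)\<^sup>2"
proof -
  define q where "q = (\<Sum>m\<in>level j. cinner (g m) (b y) *\<^sub>C g m)"
  define s where "s = (\<Sum>m\<in>level j. (cmod (cinner (g m) (b y)))\<^sup>2)"
  have s0: "0 \<le> s" by (simp add: s_def sum_nonneg)
  have "(norm q)\<^sup>2 = (\<Sum>m\<in>level j. (norm (cinner (g m) (b y) *\<^sub>C g m))\<^sup>2)"
    unfolding q_def by (rule norm_orthogonal_sum[OF finite_level']) (simp add: cinner_simps orthosystem_orth[OF g])
  also have "\<dots> = s"
    unfolding s_def
  proof (rule sum.cong)
    fix m assume "m \<in> level j"
    then have "norm (g m) = 1" using g by (auto simp: level_def orthosystem_def)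
    then show "(norm (cinner (g m) (b y) *\<^sub>C g m))\<^sup>2 = (cmod (cinner (g m) (b y)))\<^sup>2" by (simp add: norm_scaleC)
  qed simp
  finally have nq: "(norm q)\<^sup>2 = s" .
  have "cinner (b y) q = complex_of_real s"
    unfolding q_def s_def of_real_sum complex_norm_square cinner.sum_right cinner_scaleC_right
    by (intro sum.cong refl) (metis cinner_commute)
  moreover have "cinner (b y) q = cinner y (b q)"
    using positive_self_adjoint[OF b] by (simp add: is_adjoint_def)
  ultimately have s: "cinner y (b q) = complex_of_real s" by simp
  have "q \<in> eigenspace j" unfolding q_def by (intro eigenspace_sum eigenspace_scaleC level_eigenspace)
  then have "Re (cinner q (a q)) \<le> \<delta> * (norm q)\<^sup>2" using \<delta>(1) by (simp add: bounded_on_levels_def)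
  moreover have "cinner q (a q) = cinner (b q) (b q)"
    using positive_self_adjoint[OF b] by (simp add: is_adjoint_def bb[symmetric])
  ultimately have nbq: "(norm (b q))\<^sup>2 \<le> \<delta> * s" by (simp add: Re_cinner_self nq)
  have "s = cmod (cinner y (b q))" using s s0 by simp
  also have "\<dots> \<le> norm y * norm (b q)" by (rule Cauchy_Schwarz_cinner)
  finally have "s\<^sup>2 \<le> (norm y * norm (b q))\<^sup>2" using s0 by (rule power_mono)
  also have "\<dots> \<le> (norm y)\<^sup>2 * (\<delta> * s)" unfolding power_mult_distrib by (intro mult_left_mono nbq) simp
  finally have "s * s \<le> (\<delta> * (norm y)\<^sup>2) * s" by (simp add: power2_eq_square mult_ac)
  then have "s \<le> \<delta> * (norm y)\<^sup>2"
    using s0 \<delta>(2) by (cases "s = 0") (auto simp: order_less_le)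
  then show ?thesis by (simp add: s_def)
qed

text \<open>The levels from \<open>j\<close> on contribute at most \<open>\<Sum>i\<ge>j. 2\<^sup>-\<^sup>i \<delta>\<close>.\<close>

lemma tail_form_bound:
  assumes b: "b \<in> positive_operators"
    and lb: "\<And>i. (\<Sum>m\<in>level i. (cmod (cinner (g m) (b y)))\<^sup>2) \<le> \<delta> * (norm y)\<^sup>2"
    and zero: "\<And>m. g m \<noteq> 0 \<Longrightarrow> lev m < j \<Longrightarrow> cinner (g m) (b y) = 0"
  shows "Re (cinner (b y) (D (b y))) \<le> 2 * \<delta> * (1/2) ^ j * (norm y)\<^sup>2"
proof -
  define t where "t m = (1/2::real) ^ lev m * (cmod (cinner (g m) (b y)))\<^sup>2" for m
  have t0: "0 \<le> t m" for m by (simp add: t_def)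
  have d0: "0 \<le> \<delta> * (norm y)\<^sup>2" by (rule order_trans[OF sum_nonneg lb[of 0]]) simp
  have partial: "(\<Sum>m<n. t m) \<le> 2 * \<delta> * (1/2) ^ j * (norm y)\<^sup>2" for n
  proof -
    define l where "l = Suc (\<Sum>m<n. lev m)"
    have "(\<Sum>m<n. t m) = (\<Sum>m\<in>{m. m < n \<and> g m \<noteq> 0 \<and> j \<le> lev m}. t m)"
    proof (rule sum.mono_neutral_right)
      show "\<forall>m\<in>{..<n} - {m. m < n \<and> g m \<noteq> 0 \<and> j \<le> lev m}. t m = 0"
      proof
        fix m assume "m \<in> {..<n} - {m. m < n \<and> g m \<noteq> 0 \<and> j \<le> lev m}"
        then show "t m = 0" using zero[of m] by (cases "g m = 0") (auto simp: t_def cinner.zero_left)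
      qed
    qed auto
    also have "\<dots> \<le> (\<Sum>m\<in>(\<Union>i\<in>{j..<j + l}. level i). t m)"
    proof (rule sum_mono2)
      show "{m. m < n \<and> g m \<noteq> 0 \<and> j \<le> lev m} \<subseteq> (\<Union>i\<in>{j..<j + l}. level i)"
      proof
        fix m assume m: "m \<in> {m. m < n \<and> g m \<noteq> 0 \<and> j \<le> lev m}"
        then have "lev m \<le> (\<Sum>m<n. lev m)" by (intro member_le_sum) auto
        then show "m \<in> (\<Union>i\<in>{j..<j + l}. level i)" using m by (auto simp: level_def l_def)
      qed
    qed (use finite_level' t0 in auto)
    also have "\<dots> = (\<Sum>i=j..<j + l. \<Sum>m\<in>level i. t m)"
      by (rule sum.UNION_disjoint) (use finite_level' in \<open>auto simp: level_def\<close>)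
    also have "\<dots> \<le> (\<Sum>i=j..<j + l. (1/2) ^ i * (\<delta> * (norm y)\<^sup>2))"
    proof (rule sum_mono)
      fix i
      have "(\<Sum>m\<in>level i. t m) = (1/2) ^ i * (\<Sum>m\<in>level i. (cmod (cinner (g m) (b y)))\<^sup>2)"
        unfolding sum_distrib_left by (rule sum.cong) (auto simp: t_def level_def)
      also have "\<dots> \<le> (1/2) ^ i * (\<delta> * (norm y)\<^sup>2)" by (intro mult_left_mono lb) simp
      finally show "(\<Sum>m\<in>level i. t m) \<le> (1/2) ^ i * (\<delta> * (norm y)\<^sup>2)" .
    qed
    also have "\<dots> = (\<Sum>i=j..<j + l. (1/2) ^ i) * (\<delta> * (norm y)\<^sup>2)" by (simp add: sum_distrib_right)
    also have "\<dots> \<le> (2 * (1/2) ^ j) * (\<delta> * (norm y)\<^sup>2)" by (intro mult_right_mono geometric_tail d0)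
    finally show ?thesis by (simp add: mult_ac)
  qed
  have "t sums Re (cinner (b y) (D (b y)))" unfolding t_def[abs_def] by (rule D_form_sums)
  then show ?thesis using partial unfolding sums_def by (intro LIMSEQ_le_const2) auto
qed

text \<open>Positions are counted from 0 in the order of increasing level, and by index within a level.\<close>

definition position :: "nat \<Rightarrow> nat"
  where "position m = card {m'. g m' \<noteq> 0 \<and> (lev m' < lev m \<or> lev m' = lev m \<and> m' < m)}"

definition count_below :: "nat \<Rightarrow> nat"
  where "count_below j = card {m. g m \<noteq> 0 \<and> lev m < j}"

lemma finite_below: "finite {m. g m \<noteq> 0 \<and> lev m < j}"
proof -
  have "{m. g m \<noteq> 0 \<and> lev m < j} = (\<Union>i<j. level i)" by (auto simp: level_def)
  then show ?thesis using finite_level' by simp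
qed

lemma finite_before: "finite {m'. g m' \<noteq> 0 \<and> (lev m' < lev m \<or> lev m' = lev m \<and> m' < m)}"
  by (rule finite_subset[OF _ finite_below[of "Suc (lev m)"]]) auto

lemma position_less:
  assumes "g m \<noteq> 0" "lev m < lev m' \<or> lev m = lev m' \<and> m < m'"
  shows "position m < position m'"
  unfolding position_def
proof (rule psubset_card_mono[OF finite_before])
  show "{k. g k \<noteq> 0 \<and> (lev k < lev m \<or> lev k = lev m \<and> k < m)}
      \<subset> {k. g k \<noteq> 0 \<and> (lev k < lev m' \<or> lev k = lev m' \<and> k < m')}"
    using assms by auto
qed

lemma position_inj: "inj_on position {m. g m \<noteq> 0}"
proof (rule inj_onI)
  fix m m' assume *: "m \<in> {m. g m \<noteq> 0}" "m' \<in> {m. g m \<noteq> 0}" "position m = position m'"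
  show "m = m'"
  proof (rule ccontr)
    assume "m \<noteq> m'"
    then consider "lev m < lev m' \<or> lev m = lev m' \<and> m < m'" | "lev m' < lev m \<or> lev m' = lev m \<and> m' < m"
      by linarith
    then show False using position_less[of m m'] position_less[of m' m] * by cases auto
  qed
qed

lemma count_below_le_position: "count_below (lev m) \<le> position m"
  unfolding count_below_def position_def by (rule card_mono[OF finite_before]) auto

lemma position_surj:
  assumes "k < count_below j"
  shows "\<exists>m. g m \<noteq> 0 \<and> position m = k"
proof -
  let ?F = "{m. g m \<noteq> 0 \<and> lev m < j}"
  have "position m < count_below j" if "m \<in> ?F" for m
    unfolding count_below_def position_def by (rule psubset_card_mono[OF finite_below]) (use that in auto)
  then have "position ` ?F \<subseteq> {..<count_below j}" by auto
  moreover have "card (position ` ?F) = count_below j"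
    unfolding count_below_def by (rule card_image) (rule inj_on_subset[OF position_inj], auto)
  ultimately have "position ` ?F = {..<count_below j}" by (intro card_subset_eq) auto
  then have "k \<in> position ` ?F" using assms by simp
  then show ?thesis by auto
qed

text \<open>The min-max principle: \<open>k \<ge> count_below j\<close> leaves room for a nonzero vector \<open>y\<close> in the span of
  \<open>e\<^sub>0, \<dots>, e\<^sub>k\<close> such that \<open>b y\<close> has no component in the levels below \<open>j\<close>.\<close>

lemma eigenvalue_bound:
  assumes b: "b \<in> positive_operators" and e: "orthosystem e" and \<mu>: "\<And>n. 0 \<le> \<mu> n" "decseq \<mu>"
    and unit: "\<And>n. 0 < \<mu> n \<Longrightarrow> norm (e n) = 1"
    and sums: "\<And>x. (\<lambda>k. \<mu> k * (cmod (cinner (e k) x))\<^sup>2) sums Re (cinner (b x) (D (b x)))"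
    and lb: "\<And>i y. (\<Sum>m\<in>level i. (cmod (cinner (g m) (b y)))\<^sup>2) \<le> \<delta> * (norm y)\<^sup>2" and \<delta>: "0 \<le> \<delta>"
    and k: "count_below j \<le> k"
  shows "\<mu> k \<le> 2 * \<delta> * (1/2) ^ j"
proof (cases "\<mu> k = 0")
  case False
  then have pos: "0 < \<mu> i" if "i \<le> k" for i
    using \<mu>(1)[of k] decseqD[OF \<mu>(2) that] by linarith
  note bb = positive_bounded[OF b]
  let ?F = "{m. g m \<noteq> 0 \<and> lev m < j}"
  have "card ?F < card {..k}" using k by (simp add: count_below_def)
  from homogeneous_system_solution[OF finite_below _ this, of "\<lambda>m i. cinner (g m) (b (e i))"]
  obtain \<alpha> where \<alpha>: "\<exists>i\<in>{..k}. \<alpha> i \<noteq> 0" and sol: "\<And>m. m \<in> ?F \<Longrightarrow> (\<Sum>i\<le>k. \<alpha> i * cinner (g m) (b (e i))) = 0"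
    by auto
  define y where "y = (\<Sum>i\<le>k. \<alpha> i *\<^sub>C e i)"
  have ey: "cinner (e i) y = \<alpha> i" if "i \<le> k" for i
  proof -
    have "cinner (e i) y = (\<Sum>l\<le>k. \<alpha> l * cinner (e i) (e l))"
      by (simp add: y_def cinner.sum_right cinner_simps)
    also have "\<dots> = (\<Sum>l\<le>k. if l = i then \<alpha> i else 0)"
    proof (rule sum.cong)
      fix l
      have "e i \<noteq> 0" using unit[OF pos[OF that]] by auto
      then show "\<alpha> l * cinner (e i) (e l) = (if l = i then \<alpha> i else 0)"
        using orthosystem_orth[OF e, of i l] orthosystem_self[OF e, of i] by auto
    qed simp
    also have "\<dots> = \<alpha> i" using that by simp
    finally show ?thesis .
  qed
  have ny: "(norm y)\<^sup>2 = (\<Sum>i\<le>k. (cmod (\<alpha> i))\<^sup>2)"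
  proof -
    have "(norm y)\<^sup>2 = (\<Sum>i\<le>k. (norm (\<alpha> i *\<^sub>C e i))\<^sup>2)"
      unfolding y_def by (rule norm_orthogonal_sum) (simp_all add: cinner_simps orthosystem_orth[OF e])
    also have "\<dots> = (\<Sum>i\<le>k. (cmod (\<alpha> i))\<^sup>2)"
      by (rule sum.cong) (simp_all add: norm_scaleC unit pos)
    finally show ?thesis .
  qed
  have "0 < (norm y)\<^sup>2"
  proof -
    obtain i where "i \<in> {..k}" "\<alpha> i \<noteq> 0" using \<alpha> by blast
    then show ?thesis unfolding ny by (intro sum_pos2[of _ i]) auto
  qed
  have "\<mu> k * (norm y)\<^sup>2 = (\<Sum>i\<le>k. \<mu> k * (cmod (\<alpha> i))\<^sup>2)" unfolding ny by (rule sum_distrib_left)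
  also have "\<dots> \<le> (\<Sum>i\<le>k. \<mu> i * (cmod (cinner (e i) y))\<^sup>2)"
    by (intro sum_mono) (simp add: ey mult_right_mono decseqD[OF \<mu>(2)])
  also have "\<dots> \<le> Re (cinner (b y) (D (b y)))"
    using sum_le_suminf[OF sums_summable[OF sums[of y]], of "{..k}"] sums_unique[OF sums[of y]] \<mu>(1) by simp
  also have "\<dots> \<le> 2 * \<delta> * (1/2) ^ j * (norm y)\<^sup>2"
  proof (rule tail_form_bound[OF b lb])
    fix m assume "g m \<noteq> 0" "lev m < j"
    have "cinner (g m) (b y) = (\<Sum>i\<le>k. \<alpha> i * cinner (g m) (b (e i)))"
      by (simp add: y_def bounded_operators_sum[OF bb] bounded_operators_scaleC[OF bb] cinner.sum_right cinner_simps)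
    then show "cinner (g m) (b y) = 0" using sol[of m] \<open>g m \<noteq> 0\<close> \<open>lev m < j\<close> by simp
  qed
  finally show ?thesis using \<open>0 < (norm y)\<^sup>2\<close> by (rule mult_right_le_imp_le)
qed (use \<delta> in simp)

text \<open>With \<open>b\<^sup>2 = a\<close> one has \<open>f (a D) = f (b D b)\<close>. The eigenvalue number \<open>k\<close> of \<open>b D b\<close> is at most
  \<open>2 \<delta>\<close> times the eigenvalue of \<open>D\<close> in position \<open>k\<close>. Hence \<open>b D b \<le> 2 \<delta> V D V\<^sup>*\<close> with the partial
  isometry \<open>V\<close> that maps the eigenvectors of \<open>D\<close> to those of \<open>b D b\<close>, and
  \<open>f (V D V\<^sup>*) = f (V\<^sup>* V D) \<le> f (D)\<close>.\<close>

proposition trace_le_level_bound: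
  assumes a: "a \<in> positive_operators" and \<delta>: "bounded_on_levels a \<delta>" "0 \<le> \<delta>"
  shows "Re (f (a \<circ> D)) \<le> 2 * \<delta> * Re (f D)"
proof -
  obtain b where b: "b \<in> positive_operators" and "b \<circ> b = a"
    using positive_sqrt[OF bounded_operators_strongly_closed_algebra positive_bounded[OF a] a] by blast
  then have bb: "b (b x) = a x" for x by (metis comp_apply)
  note bB = positive_bounded[OF b]
  define A where "A = b \<circ> (D \<circ> b)"
  have AJ: "A \<in> J" unfolding A_def by (intro J_left J_right bB D_J)
  have A: "A \<in> positive_operators"
    unfolding A_def by (rule conjugate_positive[OF D_positive bB bB positive_self_adjoint[OF b]])
  have fA: "f (a \<circ> D) = f A"
    using f_commute[OF bB J_left[OF bB D_J]] by (simp add: A_def \<open>b \<circ> b = a\<close>[symmetric] comp_assoc)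
  have formA: "cinner x (A x) = cinner (b x) (D (b x))" for x
    using positive_self_adjoint[OF b] by (simp add: A_def is_adjoint_def)
  obtain e \<mu> where e: "orthosystem e" and \<mu>: "\<And>n. 0 \<le> \<mu> n" "decseq \<mu>"
    and unit: "\<And>n. 0 < \<mu> n \<Longrightarrow> norm (e n) = 1"
    and sums: "\<And>x. (\<lambda>k. \<mu> k * (cmod (cinner (e k) x))\<^sup>2) sums Re (cinner x (A x))"
    by (rule spectral_decomposition[OF AJ A], rule that)
  have bound: "\<mu> k \<le> 2 * \<delta> * (1/2) ^ j" if "count_below j \<le> k" for j k
    using eigenvalue_bound[OF b e \<mu> unit sums[unfolded formA] level_component_bound[OF bb b \<delta>] \<delta>(2) that] .
  have hit: "\<exists>m. g m \<noteq> 0 \<and> position m = k" if "0 < \<mu> k" for k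
  proof (rule ccontr)
    assume no: "\<nexists>m. g m \<noteq> 0 \<and> position m = k"
    have "\<mu> k \<le> 2 * \<delta> * (1/2) ^ j" for j
      using position_surj[of k j] no by (intro bound) (meson not_le)
    moreover have "(\<lambda>j. 2 * \<delta> * (1/2) ^ j) \<longlonglongrightarrow> 2 * \<delta> * 0"
      by (intro tendsto_mult tendsto_const LIMSEQ_realpow_zero) auto
    ultimately have "\<mu> k \<le> 2 * \<delta> * 0" by (intro LIMSEQ_le_const) auto
    then show False using that by simp
  qed
  define e' where "e' m = (if g m = 0 then 0 else e (position m))" for m
  have e': "orthosystem e'"
    unfolding orthosystem_def
  proof (intro conjI allI impI)
    fix m n :: nat assume "m \<noteq> n"
    then have "position m \<noteq> position n" if "g m \<noteq> 0" "g n \<noteq> 0"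
      using that position_inj by (auto simp: inj_on_def)
    then show "cinner (e' m) (e' n) = 0"
      using orthosystem_orth[OF e] by (simp add: e'_def cinner.zero_left cinner.zero_right)
  next
    show "norm (e' n) = 1 \<or> e' n = 0" for n using e by (auto simp: e'_def orthosystem_def)
  qed
  have one: "\<bar>1::real\<bar> \<le> 1" for n :: nat by simp
  define V where "V = schmidt (\<lambda>_. 1) g e'"
  define W where "W = schmidt (\<lambda>_. 1) e' g"
  have VB: "V \<in> bounded_operators" unfolding V_def by (rule schmidt_bounded_operator[OF g e' one])
  have WB: "W \<in> bounded_operators" unfolding W_def by (rule schmidt_bounded_operator[OF e' g one])
  have WV: "is_adjoint W V" unfolding V_def W_def by (rule schmidt_adjoint[OF e' g one])
  have gW: "cinner (g m) (W x) = cinner (e' m) x" for m x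
    unfolding W_def by (subst cinner_system_schmidt[OF e' g one]) (simp add: e'_def cinner.zero_left)
  define B where "B = V \<circ> (D \<circ> W)"
  have BJ: "B \<in> J" unfolding B_def by (intro J_left J_right VB WB D_J)
  have B: "B \<in> positive_operators" unfolding B_def by (rule conjugate_positive[OF D_positive WB VB WV])
  have formB: "(\<lambda>m. (1/2) ^ lev m * (cmod (cinner (e' m) x))\<^sup>2) sums Re (cinner x (B x))" for x
    using D_form_sums[of "W x"] WV by (simp add: B_def is_adjoint_def gW)
  have AB: "Re (cinner x (A x)) \<le> 2 * \<delta> * Re (cinner x (B x))" for x
  proof -
    have "(\<Sum>k<n. \<mu> k * (cmod (cinner (e k) x))\<^sup>2) \<le> 2 * \<delta> * Re (cinner x (B x))" for n
    proof -
      define S where "S = {m. g m \<noteq> 0 \<and> position m < n}"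
      have injS: "inj_on position S" by (rule inj_on_subset[OF position_inj]) (auto simp: S_def)
      have "position ` S \<subseteq> {..<n}" by (auto simp: S_def)
      then have finS: "finite S" using injS finite_imageD finite_subset by blast
      have "(\<Sum>k<n. \<mu> k * (cmod (cinner (e k) x))\<^sup>2) = (\<Sum>k\<in>position ` S. \<mu> k * (cmod (cinner (e k) x))\<^sup>2)"
      proof (rule sum.mono_neutral_right)
        show "\<forall>k\<in>{..<n} - position ` S. \<mu> k * (cmod (cinner (e k) x))\<^sup>2 = 0"
        proof
          fix k assume k: "k \<in> {..<n} - position ` S"
          then have "\<not> 0 < \<mu> k" using hit[of k] by (auto simp: S_def)
          then show "\<mu> k * (cmod (cinner (e k) x))\<^sup>2 = 0" using \<mu>(1)[of k] by simp
        qed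
      qed (use \<open>position ` S \<subseteq> {..<n}\<close> in auto)
      also have "\<dots> = (\<Sum>m\<in>S. \<mu> (position m) * (cmod (cinner (e (position m)) x))\<^sup>2)"
        by (simp add: sum.reindex[OF injS])
      also have "\<dots> \<le> (\<Sum>m\<in>S. 2 * \<delta> * ((1/2) ^ lev m * (cmod (cinner (e' m) x))\<^sup>2))"
      proof (rule sum_mono)
        fix m assume m: "m \<in> S"
        have "\<mu> (position m) * (cmod (cinner (e (position m)) x))\<^sup>2
            \<le> (2 * \<delta> * (1/2) ^ lev m) * (cmod (cinner (e (position m)) x))\<^sup>2"
          by (intro mult_right_mono bound count_below_le_position) simp
        then show "\<mu> (position m) * (cmod (cinner (e (position m)) x))\<^sup>2
            \<le> 2 * \<delta> * ((1/2) ^ lev m * (cmod (cinner (e' m) x))\<^sup>2)"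
          using m by (simp add: e'_def S_def mult_ac)
      qed
      also have "\<dots> = 2 * \<delta> * (\<Sum>m\<in>S. (1/2) ^ lev m * (cmod (cinner (e' m) x))\<^sup>2)"
        by (simp add: sum_distrib_left)
      also have "\<dots> \<le> 2 * \<delta> * Re (cinner x (B x))"
        using sum_le_suminf[OF sums_summable[OF formB[of x]] finS] sums_unique[OF formB[of x]] \<delta>(2)
        by (intro mult_left_mono) auto
      finally show ?thesis .
    qed
    then show ?thesis using sums[of x] unfolding sums_def by (intro LIMSEQ_le_const2) auto
  qed
  have "Re (f A) \<le> Re (f (\<lambda>x. (2 * \<delta>) *\<^sub>R B x))"
  proof (rule f_mono[OF AJ J_scaleR[OF BJ]], rule positive_operatorsI)
    show "is_adjoint (\<lambda>x. (2 * \<delta>) *\<^sub>R B x - A x) (\<lambda>x. (2 * \<delta>) *\<^sub>R B x - A x)"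
      by (intro is_adjoint_diff is_adjoint_scaleR positive_self_adjoint[OF A] positive_self_adjoint[OF B])
    show "0 \<le> Re (cinner x ((2 * \<delta>) *\<^sub>R B x - A x))" for x using AB[of x] by (simp add: cinner_simps)
  qed (intro diff_bounded_operator scaleR_bounded_operator J_bounded AJ BJ)
  then have "Re (f A) \<le> 2 * \<delta> * Re (f B)" by (simp add: f_scaleR[OF BJ])
  also have "\<dots> \<le> 2 * \<delta> * Re (f D)"
  proof (rule mult_left_mono)
    have P: "(\<lambda>x. x - (W \<circ> V) x) \<in> positive_operators"
    proof (rule positive_operatorsI)
      show "is_adjoint (\<lambda>x. x - (W \<circ> V) x) (\<lambda>x. x - (W \<circ> V) x)"
        by (intro is_adjoint_diff is_adjoint_id is_adjoint_comp WV is_adjoint_sym[OF WV])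
      fix x
      have "norm (V x) \<le> 1 * norm x" unfolding V_def by (rule schmidt_norm_le[OF g e' one])
      then have "(norm (V x))\<^sup>2 \<le> (norm x)\<^sup>2" by (simp add: power_mono)
      moreover have "cinner x (W (V x)) = cinner (V x) (V x)"
        using is_adjoint_sym[OF WV] by (simp add: is_adjoint_def)
      ultimately show "0 \<le> Re (cinner x (x - (W \<circ> V) x))" by (simp add: cinner_simps Re_cinner_self)
    qed (intro diff_bounded_operator id_bounded_operator comp_bounded_operator VB WB)
    have PDJ: "(\<lambda>x. x - (W \<circ> V) x) \<circ> D \<in> J"
      by (rule J_left[OF positive_bounded[OF P] D_J])
    have "f B = f (D \<circ> (W \<circ> V))"
      unfolding B_def f_commute[OF VB J_right[OF WB D_J]] by (simp only: comp_assoc)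
    also have "\<dots> = f ((W \<circ> V) \<circ> D)"
      by (rule f_commute[OF comp_bounded_operator[OF WB VB] D_J, symmetric])
    also have "\<dots> = f D - f ((\<lambda>x. x - (W \<circ> V) x) \<circ> D)"
      using f_diff[OF D_J PDJ] by (simp add: o_def)
    finally show "Re (f B) \<le> Re (f D)" using trace_comp_nonneg[OF P D_J D_positive] by (simp add: complex_nonneg_Reals_iff)
  qed (use \<delta>(2) in simp)
  finally show ?thesis by (simp add: fA)
qed

end


section \<open>Averaging over reflections\<close>

lemma orthonormal_subset: "orthonormal S \<Longrightarrow> T \<subseteq> S \<Longrightarrow> orthonormal T"
  unfolding orthonormal_def by blast

lemma orthonormal_independent:
  assumes "orthonormal S"
  shows "\<not> complex_vector.dependent S"
  unfolding complex_vector.independent_explicit_finite_subsets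
proof (intro allI ballI impI)
  fix A u v assume A: "A \<subseteq> S" "finite A" and zero: "(\<Sum>v\<in>A. u v *\<^sub>C v) = 0" and v: "v \<in> A"
  have vw: "cinner v w = (if v = w then 1 else 0)" if "w \<in> A" for w
    using assms A v that unfolding orthonormal_def by blast
  have "cinner v (\<Sum>w\<in>A. u w *\<^sub>C w) = (\<Sum>w\<in>A. if w = v then u v else 0)"
    unfolding cinner.sum_right by (rule sum.cong) (auto simp: cinner_simps vw)
  then show "u v = 0" using A v by (simp add: zero cinner.zero_right)
qed

lemma orthonormal_finite_card:
  assumes "finite G" "orthonormal F" "F \<subseteq> complex_vector.span G"
  shows "finite F" "card F \<le> card G"
  using complex_vector.independent_span_bound[OF assms(1) orthonormal_independent[OF assms(2)] assms(3)] by auto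

text \<open>The Gram--Schmidt step.\<close>

lemma orthonormal_insert:
  assumes F: "finite F" "orthonormal F" and V: "complex_vector.subspace V" "F \<subseteq> V" "x \<in> V"
    and nz: "x \<noteq> (\<Sum>v\<in>F. cinner v x *\<^sub>C v)"
  shows "\<exists>u. u \<notin> F \<and> u \<in> V \<and> orthonormal (insert u F)"
proof -
  define z where "z = x - (\<Sum>v\<in>F. cinner v x *\<^sub>C v)"
  have z0: "z \<noteq> 0" using nz by (simp add: z_def)
  have zV: "z \<in> V"
    unfolding z_def using V
    by (intro complex_vector.subspace_diff complex_vector.subspace_sum complex_vector.subspace_scale) auto
  have vz: "cinner v z = 0" if "v \<in> F" for v
    unfolding z_def by (rule orthonormal_residual[OF F that])
  define u where "u = (1 / norm z) *\<^sub>R z"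
  have vu: "cinner v u = 0" "cinner u v = 0" if "v \<in> F" for v
    using vz[OF that] cinner_zero_commute[of v z] by (simp_all add: u_def cinner_simps)
  have uu: "cinner u u = 1" using z0 by (simp add: u_def cinner_self)
  have "u \<notin> F" using vu uu by force
  moreover have "u \<in> V"
    unfolding u_def scaleR_scaleC using V(1) zV by (rule complex_vector.subspace_scale)
  moreover have "orthonormal (insert u F)" using F(2) vu uu \<open>u \<notin> F\<close> by (auto simp: orthonormal_def)
  ultimately show ?thesis by blast
qed

lemma orthonormal_expansion:
  assumes G: "finite G" and F: "orthonormal F" "F \<subseteq> complex_vector.span G" "card F = card G"
    and x: "x \<in> complex_vector.span G"
  shows "x = (\<Sum>v\<in>F. cinner v x *\<^sub>C v)"
proof (rule ccontr)
  assume ne: "x \<noteq> (\<Sum>v\<in>F. cinner v x *\<^sub>C v)"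
  note finF = orthonormal_finite_card(1)[OF G F(1,2)]
  from orthonormal_insert[OF finF F(1) complex_vector.subspace_span F(2) x ne]
  obtain u where u: "u \<notin> F" "u \<in> complex_vector.span G" "orthonormal (insert u F)" by blast
  then have "card (insert u F) \<le> card G" using F(2) by (intro orthonormal_finite_card(2)[OF G]) auto
  then show False using u finF F(3) by simp
qed

lemma orthonormal_extension:
  assumes G: "finite G" "orthonormal G" and F: "orthonormal F" "F \<subseteq> complex_vector.span G"
  shows "\<exists>F'. F \<subseteq> F' \<and> F' \<subseteq> complex_vector.span G \<and> orthonormal F' \<and> card F' = card G"
proof -
  have "\<exists>F'. F \<subseteq> F' \<and> F' \<subseteq> complex_vector.span G \<and> orthonormal F' \<and> card F' = card F + k"
    if "card F + k \<le> card G" for k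
    using that
  proof (induction k)
    case (Suc k)
    then obtain F' where F': "F \<subseteq> F'" "F' \<subseteq> complex_vector.span G" "orthonormal F'" "card F' = card F + k" by auto
    have fin: "finite F'" by (rule orthonormal_finite_card(1)[OF G(1) F'(3,2)])
    have "\<exists>x\<in>G. x \<noteq> (\<Sum>v\<in>F'. cinner v x *\<^sub>C v)"
    proof (rule ccontr)
      assume "\<not> ?thesis"
      moreover have "(\<Sum>v\<in>F'. cinner v x *\<^sub>C v) \<in> complex_vector.span F'" for x
        by (intro complex_vector.span_sum complex_vector.span_scale complex_vector.span_base)
      ultimately have "G \<subseteq> complex_vector.span F'" by (metis subsetI)
      from orthonormal_finite_card(2)[OF fin G(2) this] show False using F'(4) Suc.prems by simp
    qed
    then obtain x where x: "x \<in> G" "x \<noteq> (\<Sum>v\<in>F'. cinner v x *\<^sub>C v)" by blast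
    from orthonormal_insert[OF fin F'(3) complex_vector.subspace_span F'(2) complex_vector.span_base[OF x(1)] x(2)]
    obtain u where "u \<notin> F'" "u \<in> complex_vector.span G" "orthonormal (insert u F')" by blast
    then show ?case using F' fin by (intro exI[of _ "insert u F'"]) auto
  qed (use F in auto)
  from this[of "card G - card F"] orthonormal_finite_card(2)[OF G(1) F] show ?thesis by simp
qed

lemma orthonormal_enumeration:
  assumes "countable S" "orthonormal S"
  shows "\<exists>u. orthosystem u \<and> S \<subseteq> range u \<and> range u \<subseteq> insert 0 S"
proof -
  define u where "u n = (if n \<in> to_nat_on S ` S then from_nat_into S n else 0)" for n
  have u: "u (to_nat_on S s) = s" if "s \<in> S" for s
    using that assms(1) by (simp add: u_def)
  have uS: "u n = 0 \<or> (\<exists>s\<in>S. n = to_nat_on S s \<and> u n = s)" for n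
    using u by (auto simp: u_def)
  have "orthosystem u"
    unfolding orthosystem_def
  proof (intro conjI allI impI)
    fix m n :: nat assume "m \<noteq> n"
    then show "cinner (u m) (u n) = 0"
      using uS[of m] uS[of n] assms(2) by (auto simp: orthonormal_def cinner.zero_left cinner.zero_right)
  next
    fix n
    show "norm (u n) = 1 \<or> u n = 0"
    proof (cases "u n = 0")
      case False
      then have "u n \<in> S" using uS[of n] by auto
      then show ?thesis using orthonormal_norm[OF assms(2)] by blast
    qed simp
  qed
  moreover have "S \<subseteq> range u" using u by (metis rangeI subsetI)
  moreover have "range u \<subseteq> insert 0 S" using uS by blast
  ultimately show ?thesis by blast
qed

context dyadic_trace
begin

lemma half_power_inject: "(1/2::real) ^ i = (1/2) ^ j \<longleftrightarrow> i = j"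
  by (simp add: power_one_over)

lemma eigenspace_expand:
  assumes x: "x \<in> eigenspace j"
  shows "x = (\<Sum>m\<in>level j. cinner (g m) x *\<^sub>C g m)"
proof -
  have Dx: "D x = (1/2) ^ j *\<^sub>R x" using x by (simp add: eigenspace_def)
  have zero: "cinner (g m) x = 0" if "m \<notin> level j" for m
  proof (cases "g m = 0")
    case False
    then have "lev m \<noteq> j" using that by (simp add: level_def)
    have "complex_of_real ((1/2) ^ lev m) * cinner (g m) x = complex_of_real ((1/2) ^ j) * cinner (g m) x"
      using cinner_system_schmidt[where c="\<lambda>m. (1/2) ^ lev m" and x=x and k=m, OF g g weight_le] Dx False
      by (auto simp: D_def cinner_simps)
    then have "(1/2::real) ^ lev m = (1/2) ^ j \<or> cinner (g m) x = 0"
      by (simp only: mult_cancel_right of_real_eq_iff) blast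
    then show ?thesis using \<open>lev m \<noteq> j\<close> half_power_inject by blast
  qed (simp add: cinner.zero_left)
  have "(\<lambda>m. (complex_of_real ((1/2) ^ lev m) * cinner (g m) x) *\<^sub>C g m) sums
      (\<Sum>m\<in>level j. (complex_of_real ((1/2) ^ lev m) * cinner (g m) x) *\<^sub>C g m)"
    by (rule sums_finite[OF finite_level']) (simp add: zero scaleC.zero_left)
  moreover have "(\<lambda>m. (complex_of_real ((1/2) ^ lev m) * cinner (g m) x) *\<^sub>C g m) sums D x"
    unfolding D_def by (rule schmidt_sums[OF g g weight_le])
  ultimately have "D x = (\<Sum>m\<in>level j. (complex_of_real ((1/2) ^ lev m) * cinner (g m) x) *\<^sub>C g m)"
    by (rule sums_unique2[symmetric])
  also have "\<dots> = (\<Sum>m\<in>level j. (1/2) ^ j *\<^sub>R (cinner (g m) x *\<^sub>C g m))"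
    by (rule sum.cong) (auto simp: level_def scaleR_scaleC scaleC_scaleC)
  also have "\<dots> = (1/2) ^ j *\<^sub>R (\<Sum>m\<in>level j. cinner (g m) x *\<^sub>C g m)" by (simp add: scaleR_sum_right)
  finally show ?thesis unfolding Dx by (simp only: scaleR_cancel_left) simp
qed

lemma eigenspace_orthogonal:
  assumes "x \<in> eigenspace i" "y \<in> eigenspace j" "i \<noteq> j"
  shows "cinner x y = 0"
proof -
  have "cinner (D x) y = cinner x (D y)" using positive_self_adjoint[OF D_positive] by (simp add: is_adjoint_def)
  then have "complex_of_real ((1/2) ^ i) * cinner x y = complex_of_real ((1/2) ^ j) * cinner x y"
    using assms by (simp only: eigenspace_def mem_Collect_eq cinner_simps)
  then have "(1/2::real) ^ i = (1/2) ^ j \<or> cinner x y = 0"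
    by (simp only: mult_cancel_right of_real_eq_iff) blast
  then show ?thesis using assms(3) half_power_inject by blast
qed

lemma eigenspace_subspace: "complex_vector.subspace (eigenspace j)"
  by (rule complex_vector.subspaceI) (auto intro: eigenspace_zero eigenspace_add eigenspace_scaleC)

lemma eigenspace_span: "eigenspace j = complex_vector.span (g ` level j)"
proof
  show "complex_vector.span (g ` level j) \<subseteq> eigenspace j"
    by (rule complex_vector.span_minimal) (auto intro: level_eigenspace eigenspace_subspace)
  show "eigenspace j \<subseteq> complex_vector.span (g ` level j)"
  proof
    fix x assume "x \<in> eigenspace j"
    then have "x = (\<Sum>m\<in>level j. cinner (g m) x *\<^sub>C g m)" by (rule eigenspace_expand)
    also have "\<dots> \<in> complex_vector.span (g ` level j)"
      by (intro complex_vector.span_sum complex_vector.span_scale complex_vector.span_base) simp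
    finally show "x \<in> complex_vector.span (g ` level j)" .
  qed
qed

lemma level_orthonormal: "orthonormal (g ` level j)"
  unfolding orthonormal_def
  using orthosystem_orth[OF g] orthosystem_self[OF g] by (auto simp: level_def) metis

lemma card_level: "card (g ` level j) = card (level j)"
proof (rule card_image, rule inj_onI)
  fix m n assume "m \<in> level j" "n \<in> level j" "g m = g n"
  then show "m = n"
    using orthosystem_orth[OF g, of m n] orthosystem_self[OF g, of m] by (auto simp: level_def)
qed

text \<open>Formulated for all orthonormal families, this bound on the trace of \<open>a\<close> compressed to an
  eigenspace of \<open>D\<close> is visibly invariant under unitaries that preserve the eigenspaces.\<close>

definition trace_bounded :: "('a \<Rightarrow> 'a) \<Rightarrow> real \<Rightarrow> bool"
  where "trace_bounded a \<epsilon> \<longleftrightarrow> (\<forall>j F. orthonormal F \<longrightarrow> F \<subseteq> eigenspace j \<longrightarrow>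
    (\<Sum>v\<in>F. Re (cinner v (a v))) \<le> \<epsilon> * card (level j))"

lemma diagonal_trace_bounded:
  assumes a: "a \<in> positive_operators" and diag: "\<And>m. g m \<noteq> 0 \<Longrightarrow> Re (cinner (g m) (a (g m))) \<le> \<epsilon>"
  shows "trace_bounded a \<epsilon>"
  unfolding trace_bounded_def
proof (intro allI impI)
  fix j F assume F: "orthonormal F" "F \<subseteq> eigenspace j"
  note ab = positive_bounded[OF a]
  have fin: "finite (g ` level j)" using finite_level' by simp
  from orthonormal_extension[OF fin level_orthonormal F(1) F(2)[unfolded eigenspace_span]]
  obtain F' where F': "F \<subseteq> F'" "F' \<subseteq> complex_vector.span (g ` level j)" "orthonormal F'"
    "card F' = card (g ` level j)" by blast
  note finF' = orthonormal_finite_card(1)[OF fin F'(3,2)]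
  have "(\<Sum>v\<in>F. Re (cinner v (a v))) \<le> (\<Sum>v\<in>F'. Re (cinner v (a v)))"
    by (rule sum_mono2[OF finF' F'(1)]) (rule positive_Re_ge_0[OF a])
  also have "\<dots> = Re (\<Sum>v\<in>F'. \<Sum>m\<in>level j. cinner (g m) v * cinner v (a (g m)))"
    unfolding Re_sum[of _ F']
  proof (rule sum.cong)
    fix v assume "v \<in> F'"
    then have "v = (\<Sum>m\<in>level j. cinner (g m) v *\<^sub>C g m)"
      using F'(2) by (intro eigenspace_expand) (auto simp: eigenspace_span)
    then have "cinner v (a v) = cinner v (a (\<Sum>m\<in>level j. cinner (g m) v *\<^sub>C g m))" by simp
    also have "\<dots> = (\<Sum>m\<in>level j. cinner (g m) v * cinner v (a (g m)))"
      by (simp add: bounded_operators_sum[OF ab] bounded_operators_scaleC[OF ab] cinner.sum_right cinner_simps)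
    finally show "Re (cinner v (a v)) = Re (\<Sum>m\<in>level j. cinner (g m) v * cinner v (a (g m)))" by simp
  qed simp
  also have "(\<Sum>v\<in>F'. \<Sum>m\<in>level j. cinner (g m) v * cinner v (a (g m)))
      = (\<Sum>m\<in>level j. \<Sum>v\<in>F'. cinner (g m) v * cinner v (a (g m)))" by (rule sum.swap)
  also have "\<dots> = (\<Sum>m\<in>level j. cinner (g m) (a (g m)))"
  proof (rule sum.cong)
    fix m assume "m \<in> level j"
    then have "g m = (\<Sum>v\<in>F'. cinner v (g m) *\<^sub>C v)"
      by (intro orthonormal_expansion[OF fin F'(3,2,4)] complex_vector.span_base) simp
    then have "cinner (g m) (a (g m)) = cinner (\<Sum>v\<in>F'. cinner v (g m) *\<^sub>C v) (a (g m))" by simp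
    also have "\<dots> = (\<Sum>v\<in>F'. cinner (g m) v * cinner v (a (g m)))"
      by (simp add: cinner.sum_left cinner_simps cinner_commute[symmetric])
    finally show "(\<Sum>v\<in>F'. cinner (g m) v * cinner v (a (g m))) = cinner (g m) (a (g m))" by simp
  qed simp
  also have "Re (\<Sum>m\<in>level j. cinner (g m) (a (g m))) = (\<Sum>m\<in>level j. Re (cinner (g m) (a (g m))))" by simp
  also have "\<dots> \<le> (\<Sum>m\<in>level j. \<epsilon>)" by (rule sum_mono) (use diag in \<open>simp add: level_def\<close>)
  also have "\<dots> = \<epsilon> * card (level j)" by simp
  finally show "(\<Sum>v\<in>F. Re (cinner v (a v))) \<le> \<epsilon> * card (level j)" .
qed

text \<open>The eigenvectors of the compression of \<open>a\<close> to the eigenspace with eigenvalue above \<open>2 \<epsilon>\<close> make up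
  at most half of the dimension, by the bound on the trace. So each of them can be paired with
  another vector, which lies in the part where \<open>a \<le> 2 \<epsilon>\<close>.\<close>

lemma heavy_vectors:
  assumes a: "a \<in> positive_operators" and tr: "trace_bounded a \<epsilon>" and \<epsilon>: "0 < \<epsilon>"
    and \<delta>: "bounded_on_levels a \<delta>"
  shows "\<exists>F w. orthonormal (F \<union> w ` F) \<and> finite F \<and> inj_on w F \<and> F \<inter> w ` F = {} \<and>
    F \<subseteq> eigenspace j \<and> w ` F \<subseteq> eigenspace j \<and>
    (\<forall>x\<in>eigenspace j. Re (cinner x (a x)) \<le> 2 * \<epsilon> * (norm x)\<^sup>2 + (\<delta> - 2 * \<epsilon>) * (\<Sum>v\<in>F. (cmod (cinner v x))\<^sup>2))"
proof -
  note ab = positive_bounded[OF a]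
  define Q where "Q x = (\<Sum>m\<in>level j. cinner (g m) x *\<^sub>C g m)" for x
  have "Q \<in> finite_rank_operators"
    unfolding Q_def[abs_def] by (rule finite_sum_finite_rank[OF finite_level'])
  then have QJ: "Q \<in> J" using finite_rank by blast
  note Qb = J_bounded[OF QJ]
  have Qadj: "is_adjoint Q Q"
    unfolding is_adjoint_def Q_def
    by (simp add: cinner.sum_left cinner.sum_right cinner_simps cinner_commute[symmetric] mult.commute)
  have QE: "Q x \<in> eigenspace j" for x
    unfolding Q_def by (intro eigenspace_sum eigenspace_scaleC level_eigenspace)
  have Qx: "Q x = x" if "x \<in> eigenspace j" for x
    using eigenspace_expand[OF that] by (simp add: Q_def)
  define K where "K = Q \<circ> (a \<circ> Q)"
  have KJ: "K \<in> J" unfolding K_def by (intro J_left Qb ab QJ)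
  have K: "K \<in> positive_operators" unfolding K_def by (rule conjugate_positive[OF a Qb Qb Qadj])
  have aK: "cinner x (K y) = cinner x (a y)" if "x \<in> eigenspace j" "y \<in> eigenspace j" for x y
    using Qadj that Qx by (simp add: K_def is_adjoint_def) metis
  obtain e \<mu> where e: "orthosystem e" and \<mu>: "\<And>n. 0 \<le> \<mu> n" "decseq \<mu>" "\<mu> \<longlonglongrightarrow> 0"
    and Ke: "\<And>n. K (e n) = \<mu> n *\<^sub>R e n" and unit: "\<And>n. 0 < \<mu> n \<Longrightarrow> norm (e n) = 1"
    and rest: "\<And>n z. \<forall>k<n. cinner (e k) z = 0 \<Longrightarrow> Re (cinner z (K z)) \<le> \<mu> n * (norm z)\<^sup>2"
    by (rule spectral_decomposition[OF KJ K], rule that)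
  have ex: "\<exists>n. \<mu> n \<le> 2 * \<epsilon>"
    using LIMSEQ_D[OF \<mu>(3), of "2 * \<epsilon>"] \<epsilon> \<mu>(1) by (metis abs_of_nonneg diff_zero less_imp_le mult_pos_pos order_refl real_norm_def zero_less_numeral)
  define n where "n = (LEAST n. \<mu> n \<le> 2 * \<epsilon>)"
  have \<mu>n: "\<mu> n \<le> 2 * \<epsilon>" unfolding n_def using ex by (rule LeastI_ex)
  have big: "2 * \<epsilon> < \<mu> k" if "k < n" for k using not_less_Least[of k "\<lambda>n. \<mu> n \<le> 2 * \<epsilon>"] that by (simp add: n_def)
  have e1: "norm (e k) = 1" if "k < n" for k using unit big[OF that] \<epsilon> by simp
  have ee: "cinner (e k) (e l) = (if k = l then 1 else 0)" if "k < n" "l < n" for k l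
    using orthosystem_orth[OF e] e1[OF that(1)] by (cases "k = l") (auto simp: cinner_self)
  have eE: "e k \<in> eigenspace j" if "k < n" for k
  proof -
    have "e k = (1 / \<mu> k) *\<^sub>R K (e k)" using big[OF that] \<epsilon> by (simp add: Ke)
    also have "\<dots> \<in> eigenspace j" unfolding scaleR_scaleC by (intro eigenspace_scaleC) (simp add: K_def QE)
    finally show ?thesis .
  qed
  define F where "F = e ` {..<n}"
  have inj: "inj_on e {..<n}"
  proof (rule inj_onI)
    fix k l assume *: "k \<in> {..<n}" "l \<in> {..<n}" "e k = e l"
    show "k = l" using ee[of k k] ee[of k l] * by (auto split: if_splits)
  qed
  have F: "orthonormal F" "finite F" "F \<subseteq> eigenspace j" and cardF: "card F = n"
    using ee eE inj by (auto simp: F_def orthonormal_def card_image inj_on_def)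
  have "2 * \<epsilon> * n \<le> \<epsilon> * card (level j)"
  proof -
    have "2 * \<epsilon> * n = (\<Sum>v\<in>F. 2 * \<epsilon>)" by (simp add: cardF)
    also have "\<dots> \<le> (\<Sum>v\<in>F. Re (cinner v (a v)))"
    proof (rule sum_mono)
      fix v assume "v \<in> F"
      then obtain k where k: "k < n" "v = e k" by (auto simp: F_def)
      have "cinner v (a v) = cinner v (K v)" using aK eE[OF k(1)] k by simp
      also have "\<dots> = \<mu> k" using ee[of k k] k by (simp add: Ke cinner_simps)
      finally show "2 * \<epsilon> \<le> Re (cinner v (a v))" using big[OF k(1)] by simp
    qed
    also have "\<dots> \<le> \<epsilon> * card (level j)" using tr F by (simp add: trace_bounded_def)
    finally show ?thesis .
  qed
  then have "\<epsilon> * real (2 * n) \<le> \<epsilon> * real (card (level j))" by (simp add: mult_ac)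
  then have half: "2 * n \<le> card (level j)" using \<epsilon> by (simp only: mult_le_cancel_left_pos of_nat_le_iff)
  have fin: "finite (g ` level j)" using finite_level' by simp
  from orthonormal_extension[OF fin level_orthonormal F(1) F(3)[unfolded eigenspace_span]]
  obtain F' where F': "F \<subseteq> F'" "F' \<subseteq> eigenspace j" "orthonormal F'" "card F' = card (level j)"
    by (auto simp: card_level eigenspace_span)
  have finF': "finite F'" using orthonormal_finite_card(1)[OF fin F'(3)] F'(2) by (simp add: eigenspace_span)
  have "card F \<le> card (F' - F)" using half F' F(2) cardF by (simp add: card_Diff_subset)
  then obtain w where w: "w ` F \<subseteq> F' - F" "inj_on w F" using card_le_inj[of F "F' - F"] F(2) finF' by auto
  have "orthonormal (F \<union> w ` F)" using F'(1) w(1) by (intro orthonormal_subset[OF F'(3)]) blast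
  moreover have "Re (cinner x (a x)) \<le> 2 * \<epsilon> * (norm x)\<^sup>2 + (\<delta> - 2 * \<epsilon>) * (\<Sum>v\<in>F. (cmod (cinner v x))\<^sup>2)"
    if x: "x \<in> eigenspace j" for x
  proof -
    define y where "y = (\<Sum>v\<in>F. cinner v x *\<^sub>C v)"
    define s where "s = (\<Sum>v\<in>F. (cmod (cinner v x))\<^sup>2)"
    define z where "z = x - y"
    have yE: "y \<in> eigenspace j" unfolding y_def using F(3) by (intro eigenspace_sum eigenspace_scaleC) auto
    have nz: "(norm z)\<^sup>2 = (norm x)\<^sup>2 - s" unfolding z_def y_def s_def by (rule Bessel_orthonormal(1)[OF F(2,1)])
    have vz: "cinner v z = 0" if "v \<in> F" for v
      unfolding z_def y_def by (rule orthonormal_residual[OF F(2,1) that])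
    have yz: "cinner y z = 0" unfolding y_def by (simp add: cinner.sum_left cinner_simps vz)
    have xyz: "x = y + z" by (simp add: z_def)
    have "(norm x)\<^sup>2 = (norm y)\<^sup>2 + (norm z)\<^sup>2" unfolding xyz norm_add_squared yz by simp
    then have ny: "(norm y)\<^sup>2 = s" using nz by simp
    have zKy: "cinner z (K y) = 0"
    proof -
      have "cinner z (K v) = 0" if "v \<in> F" for v
      proof -
        obtain k where "v = e k" using \<open>v \<in> F\<close> by (auto simp: F_def)
        then show ?thesis using vz[OF that] cinner_zero_commute by (metis Ke cinner_scaleR_right mult_zero_right)
      qed
      then show ?thesis
        unfolding y_def bounded_operators_sum[OF J_bounded[OF KJ]] bounded_operators_scaleC[OF J_bounded[OF KJ]]
        by (simp add: cinner.sum_right cinner_simps)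
    qed
    have yKz: "cinner y (K z) = 0" using zKy positive_form_bound(1)[OF K, of y z] by simp
    have "cinner x (a x) = cinner x (K x)" using aK[OF x x] by simp
    also have "\<dots> = cinner y (K y) + cinner z (K z)"
      unfolding xyz bounded_operators_add[OF J_bounded[OF KJ]] by (simp add: cinner_simps zKy yKz)
    finally have "Re (cinner x (a x)) = Re (cinner y (a y)) + Re (cinner z (K z))" using aK[OF yE yE] by simp
    moreover have "Re (cinner y (a y)) \<le> \<delta> * s" using \<delta> yE ny by (auto simp: bounded_on_levels_def)
    moreover have "Re (cinner z (K z)) \<le> \<mu> n * (norm z)\<^sup>2" by (rule rest) (simp add: vz F_def)
    moreover have "\<mu> n * (norm z)\<^sup>2 \<le> 2 * \<epsilon> * (norm z)\<^sup>2" by (intro mult_right_mono \<mu>n) simp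
    ultimately have "Re (cinner x (a x)) \<le> \<delta> * s + 2 * \<epsilon> * ((norm x)\<^sup>2 - s)" unfolding nz by linarith
    then show ?thesis by (simp add: s_def[symmetric] algebra_simps)
  qed
  ultimately show ?thesis
    using F w F'(2) by (intro exI[of _ F] exI[of _ w]) auto
qed

text \<open>The reflection \<open>U\<close> exchanges the vectors \<open>v\<close> of the preceding lemma with their partners \<open>w v\<close>, in
  all levels at once. It commutes with \<open>D\<close>, so \<open>f (U a U D) = f (a D)\<close>, and in
  \<open>(a + U a U) / 2\<close> each large eigenvalue of the compressions of \<open>a\<close> is averaged with a value at most \<open>2 \<epsilon>\<close>.\<close>

lemma halving:
  assumes a: "a \<in> positive_operators" and tr: "trace_bounded a \<epsilon>" and \<epsilon>: "0 < \<epsilon>"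
    and \<delta>: "bounded_on_levels a \<delta>" "2 * \<epsilon> \<le> \<delta>"
  shows "\<exists>a'\<in>positive_operators. trace_bounded a' \<epsilon> \<and> bounded_on_levels a' (\<delta> / 2 + \<epsilon>) \<and> f (a' \<circ> D) = f (a \<circ> D)"
proof -
  note ab = positive_bounded[OF a]
  obtain F w where orth: "\<And>j. orthonormal (F j \<union> w j ` F j)" and finF: "\<And>j. finite (F j)"
    and inj: "\<And>j. inj_on (w j) (F j)" and disj: "\<And>j. F j \<inter> w j ` F j = {}"
    and FE: "\<And>j. F j \<subseteq> eigenspace j" and wE: "\<And>j. w j ` F j \<subseteq> eigenspace j"
    and heavy: "\<And>j x. x \<in> eigenspace j \<Longrightarrow>
      Re (cinner x (a x)) \<le> 2 * \<epsilon> * (norm x)\<^sup>2 + (\<delta> - 2 * \<epsilon>) * (\<Sum>v\<in>F j. (cmod (cinner v x))\<^sup>2)"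
    using heavy_vectors[OF a tr \<epsilon> \<delta>(1)] by metis
  \<comment> \<open>The reflection in the orthogonal complement of the unit vectors \<open>(v - w v) / \<surd>2\<close> exchanges \<open>v\<close>
    and \<open>w v\<close>.\<close>
  define \<rho> where "\<rho> j v = (1 / sqrt 2) *\<^sub>R (v - w j v)" for j v
  define S where "S = (\<Union>j. \<rho> j ` F j)"
  have \<rho>E: "\<rho> j v \<in> eigenspace j" if "v \<in> F j" for j v
  proof -
    have "v - w j v \<in> eigenspace j"
      using eigenspace_subspace FE wE that by (intro complex_vector.subspace_diff) blast+
    then show ?thesis unfolding \<rho>_def scaleR_scaleC by (rule eigenspace_scaleC)
  qed
  have inner: "cinner u v = (if u = v then 1 else 0)" "cinner (w j u) (w j v) = (if u = v then 1 else 0)"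
    "cinner u (w j v) = 0" "cinner (w j u) v = 0" if "u \<in> F j" "v \<in> F j" for j u v
    using orth[of j] disj[of j] inj[of j] that unfolding orthonormal_def inj_on_def by auto
  have S: "orthonormal S"
    unfolding orthonormal_def
  proof (intro ballI)
    fix p q assume "p \<in> S" "q \<in> S"
    then obtain i u j v where p: "u \<in> F i" "p = \<rho> i u" and q: "v \<in> F j" "q = \<rho> j v" by (auto simp: S_def)
    have same: "cinner (\<rho> j u) (\<rho> j v) = (if u = v then 1 else 0)" if "u \<in> F j" "v \<in> F j" for u v j
    proof -
      have "cinner (\<rho> j u) (\<rho> j v) = complex_of_real (1 / sqrt 2 * (1 / sqrt 2)) *
          (cinner u v - cinner u (w j v) - (cinner (w j u) v - cinner (w j u) (w j v)))"
        unfolding \<rho>_def cinner_scaleR_left cinner_scaleR_right cinner.diff_left cinner.diff_right of_real_mult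
        by (simp only: mult.assoc) (simp add: algebra_simps)
      also have "1 / sqrt 2 * (1 / sqrt 2) = (1/2 :: real)" by simp
      finally show ?thesis by (simp add: inner[OF that])
    qed
    show "cinner p q = (if p = q then 1 else 0)"
    proof (cases "i = j")
      case True
      with p have u: "u \<in> F j" "p = \<rho> j u" by simp_all
      show ?thesis
      proof (cases "u = v")
        case True
        then show ?thesis using same[OF u(1) q(1)] u(2) q(2) by simp
      next
        case False
        then have 0: "cinner p q = 0" using same[OF u(1) q(1)] u(2) q(2) by simp
        moreover have "cinner p p = 1" using same[OF u(1) u(1)] u(2) by simp
        ultimately have "p \<noteq> q" by force
        then show ?thesis using 0 by simp
      qed
    next
      case False
      then have 0: "cinner p q = 0"
        unfolding p(2) q(2) by (rule eigenspace_orthogonal[OF \<rho>E[OF p(1)] \<rho>E[OF q(1)]])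
      moreover have "cinner p p = 1" using same[OF p(1) p(1)] p(2) by simp
      ultimately have "p \<noteq> q" by force
      then show ?thesis using 0 by simp
    qed
  qed
  have "countable S" unfolding S_def by (rule countable_UN) (auto intro!: countable_finite finite_imageI finF)
  from orthonormal_enumeration[OF this S] obtain r
    where r: "orthosystem r" and Sr: "S \<subseteq> range r" and rS: "range r \<subseteq> insert 0 S" by auto
  have one: "\<bar>1::real\<bar> \<le> 1" for n :: nat by simp
  define R where "R = schmidt (\<lambda>_. 1) r r"
  have Rb: "R \<in> bounded_operators" unfolding R_def by (rule schmidt_bounded_operator[OF r r one])
  have Radj: "is_adjoint R R" unfolding R_def by (rule schmidt_adjoint[OF r r one])
  have Rr: "R (r n) = r n" for n
  proof (cases "r n = 0")
    case False
    then show ?thesis using schmidt_system[where c="\<lambda>_. 1", OF r r one] by (simp add: R_def)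
  qed (simp add: bounded_operators_zero[OF Rb])
  have Rsums: "(\<lambda>n. cinner (r n) x *\<^sub>C r n) sums R x" for x
    using schmidt_sums[where c="\<lambda>_. 1" and x=x, OF r r one] by (simp add: R_def)
  have RR: "R (R x) = R x" for x
  proof -
    have "(\<lambda>n. cinner (r n) x *\<^sub>C r n) sums R (R x)"
      using bounded_linear.sums[OF bounded_operators_linear[OF Rb] Rsums[of x]]
      by (simp add: bounded_operators_scaleC[OF Rb] Rr)
    from sums_unique2[OF this Rsums] show ?thesis .
  qed
  have DR: "D (R x) = R (D x)" for x
  proof -
    have "(\<lambda>n. cinner (r n) x *\<^sub>C D (r n)) sums D (R x)"
      using bounded_linear.sums[OF bounded_operators_linear[OF D_bounded] Rsums[of x]]
      by (simp add: bounded_operators_scaleC[OF D_bounded])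
    moreover have "cinner (r n) x *\<^sub>C D (r n) = cinner (r n) (D x) *\<^sub>C r n" for n
    proof -
      have "r n = 0 \<or> r n \<in> S" using rS by blast
      then have "\<exists>j. r n \<in> eigenspace j"
      proof
        assume "r n = 0"
        then show ?thesis using eigenspace_zero[of 0] by auto
      next
        assume "r n \<in> S"
        then obtain j v where "v \<in> F j" "r n = \<rho> j v" by (auto simp: S_def)
        then show ?thesis using \<rho>E[of v j] by auto
      qed
      then obtain j where "r n \<in> eigenspace j" ..
      then have "D (r n) = (1/2) ^ j *\<^sub>R r n" by (simp add: eigenspace_def)
      moreover have "cinner (D (r n)) x = cinner (r n) (D x)"
        using positive_self_adjoint[OF D_positive] by (simp add: is_adjoint_def)
      ultimately show ?thesis by (metis cinner_scaleR_left mult.commute scaleC_scaleC scaleR_scaleC)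
    qed
    ultimately have "(\<lambda>n. cinner (r n) (D x) *\<^sub>C r n) sums D (R x)" by (simp only:)
    from sums_unique2[OF this Rsums] show ?thesis .
  qed
  define U where "U x = x - 2 *\<^sub>R R x" for x
  have Ub: "U \<in> bounded_operators"
    unfolding U_def[abs_def] by (intro diff_bounded_operator id_bounded_operator scaleR_bounded_operator Rb)
  have Uadj: "is_adjoint U U"
    unfolding U_def[abs_def] by (intro is_adjoint_diff is_adjoint_id is_adjoint_scaleR Radj)
  have UU: "U (U x) = x" for x
    by (simp add: U_def bounded_operators_diff[OF Rb] bounded_operators_scaleR[OF Rb] RR) (simp add: scaleR_2)
  have UD: "U (D x) = D (U x)" for x
    by (simp add: U_def bounded_operators_diff[OF D_bounded] bounded_operators_scaleR[OF D_bounded] DR)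
  have UE: "U x \<in> eigenspace j" if "x \<in> eigenspace j" for x j
    using that by (simp add: eigenspace_def UD[symmetric] bounded_operators_scaleR[OF Ub])
  have Ucinner: "cinner (U x) (U y) = cinner x y" for x y
    using Uadj UU by (simp add: is_adjoint_def)
  have Uv: "U v = w j v" if v: "v \<in> F j" for j v
  proof -
    have "cinner (r n) (v + w j v) = 0" for n
    proof (cases "r n = 0")
      case False
      then obtain i u where u: "u \<in> F i" "r n = \<rho> i u" using rS by (force simp: S_def)
      show ?thesis
      proof (cases "i = j")
        case True
        then show ?thesis using inner[of u j v] u v by (simp add: \<rho>_def cinner_simps)
      next
        case False
        have "v \<in> eigenspace j" "w j v \<in> eigenspace j" using FE wE v by blast+
        then have "v + w j v \<in> eigenspace j" by (rule eigenspace_add)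
        then show ?thesis using eigenspace_orthogonal[OF \<rho>E[OF u(1)] _ False] u(2) by simp
      qed
    qed (simp add: cinner.zero_left)
    then have "R (v + w j v) = 0" using Rsums[of "v + w j v"] sums_unique2[OF _ sums_zero] by (simp add: scaleC.zero_left)
    moreover have "R (\<rho> j v) = \<rho> j v"
    proof -
      have "\<rho> j v \<in> range r" using Sr v by (auto simp: S_def)
      then show ?thesis using Rr by auto
    qed
    then have "R (v - w j v) = v - w j v" by (simp add: \<rho>_def bounded_operators_scaleR[OF Rb])
    ultimately have "R ((v + w j v) + (v - w j v)) = v - w j v"
      by (simp only: bounded_operators_add[OF Rb]) simp
    then have "R (2 *\<^sub>R v) = v - w j v" by (simp add: scaleR_2)
    then show ?thesis by (simp add: U_def bounded_operators_scaleR[OF Rb])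
  qed
  define a' where "a' x = (1/2) *\<^sub>R (a x + (U \<circ> (a \<circ> U)) x)" for x
  have a': "a' \<in> positive_operators"
    unfolding a'_def[abs_def] by (intro positive_scaleR positive_add a conjugate_positive Ub Uadj) simp
  have form: "Re (cinner x (a' x)) = (Re (cinner x (a x)) + Re (cinner (U x) (a (U x)))) / 2" for x
    using Uadj by (simp add: a'_def cinner_simps is_adjoint_def)
  have "f (a' \<circ> D) = f (a \<circ> D)"
  proof -
    have aDJ: "a \<circ> D \<in> J" by (rule J_left[OF ab D_J])
    have XJ: "a \<circ> (U \<circ> D) \<in> J" by (intro J_left ab Ub D_J)
    have "f (U \<circ> (a \<circ> (U \<circ> D))) = f ((a \<circ> (U \<circ> D)) \<circ> U)" by (rule f_commute[OF Ub XJ])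
    also have "(a \<circ> (U \<circ> D)) \<circ> U = a \<circ> D" by (simp add: fun_eq_iff UD UU)
    finally have fU: "f (U \<circ> (a \<circ> (U \<circ> D))) = f (a \<circ> D)" .
    have "a' \<circ> D = (\<lambda>x. (1/2) *\<^sub>R ((a \<circ> D) x + (U \<circ> (a \<circ> (U \<circ> D))) x))" by (simp add: fun_eq_iff a'_def)
    then have "f (a' \<circ> D) = of_real (1/2) * (f (a \<circ> D) + f (U \<circ> (a \<circ> (U \<circ> D))))"
      using f_scaleR[OF J_add[OF aDJ J_left[OF Ub XJ]], of "1/2"] f_add[OF aDJ J_left[OF Ub XJ]] by simp
    then show ?thesis unfolding fU by simp
  qed
  moreover have "trace_bounded a' \<epsilon>"
    unfolding trace_bounded_def
  proof (intro allI impI)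
    fix j G assume G: "orthonormal G" "G \<subseteq> eigenspace j"
    have injU: "inj_on U G" by (metis UU inj_onI)
    have "orthonormal (U ` G)" using G(1) injU by (auto simp: orthonormal_def Ucinner inj_on_def)
    moreover have "U ` G \<subseteq> eigenspace j" using G(2) UE by blast
    ultimately have "(\<Sum>v\<in>U ` G. Re (cinner v (a v))) \<le> \<epsilon> * card (level j)" using tr by (simp add: trace_bounded_def)
    moreover have "(\<Sum>v\<in>G. Re (cinner v (a v))) \<le> \<epsilon> * card (level j)" using tr G by (simp add: trace_bounded_def)
    ultimately show "(\<Sum>v\<in>G. Re (cinner v (a' v))) \<le> \<epsilon> * card (level j)"
      by (simp add: form sum.reindex[OF injU] sum.distrib flip: sum_divide_distrib)
  qed
  moreover have "bounded_on_levels a' (\<delta> / 2 + \<epsilon>)"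
    unfolding bounded_on_levels_def
  proof (intro allI ballI)
    fix j x assume x: "x \<in> eigenspace j"
    let ?s = "\<Sum>v\<in>F j. (cmod (cinner v x))\<^sup>2" and ?t = "\<Sum>v\<in>w j ` F j. (cmod (cinner v x))\<^sup>2"
    have "norm (U x) = norm x"
    proof -
      have "(norm (U x))\<^sup>2 = (norm x)\<^sup>2" using Ucinner[of x x] by (metis Re_cinner_self)
      then show ?thesis by simp
    qed
    moreover have "(\<Sum>v\<in>F j. (cmod (cinner v (U x)))\<^sup>2) = ?t"
    proof -
      have "cinner v (U x) = cinner (w j v) x" if "v \<in> F j" for v
        using Uv[OF that] Uadj by (metis is_adjoint_def)
      then show ?thesis by (simp add: sum.reindex[OF inj])
    qed
    ultimately have t: "Re (cinner (U x) (a (U x))) \<le> 2 * \<epsilon> * (norm x)\<^sup>2 + (\<delta> - 2 * \<epsilon>) * ?t"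
      using heavy[OF UE[OF x]] by simp
    have "?s + ?t = (\<Sum>v\<in>F j \<union> w j ` F j. (cmod (cinner v x))\<^sup>2)"
      using finF disj by (simp add: sum.union_disjoint)
    also have "\<dots> \<le> (norm x)\<^sup>2" using finF orth by (intro Bessel_orthonormal(2)) auto
    finally have "(\<delta> - 2 * \<epsilon>) * (?s + ?t) \<le> (\<delta> - 2 * \<epsilon>) * (norm x)\<^sup>2" using \<delta>(2) by (intro mult_left_mono) auto
    then have "Re (cinner x (a x)) + Re (cinner (U x) (a (U x))) \<le> 4 * \<epsilon> * (norm x)\<^sup>2 + (\<delta> - 2 * \<epsilon>) * (norm x)\<^sup>2"
      using heavy[OF x] t unfolding distrib_left by linarith
    then show "Re (cinner x (a' x)) \<le> (\<delta> / 2 + \<epsilon>) * (norm x)\<^sup>2" unfolding form by (simp add: field_simps)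
  qed
  ultimately show ?thesis using a' by blast
qed

theorem trace_le_diagonal_bound:
  assumes a: "a \<in> positive_operators" and \<epsilon>: "0 < \<epsilon>"
    and diag: "\<And>m. g m \<noteq> 0 \<Longrightarrow> Re (cinner (g m) (a (g m))) \<le> \<epsilon>"
  shows "Re (f (a \<circ> D)) \<le> 4 * \<epsilon> * Re (f D)"
proof -
  obtain K where K: "K > 0" "\<And>x. Re (cinner x (a x)) \<le> K * (norm x)\<^sup>2"
    using bounded_operators_form_bound[OF positive_bounded[OF a]] by blast
  have iterate: "\<exists>a'\<in>positive_operators. trace_bounded a' \<epsilon> \<and>
      bounded_on_levels a' (2 * \<epsilon> + (1/2) ^ n * K) \<and> f (a' \<circ> D) = f (a \<circ> D)" for n
  proof (induction n)
    case 0
    have "Re (cinner x (a x)) \<le> (2 * \<epsilon> + K) * (norm x)\<^sup>2" for x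
      unfolding distrib_right by (rule add_increasing) (use \<epsilon> K(2) in auto)
    then show ?case using a diagonal_trace_bounded[OF a diag] by (intro bexI[of _ a]) (auto simp: bounded_on_levels_def)
  next
    case (Suc n)
    then obtain a' where a': "a' \<in> positive_operators" "trace_bounded a' \<epsilon>"
      "bounded_on_levels a' (2 * \<epsilon> + (1/2) ^ n * K)" "f (a' \<circ> D) = f (a \<circ> D)" by blast
    have "2 * \<epsilon> \<le> 2 * \<epsilon> + (1/2) ^ n * K" using K(1) by simp
    from halving[OF a'(1,2) \<epsilon> a'(3) this] obtain a'' where a'': "a'' \<in> positive_operators" "trace_bounded a'' \<epsilon>"
      "bounded_on_levels a'' ((2 * \<epsilon> + (1/2) ^ n * K) / 2 + \<epsilon>)" "f (a'' \<circ> D) = f (a' \<circ> D)" by blast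
    have "(2 * \<epsilon> + (1/2) ^ n * K) / 2 + \<epsilon> = 2 * \<epsilon> + (1/2) ^ Suc n * K" by (simp add: field_simps)
    then have "bounded_on_levels a'' (2 * \<epsilon> + (1/2) ^ Suc n * K)" using a''(3) by (simp only:)
    moreover have "f (a'' \<circ> D) = f (a \<circ> D)" using a''(4) a'(4) by (simp only:)
    ultimately show ?case using a''(1,2) by blast
  qed
  have "Re (f (a \<circ> D)) \<le> 2 * (2 * \<epsilon> + (1/2) ^ n * K) * Re (f D)" for n
  proof -
    from iterate[of n] obtain a' where "a' \<in> positive_operators"
      "bounded_on_levels a' (2 * \<epsilon> + (1/2) ^ n * K)" "f (a' \<circ> D) = f (a \<circ> D)" by blast
    then show ?thesis using trace_le_level_bound[of a' "2 * \<epsilon> + (1/2) ^ n * K"] \<epsilon> K(1) by simp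
  qed
  moreover have "(\<lambda>n. 2 * (2 * \<epsilon> + (1/2) ^ n * K) * Re (f D)) \<longlonglongrightarrow> 2 * (2 * \<epsilon> + 0 * K) * Re (f D)"
    by (intro tendsto_intros LIMSEQ_realpow_zero) auto
  ultimately show ?thesis using LIMSEQ_le_const by fastforce
qed

end


section \<open>The domination estimate and normality\<close>

lemma separable_orthonormal_countable:
  fixes S :: "'a::complex_hilbert_space set"
  assumes sep: "separable_space (euclidean :: 'a topology)" and S: "orthonormal S"
  shows "countable S"
proof -
  obtain C :: "'a set" where C: "countable C" "closure C = UNIV"
    using sep by (auto simp: separable_space_def)
  have "\<exists>c\<in>C. dist c x < 1/2" for x
    using C(2) closure_approachable[of x C] by (metis UNIV_I half_gt_zero zero_less_one)
  then obtain c where c: "\<And>x. c x \<in> C" "\<And>x. dist (c x) x < 1/2" by metis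
  have "inj_on c S"
  proof (rule inj_onI, rule ccontr)
    fix x y assume xy: "x \<in> S" "y \<in> S" "c x = c y" "x \<noteq> y"
    have "dist x y < 1"
      using c(2)[of x] c(2)[of y] dist_triangle3[of x y "c x"] xy(3) by simp
    then have "(norm (x - y))\<^sup>2 < 1\<^sup>2" by (intro power_strict_mono) (auto simp: dist_norm)
    moreover have "(norm x)\<^sup>2 = 1" "(norm y)\<^sup>2 = 1" "cinner x y = 0"
      using S xy Re_cinner_self[of x] Re_cinner_self[of y] by (auto simp: orthonormal_def)
    ultimately show False by (simp add: norm_diff_squared)
  qed
  moreover have "countable (c ` S)" by (rule countable_subset[OF _ C(1)]) (use c(1) in auto)
  ultimately show ?thesis by (rule countable_image_inj_on[rotated])
qed

context positive_trace
begin

text \<open>A nonzero eigenvalue \<open>\<kappa>\<close> of \<open>T\<close> is rounded up to \<open>L (1/2)\<^sup>j\<close> with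
  \<open>\<kappa> \<le> L (1/2)\<^sup>j < 2 \<kappa>\<close>. Compactness of \<open>T\<close> makes the levels finite.\<close>

lemma trace_le_eigenbasis_bound:
  assumes sep: "separable_space (euclidean :: 'a topology)"
    and TJ: "T \<in> J" and T: "T \<in> positive_operators"
    and B: "orthonormal_basis B" and eig: "\<forall>b\<in>B. \<exists>l. T b = l *\<^sub>C b"
  shows "\<exists>K\<ge>0. \<forall>a\<in>positive_operators. \<forall>\<epsilon>>0. (\<forall>b\<in>B. Re (cinner b (a b)) \<le> \<epsilon>) \<longrightarrow> Re (f (a \<circ> T)) \<le> K * \<epsilon>"
proof -
  have orthB: "orthonormal B" and dense: "closure (complex_vector.span B) = UNIV"
    using B by (simp_all add: orthonormal_basis_def orthonormal_def)
  from orthonormal_enumeration[OF separable_orthonormal_countable[OF sep orthB] orthB]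
  obtain h where h: "orthosystem h" and Bh: "B \<subseteq> range h" and hB: "range h \<subseteq> insert 0 B" by auto
  note Tb = positive_bounded[OF T]
  define \<kappa> where "\<kappa> m = Re (cinner (h m) (T (h m)))" for m
  have \<kappa>0: "0 \<le> \<kappa> m" for m unfolding \<kappa>_def by (rule positive_Re_ge_0[OF T])
  have h0: "h m \<noteq> 0" if "0 < \<kappa> m" for m using that by (auto simp: \<kappa>_def cinner.zero_left)
  have Th: "T (h m) = \<kappa> m *\<^sub>R h m" for m
  proof (cases "h m = 0")
    case False
    then have "h m \<in> B" using hB by blast
    then obtain l where l: "T (h m) = l *\<^sub>C h m" using eig by blast
    have "cinner (h m) (T (h m)) = l" using False by (simp add: l cinner_simps orthosystem_self[OF h])
    then have "l = complex_of_real (\<kappa> m)"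
      using T by (auto simp: positive_operators_def \<kappa>_def complex_nonneg_Reals_iff complex_eq_iff)
    then show ?thesis by (simp add: l scaleR_scaleC)
  qed (simp add: bounded_operators_zero[OF Tb])
  obtain L where L: "L > 0" "\<And>x. norm (T x) \<le> L * norm x" using bounded_operators_bound[OF Tb] by blast
  have \<kappa>L: "\<kappa> m \<le> L" for m
  proof (cases "h m = 0")
    case False
    then have "norm (h m) = 1" using h by (auto simp: orthosystem_def)
    then show ?thesis using L(2)[of "h m"] \<kappa>0[of m] by (simp add: Th)
  qed (use L(1) in \<open>simp add: \<kappa>_def cinner.zero_left\<close>)
  define lev where "lev m = (LEAST j. L * (1/2) ^ Suc j < \<kappa> m)" for m
  have lev: "L * (1/2) ^ Suc (lev m) < \<kappa> m" "\<kappa> m \<le> L * (1/2) ^ lev m" if "0 < \<kappa> m" for m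
  proof -
    have "\<kappa> m / L > 0" using that L(1) by simp
    from real_arch_pow_inv[OF this, of "1/2"] obtain j where "(1/2::real) ^ j < \<kappa> m / L" by auto
    moreover have "(1/2::real) ^ Suc j \<le> (1/2) ^ j" by simp
    ultimately have "(1/2) ^ Suc j < \<kappa> m / L" by linarith
    then have ex: "L * (1/2) ^ Suc j < \<kappa> m" using L(1) by (simp add: pos_less_divide_eq mult.commute)
    then show "L * (1/2) ^ Suc (lev m) < \<kappa> m" unfolding lev_def by (rule LeastI)
    show "\<kappa> m \<le> L * (1/2) ^ lev m"
    proof (cases "lev m")
      case 0 then show ?thesis using \<kappa>L by simp
    next
      case (Suc k)
      then have "\<not> L * (1/2) ^ Suc k < \<kappa> m"
        using not_less_Least[of k "\<lambda>j. L * (1/2) ^ Suc j < \<kappa> m"] by (simp add: lev_def)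
      then show ?thesis using Suc by simp
    qed
  qed
  define g where "g m = (if 0 < \<kappa> m then h m else 0)" for m
  have g: "orthosystem g"
    using h by (auto simp: g_def orthosystem_def cinner.zero_left cinner.zero_right)
  have fin: "finite {m. g m \<noteq> 0 \<and> lev m = j}" for j
  proof (rule ccontr)
    let ?S = "{m. g m \<noteq> 0 \<and> lev m = j}"
    assume inf: "infinite ?S"
    define u where "u n = h (enumerate ?S n)" for n
    have S: "0 < \<kappa> (enumerate ?S n)" "lev (enumerate ?S n) = j" for n
      using enumerate_in_set[OF inf, of n] by (auto simp: g_def split: if_splits)
    show False
    proof (rule compact_eigenvalues_not_bounded_below[where u=u and c="\<lambda>n. \<kappa> (enumerate ?S n)",
          OF J_compact[OF TJ]])
      show "norm (u n) = 1" for n using h h0[OF S(1)] by (auto simp: u_def orthosystem_def)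
      show "T (u n) = \<kappa> (enumerate ?S n) *\<^sub>R u n" for n by (simp add: u_def Th)
      show "L * (1/2) ^ Suc j \<le> \<kappa> (enumerate ?S n)" for n using lev(1)[OF S(1)[of n]] unfolding S(2) by simp
      show "0 < L * (1/2) ^ Suc j" using L(1) by simp
      show "cinner (u m) (u n) = 0" if "m \<noteq> n" for m n
        unfolding u_def
      proof (rule orthosystem_orth[OF h])
        show "enumerate ?S m \<noteq> enumerate ?S n"
          using enumerate_mono[OF _ inf, of m n] enumerate_mono[OF _ inf, of n m] that
          by (cases m n rule: linorder_cases) auto
      qed
    qed
  qed
  have w1: "\<bar>(1/2::real) ^ lev m\<bar> \<le> 1" for m by (simp add: power_le_one)
  let ?D = "schmidt (\<lambda>m. (1/2) ^ lev m) g g"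
  have DJ: "?D \<in> J"
  proof -
    define c where "c m = (if 0 < \<kappa> m then (1/2) ^ lev m / \<kappa> m else 0)" for m
    have c: "\<bar>c m\<bar> \<le> 2 / L" for m
    proof (cases "0 < \<kappa> m")
      case True
      then show ?thesis using lev(1)[OF True] L(1) by (simp add: c_def field_simps)
    qed (use L(1) in \<open>simp add: c_def\<close>)
    have "?D x = T (schmidt c g g x)" for x
    proof (rule sums_unique2)
      show "(\<lambda>m. (complex_of_real (c m) * cinner (g m) x) *\<^sub>C T (g m)) sums T (schmidt c g g x)"
        by (rule bounded_operator_schmidt_sums[where c=c, OF g g c Tb])
      have "(complex_of_real (c m) * cinner (g m) x) *\<^sub>C T (g m)
          = (complex_of_real ((1/2) ^ lev m) * cinner (g m) x) *\<^sub>C g m" for m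
      proof (cases "0 < \<kappa> m")
        case True
        then have "T (g m) = complex_of_real (\<kappa> m) *\<^sub>C g m" by (simp add: g_def Th scaleR_scaleC)
        moreover have "complex_of_real (c m) * complex_of_real (\<kappa> m) = complex_of_real ((1/2) ^ lev m)"
          using True by (simp add: c_def flip: of_real_mult)
        ultimately show ?thesis by (metis mult.assoc mult.commute scaleC_scaleC)
      next
        case False
        then show ?thesis by (simp add: g_def bounded_operators_zero[OF Tb] scaleC.zero_right)
      qed
      then show "(\<lambda>m. (complex_of_real (c m) * cinner (g m) x) *\<^sub>C T (g m)) sums ?D x"
        using schmidt_sums[where c="\<lambda>m. (1/2) ^ lev m" and x=x, OF g g w1] by (simp only:)
    qed
    then have "?D = T \<circ> schmidt c g g" by (simp add: fun_eq_iff)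
    moreover have "T \<circ> schmidt c g g \<in> J"
      by (rule J_right[OF schmidt_bounded_operator[where c=c, OF g g c] TJ])
    ultimately show ?thesis by (simp only:)
  qed
  interpret dyadic_trace J f g lev
    by unfold_locales (use g fin DJ in auto)
  have \<kappa>abs: "\<bar>\<kappa> m\<bar> \<le> L" for m using \<kappa>0 \<kappa>L by simp
  have "T = schmidt \<kappa> h h"
  proof (rule bounded_operators_ext_span[OF Tb schmidt_bounded_operator[where c=\<kappa>, OF h h \<kappa>abs] dense])
    fix b assume b: "b \<in> B"
    then obtain m where "b = h m" using Bh by blast
    moreover have "b \<noteq> 0" using b orthB by (auto simp: orthonormal_def cinner.zero_left dest!: bspec)
    ultimately show "T b = schmidt \<kappa> h h b"
      using schmidt_system[where c=\<kappa>, OF h h \<kappa>abs] Th by simp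
  qed
  then have T_sums: "(\<lambda>m. \<kappa> m * (cmod (cinner (h m) x))\<^sup>2) sums Re (cinner x (T x))" for x
    using schmidt_form_sums[where c=\<kappa>, OF h \<kappa>abs] by simp
  have LDJ: "(\<lambda>x. L *\<^sub>R D x) \<in> J" by (rule J_scaleR[OF D_J])
  have le: "(\<lambda>x. L *\<^sub>R D x - T x) \<in> positive_operators"
  proof (rule positive_operatorsI[OF J_bounded[OF J_diff[OF LDJ TJ]]])
    show "is_adjoint (\<lambda>x. L *\<^sub>R D x - T x) (\<lambda>x. L *\<^sub>R D x - T x)"
      by (intro is_adjoint_diff is_adjoint_scaleR positive_self_adjoint[OF T] positive_self_adjoint[OF D_positive])
    fix x
    have "\<kappa> m * (cmod (cinner (h m) x))\<^sup>2 \<le> L * ((1/2) ^ lev m * (cmod (cinner (g m) x))\<^sup>2)" for m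
    proof (cases "0 < \<kappa> m")
      case True
      then show ?thesis using mult_right_mono[OF lev(2)[OF True], of "(cmod (cinner (h m) x))\<^sup>2"] by (simp add: g_def mult.assoc)
    next
      case False
      then have "\<kappa> m = 0" using \<kappa>0[of m] by simp
      then show ?thesis using L(1) by simp
    qed
    from sums_le[OF this T_sums sums_mult[OF D_form_sums]]
    show "0 \<le> Re (cinner x (L *\<^sub>R D x - T x))" by (simp add: cinner_simps)
  qed
  show ?thesis
  proof (intro exI[of _ "4 * L * Re (f D)"] conjI ballI allI impI)
    show "0 \<le> 4 * L * Re (f D)" using f_nonneg[OF D_J D_positive] L(1) by (simp add: complex_nonneg_Reals_iff)
    fix a and \<epsilon> :: real assume a: "a \<in> positive_operators" and \<epsilon>: "0 < \<epsilon>" and diag: "\<forall>b\<in>B. Re (cinner b (a b)) \<le> \<epsilon>"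
    have "Re (f (a \<circ> T)) \<le> Re (f (a \<circ> (\<lambda>x. L *\<^sub>R D x)))"
      by (rule trace_mono_right[OF a TJ LDJ le])
    also have "a \<circ> (\<lambda>x. L *\<^sub>R D x) = (\<lambda>x. L *\<^sub>R (a \<circ> D) x)"
      by (simp add: fun_eq_iff bounded_operators_scaleR[OF positive_bounded[OF a]])
    also have "f \<dots> = of_real L * f (a \<circ> D)" by (rule f_scaleR[OF J_left[OF positive_bounded[OF a] D_J]])
    also have "Re \<dots> = L * Re (f (a \<circ> D))" by simp
    also have "\<dots> \<le> L * (4 * \<epsilon> * Re (f D))"
    proof (intro mult_left_mono trace_le_diagonal_bound[OF a \<epsilon>])
      fix m assume "g m \<noteq> 0"
      then have "g m \<in> B" using hB by (auto simp: g_def split: if_splits)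
      then show "Re (cinner (g m) (a (g m))) \<le> \<epsilon>" using diag by blast
    qed (use L(1) in simp)
    also have "\<dots> = 4 * L * Re (f D) * \<epsilon>" by simp
    finally show "Re (f (a \<circ> T)) \<le> 4 * L * Re (f D) * \<epsilon>" .
  qed
qed

lemma trace_Cauchy_Schwarz:
  assumes TJ: "T \<in> J" and T: "T \<in> positive_operators"
    and a: "a \<in> bounded_operators" and a': "a' \<in> bounded_operators" and adj: "is_adjoint a a'"
  shows "(cmod (f (a \<circ> T)))\<^sup>2 \<le> Re (f T) * Re (f ((a' \<circ> a) \<circ> T))"
proof -
  have real: "complex_of_real (Re (f S)) = f S" if "S \<in> J" "S \<in> positive_operators" for S
    using f_nonneg[OF that] by (simp add: complex_nonneg_Reals_iff complex_eq_iff)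
  have sandwich: "f ((b' \<circ> b) \<circ> T) \<in> \<real>\<^sub>\<ge>\<^sub>0"
    if b: "b \<in> bounded_operators" "b' \<in> bounded_operators" "is_adjoint b b'" for b b'
    by (rule trace_comp_nonneg[OF adjoint_comp_self_positive[OF b] TJ T])
  have aT: "a \<circ> T \<in> J" and a'T: "a' \<circ> T \<in> J" and aaT: "(a' \<circ> a) \<circ> T \<in> J"
    by (intro J_left comp_bounded_operator a a' TJ)+
  have "complex_of_real (Re (f T)) + t * f (a \<circ> T) + cnj t * f (a' \<circ> T)
      + complex_of_real ((cmod t)\<^sup>2 * Re (f ((a' \<circ> a) \<circ> T))) \<in> \<real>\<^sub>\<ge>\<^sub>0" for t
  proof -
    define b where "b x = x + t *\<^sub>C a x" for x
    define b' where "b' x = x + cnj t *\<^sub>C a' x" for x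
    have bb: "b \<in> bounded_operators" "b' \<in> bounded_operators"
      unfolding b_def[abs_def] b'_def[abs_def] by (intro bounded_operator_intros a a')+
    have adjb: "is_adjoint b b'"
      using adj by (simp add: is_adjoint_def b_def b'_def cinner_simps)
    have "(b' \<circ> b) \<circ> T = (\<lambda>x. (T x + t *\<^sub>C (a \<circ> T) x) + (cnj t *\<^sub>C (a' \<circ> T) x + (t * cnj t) *\<^sub>C ((a' \<circ> a) \<circ> T) x))"
      by (simp add: fun_eq_iff b_def b'_def bounded_operators_add[OF a'] bounded_operators_scaleC[OF a']
          scaleC_add_right scaleC_scaleC mult.commute)
    then have "f ((b' \<circ> b) \<circ> T) = (f T + t * f (a \<circ> T)) + (cnj t * f (a' \<circ> T) + (t * cnj t) * f ((a' \<circ> a) \<circ> T))"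
      using f_add[OF J_add[OF TJ J_scaleC[OF aT, of t]] J_add[OF J_scaleC[OF a'T, of "cnj t"] J_scaleC[OF aaT, of "t * cnj t"]]]
        f_add[OF TJ J_scaleC[OF aT, of t]] f_add[OF J_scaleC[OF a'T, of "cnj t"] J_scaleC[OF aaT, of "t * cnj t"]]
        f_scaleC[OF aT, of t] f_scaleC[OF a'T, of "cnj t"] f_scaleC[OF aaT, of "t * cnj t"] by (simp only:)
    moreover have "f ((a' \<circ> a) \<circ> T) = complex_of_real (Re (f ((a' \<circ> a) \<circ> T)))"
      using sandwich[OF a a' adj] by (simp add: complex_nonneg_Reals_iff complex_eq_iff)
    moreover have "complex_of_real ((cmod t)\<^sup>2) = t * cnj t" by (rule complex_norm_square)
    ultimately show ?thesis
      using sandwich[OF bb adjb] real[OF TJ T] by (simp only: of_real_mult add.assoc)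
  qed
  from nonneg_form_bound(2)[OF this] show ?thesis .
qed

end

lemma vector_functional_normal:
  fixes N :: "('a::complex_hilbert_space \<Rightarrow> 'a) set"
  shows "continuous_map (subtopology ultraweak_topology N) euclidean (\<lambda>A. cinner y (A h))"
proof (rule continuous_map_from_subtopology)
  let ?S = "{{A \<in> bounded_operators. (\<Sum>n. cinner (x n) (A (y n))) \<in> U} | (x :: nat \<Rightarrow> 'a) y U.
      summable (\<lambda>n. (norm (x n))\<^sup>2) \<and> summable (\<lambda>n. (norm (y n))\<^sup>2) \<and> open U}"
  let ?x = "\<lambda>n::nat. if n = 0 then y else 0" and ?y = "\<lambda>n::nat. if n = 0 then h else 0"
  have sum: "(\<Sum>n. cinner (?x n) (A (?y n))) = cinner y (A h)" for A :: "'a \<Rightarrow> 'a"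
    using suminf_finite[of "{0}" "\<lambda>n. cinner (?x n) (A (?y n))"] by (simp add: cinner.zero_left)
  have "summable (\<lambda>n. (norm (?x n))\<^sup>2)" "summable (\<lambda>n. (norm (?y n))\<^sup>2)"
    by (rule summable_finite[of "{0}"]; simp)+
  then have basic: "{A \<in> bounded_operators. cinner y (A h) \<in> U} \<in> ?S" if "open U" for U
    using that sum by (intro CollectI exI[of _ ?x] exI[of _ ?y] exI[of _ U]) simp
  have "\<Union>?S = bounded_operators"
    using basic[of UNIV] by auto
  then have top: "topspace ultraweak_topology = (bounded_operators :: ('a \<Rightarrow> 'a) set)"
    by (simp add: ultraweak_topology_def)
  show "continuous_map ultraweak_topology euclidean (\<lambda>A. cinner y (A h))"
    unfolding continuous_map_def top
  proof (intro conjI allI impI)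
    fix U :: "complex set" assume "openin euclidean U"
    then have "open U" by simp
    then show "openin ultraweak_topology {A \<in> bounded_operators. cinner y (A h) \<in> U}"
      unfolding ultraweak_topology_def by (rule topology_generated_by_Basis[OF basic])
  qed auto
qed

theorem theorem6p2:
  fixes N J :: "('a::complex_hilbert_space \<Rightarrow> 'a) set"
    and T :: "'a \<Rightarrow> 'a"
    and f :: "('a \<Rightarrow> 'a) \<Rightarrow> complex"
  assumes "separable_space (euclidean :: 'a topology)"
    and "weakly_closed_star_subalgebra N"
    and "compact_ideal J" and "finite_rank_operators \<subseteq> J"
    and "T \<in> J" and "T \<in> positive_operators" and "T \<noteq> (\<lambda>_. 0)"
    and "singular_trace_on J f" and "positive_functional_on J f"
    and "\<exists>h. dominated N h T"
  shows "(\<lambda>a. f (a \<circ> T)) \<in> predual N"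
proof -
  note N = assms(2) and TJ = assms(5) and T = assms(6)
  interpret positive_trace J f
    by unfold_locales (use assms in \<open>auto simp: singular_trace_on_def\<close>)
  obtain h B where B: "orthonormal_basis B" "\<forall>b\<in>B. \<exists>l. T b = l *\<^sub>C b"
    and dom: "\<And>b P. b \<in> B \<Longrightarrow> P \<in> N \<Longrightarrow> P \<in> projection_operators \<Longrightarrow> norm (P b) \<le> norm (P h)"
    using assms(10) unfolding dominated_def by blast
  obtain K where K: "K \<ge> 0" and trace_bound: "\<And>a \<epsilon>. a \<in> positive_operators \<Longrightarrow> 0 < \<epsilon> \<Longrightarrow>
      (\<And>b. b \<in> B \<Longrightarrow> Re (cinner b (a b)) \<le> \<epsilon>) \<Longrightarrow> Re (f (a \<circ> T)) \<le> K * \<epsilon>"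
    using trace_le_eigenbasis_bound[OF assms(1) TJ T B] by blast
  note Nb = star_algebra_bounded[OF N]
  define C where "C = sqrt (Re (f T) * K)"
  have fT: "0 \<le> Re (f T)" using f_nonneg[OF TJ T] by (simp add: complex_nonneg_Reals_iff)
  have bound: "cmod (f (a \<circ> T)) \<le> C * norm (a h)" if a: "a \<in> N" for a
  proof -
    obtain a' where a': "a' \<in> N" "is_adjoint a a'" using N a by (auto simp: weakly_closed_star_subalgebra_def)
    have pos: "a' \<circ> a \<in> positive_operators" by (rule adjoint_comp_self_positive[OF Nb[OF a] Nb[OF a'(1)] a'(2)])
    \<comment> \<open>The summand \<open>1 / Suc n\<close> covers the case \<open>a h = 0\<close>, since \<open>trace_bound\<close> needs a positive number.\<close>
    have "Re (f ((a' \<circ> a) \<circ> T)) \<le> K * ((norm (a h))\<^sup>2 + 1 / Suc n)" for n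
    proof (rule trace_bound[OF pos])
      fix b assume b: "b \<in> B"
      have "Re (cinner b ((a' \<circ> a) b)) \<le> Re (cinner h ((a' \<circ> a) h))"
        by (rule projection_domination_extends[OF N dom[OF b] star_algebra_comp[OF N a'(1) a] pos])
      also have "cinner h ((a' \<circ> a) h) = cinner (a h) (a h)" using a'(2) by (simp add: is_adjoint_def)
      also have "Re \<dots> = (norm (a h))\<^sup>2" by (rule Re_cinner_self)
      finally have "Re (cinner b ((a' \<circ> a) b)) \<le> (norm (a h))\<^sup>2" .
      moreover have "0 \<le> 1 / real (Suc n)" by simp
      ultimately show "Re (cinner b ((a' \<circ> a) b)) \<le> (norm (a h))\<^sup>2 + 1 / Suc n" by linarith
    qed (simp add: add_nonneg_pos)
    moreover have "(\<lambda>n. K * ((norm (a h))\<^sup>2 + 1 / Suc n)) \<longlonglongrightarrow> K * ((norm (a h))\<^sup>2 + 0)"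
      by (intro tendsto_intros LIMSEQ_Suc[OF lim_1_over_n])
    ultimately have le: "Re (f ((a' \<circ> a) \<circ> T)) \<le> K * (norm (a h))\<^sup>2"
      using LIMSEQ_le_const by fastforce
    have "(cmod (f (a \<circ> T)))\<^sup>2 \<le> Re (f T) * Re (f ((a' \<circ> a) \<circ> T))"
      by (rule trace_Cauchy_Schwarz[OF TJ T Nb[OF a] Nb[OF a'(1)] a'(2)])
    also have "\<dots> \<le> Re (f T) * (K * (norm (a h))\<^sup>2)" by (rule mult_left_mono[OF le fT])
    also have "\<dots> = (C * norm (a h))\<^sup>2" using fT K by (simp add: C_def power_mult_distrib)
    finally show ?thesis by (rule power2_le_imp_le) (use fT K in \<open>simp add: C_def\<close>)
  qed
  have aTJ: "a \<circ> T \<in> J" if "a \<in> N" for a by (rule J_left[OF Nb[OF that] TJ])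
  have lin_add: "f ((\<lambda>x. a x + b x) \<circ> T) = f (a \<circ> T) + f (b \<circ> T)" if "a \<in> N" "b \<in> N" for a b
    using f_add[OF aTJ[OF that(1)] aTJ[OF that(2)]] by (simp add: o_def)
  have lin_scale: "f ((\<lambda>x. c *\<^sub>C a x) \<circ> T) = c * f (a \<circ> T)" if "a \<in> N" for a c
    using f_scaleC[OF aTJ[OF that], of c] by (simp add: o_def)
  define V where "V = (\<lambda>a. a h) ` N"
  \<comment> \<open>The functional \<open>a h \<mapsto> f (a T)\<close>; the bound makes the choice of \<open>a\<close> irrelevant.\<close>
  define \<psi> where "\<psi> v = f ((SOME a. a \<in> N \<and> a h = v) \<circ> T)" for v
  have \<psi>: "\<psi> (a h) = f (a \<circ> T)" if a: "a \<in> N" for a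
  proof -
    define b where "b = (SOME b. b \<in> N \<and> b h = a h)"
    have b: "b \<in> N" "b h = a h"
      using someI[of "\<lambda>b. b \<in> N \<and> b h = a h" a] a by (auto simp: b_def)
    have "cmod (f ((\<lambda>x. b x - a x) \<circ> T)) \<le> C * norm (b h - a h)"
      by (rule bound[OF star_algebra_diff[OF N b(1) a]])
    moreover have "f ((\<lambda>x. b x - a x) \<circ> T) = f (b \<circ> T) - f (a \<circ> T)"
      using f_diff[OF aTJ[OF b(1)] aTJ[OF a]] by (simp add: o_def)
    ultimately have "f (b \<circ> T) = f (a \<circ> T)" using b(2) by simp
    then show ?thesis by (simp only: \<psi>_def b_def)
  qed
  have "\<exists>y. \<forall>v\<in>V. \<psi> v = cinner y v"
  proof (rule Riesz_on_subspace[where K=C])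
    show "0 \<in> V" unfolding V_def by (rule image_eqI[OF _ star_algebra_zero[OF N]]) simp
  next
    fix v w assume "v \<in> V" "w \<in> V"
    then obtain a b where ab: "a \<in> N" "v = a h" "b \<in> N" "w = b h" by (auto simp: V_def)
    note sum = star_algebra_add[OF N ab(1,3)]
    show "v + w \<in> V" unfolding V_def ab by (rule image_eqI[OF _ sum]) simp
    show "\<psi> (v + w) = \<psi> v + \<psi> w" using \<psi>[OF sum] \<psi>[OF ab(1)] \<psi>[OF ab(3)] lin_add[OF ab(1,3)] ab by simp
  next
    fix c v assume "v \<in> V"
    then obtain a where a: "a \<in> N" "v = a h" by (auto simp: V_def)
    note scale = star_algebra_scaleC[OF N a(1), of c]
    show "c *\<^sub>C v \<in> V" unfolding V_def a by (rule image_eqI[OF _ scale]) simp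
    show "\<psi> (c *\<^sub>C v) = c * \<psi> v" using \<psi>[OF scale] \<psi>[OF a(1)] lin_scale[OF a(1)] a by simp
  next
    fix v assume "v \<in> V"
    then show "cmod (\<psi> v) \<le> C * norm v" using bound \<psi> by (auto simp: V_def)
  qed
  then obtain y where y: "\<And>a. a \<in> N \<Longrightarrow> f (a \<circ> T) = cinner y (a h)" using \<psi> by (auto simp: V_def)
  have "continuous_map (subtopology ultraweak_topology N) euclidean (\<lambda>a. f (a \<circ> T))"
    by (rule continuous_map_eq[OF vector_functional_normal[of N y h]]) (simp add: y)
  moreover have "linear_functional_on N (\<lambda>a. f (a \<circ> T))"
    using lin_add lin_scale by (simp add: linear_functional_on_def)
  ultimately show ?thesis by (simp add: predual_def)
qed

end
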